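(* \[ \lim_{h\downarrow0}\frac1h\sup_{g\in\mathcal{D}(\mathcal{A}),\,\varepsilon>0}\varphi(h,g,\varepsilon)=I(M^{\pi}), \] where $\varphi(h,g,\varepsilon)=\int\log\frac{g(x)+\varepsilon}{(T_hg)(x)+\varepsilon}M^{\pi}(x)\,dx$ and $I(M^{\pi})=\sup_{u\in\mathcal B_b^+(\mathbb{R}^d),\,\varepsilon>0}\int\frac{-\mathcal{A}(u+\varepsilon)}{u+\varepsilon}M^{\pi}\,dx$.
   Context: Location model $X=\theta+\varepsilon$, $\varepsilon\sim\mathrm{ID}(A,\nu,\gamma)$ on $\mathbb{R}^d$, density $p_{A,\nu,\gamma}(x\mid\theta)$; $\pi$ a symmetric prior, $M^{\pi}(x)=\int p_{A,\nu,\gamma}(x\mid\theta)\pi(\theta)d\theta$. $T_h$ is the semigroup on $L^2(\mathbb{R}^d;\mathsf m)$ ($\mathsf m$ Lebesgue) of the symmetric Lévy process with time-$h$ law $\mathrm{ID}(2hA,h\tilde\nu,0)$, $\tilde\nu(dx)=\nu(dx)+\nu(-dx)$, i.e. $T_hg(x)=\int g(y)p_h(y\mid x)dy$; $\mathcal{A}$ is its generator with domain $\mathcal{D}(\mathcal{A})$. $\mathcal B_b^+(\mathbb{R}^d)$ = bounded nonnegative Borel functions.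
   Formalization: The supremum over g is taken over nonnegative g in D(A), since the logarithm is otherwise undefined; in I the supremum is over u in B_b^+ that also lie in D(A), with A(u+ε) read as Au, since A is only defined on D(A). *)

theory Defs
  imports "HOL-Probability.Probability"
begin

definition charfun_vec :: "(real^'n) measure \<Rightarrow> real^'n \<Rightarrow> complex" where
  "charfun_vec \<mu> \<xi> = (\<integral>x. exp (\<i> * complex_of_real (\<xi> \<bullet> x)) \<partial>\<mu>)"

definition levy_measure :: "(real^'n) measure \<Rightarrow> bool" where
  "levy_measure \<nu> \<longleftrightarrow> sets \<nu> = sets borel \<and> emeasure \<nu> {0} = 0 \<and>
     (\<integral>\<^sup>+x. ennreal (min 1 ((norm x)\<^sup>2)) \<partial>\<nu>) < \<infinity>"

definition levy_exponent :: "real^'n^'n \<Rightarrow> (real^'n) measure \<Rightarrow> real^'n \<Rightarrow> real^'n \<Rightarrow> complex" where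
  "levy_exponent A \<nu> \<gamma> \<xi> =
     \<i> * complex_of_real (\<gamma> \<bullet> \<xi>) - complex_of_real ((\<xi> \<bullet> (A *v \<xi>)) / 2)
     + (\<integral>x. exp (\<i> * complex_of_real (\<xi> \<bullet> x)) - 1
              - \<i> * complex_of_real ((\<xi> \<bullet> x) * indicator (cball 0 1) x) \<partial>\<nu>)"

definition is_ID :: "(real^'n) measure \<Rightarrow> real^'n^'n \<Rightarrow> (real^'n) measure \<Rightarrow> real^'n \<Rightarrow> bool" where
  "is_ID \<mu> A \<nu> \<gamma> \<longleftrightarrow> prob_space \<mu> \<and> sets \<mu> = sets borel \<and>
     (\<forall>\<xi>. charfun_vec \<mu> \<xi> = exp (levy_exponent A \<nu> \<gamma> \<xi>))"

definition ID_law :: "real^'n^'n \<Rightarrow> (real^'n) measure \<Rightarrow> real^'n \<Rightarrow> (real^'n) measure" where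
  "ID_law A \<nu> \<gamma> = (THE \<mu>. is_ID \<mu> A \<nu> \<gamma>)"

definition sym_levy :: "(real^'n) measure \<Rightarrow> (real^'n) measure" where
  "sym_levy \<nu> = measure_of UNIV (sets borel) (\<lambda>B. emeasure \<nu> B + emeasure \<nu> (uminus ` B))"

definition scale_measure_h :: "real \<Rightarrow> (real^'n) measure \<Rightarrow> (real^'n) measure" where
  "scale_measure_h h \<nu> = measure_of UNIV (sets borel) (\<lambda>B. ennreal h * emeasure \<nu> B)"

text \<open>T_h g (x) = int g(y) p_h(y|x) dy, where p_h(.|x) is the law of x + X_h and X_h ~ ID(2hA, h nu~, 0).\<close>
definition semigroup_T :: "real^'n^'n \<Rightarrow> (real^'n) measure \<Rightarrow> real \<Rightarrow> (real^'n \<Rightarrow> real) \<Rightarrow> real^'n \<Rightarrow> real" where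
  "semigroup_T A \<nu> h g x = (\<integral>z. g (x + z) \<partial>(ID_law ((2 * h) *\<^sub>R A) (scale_measure_h h (sym_levy \<nu>)) 0))"

definition L2fun :: "(real^'n \<Rightarrow> real) \<Rightarrow> bool" where
  "L2fun g \<longleftrightarrow> g \<in> borel_measurable lborel \<and> integrable lborel (\<lambda>x. (g x)\<^sup>2)"

definition L2norm :: "(real^'n \<Rightarrow> real) \<Rightarrow> real" where
  "L2norm g = sqrt (\<integral>x. (g x)\<^sup>2 \<partial>lborel)"

definition gen_limit :: "real^'n^'n \<Rightarrow> (real^'n) measure \<Rightarrow> (real^'n \<Rightarrow> real) \<Rightarrow> (real^'n \<Rightarrow> real) \<Rightarrow> bool" where
  "gen_limit A \<nu> g f \<longleftrightarrow> L2fun f \<and>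
     ((\<lambda>h. L2norm (\<lambda>x. (semigroup_T A \<nu> h g x - g x) / h - f x)) \<longlongrightarrow> 0) (at_right 0)"

text \<open>domain D(A) of the L^2 generator, and the generator itself (defined up to a.e.)\<close>
definition gen_dom :: "real^'n^'n \<Rightarrow> (real^'n) measure \<Rightarrow> (real^'n \<Rightarrow> real) \<Rightarrow> bool" where
  "gen_dom A \<nu> g \<longleftrightarrow> L2fun g \<and> (\<exists>f. gen_limit A \<nu> g f)"

definition generator :: "real^'n^'n \<Rightarrow> (real^'n) measure \<Rightarrow> (real^'n \<Rightarrow> real) \<Rightarrow> real^'n \<Rightarrow> real" where
  "generator A \<nu> g = (SOME f. gen_limit A \<nu> g f)"

definition marginal :: "(real^'n \<Rightarrow> real) \<Rightarrow> (real^'n \<Rightarrow> real) \<Rightarrow> real^'n \<Rightarrow> real" where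
  "marginal p \<pi> x = (\<integral>\<theta>. p (x - \<theta>) * \<pi> \<theta> \<partial>lborel)"

definition phi_fun :: "real^'n^'n \<Rightarrow> (real^'n) measure \<Rightarrow> (real^'n \<Rightarrow> real) \<Rightarrow> real \<Rightarrow> (real^'n \<Rightarrow> real) \<Rightarrow> real \<Rightarrow> real" where
  "phi_fun A \<nu> M h g \<epsilon> = (\<integral>x. ln ((g x + \<epsilon>) / (semigroup_T A \<nu> h g x + \<epsilon>)) * M x \<partial>lborel)"

definition fisher_I :: "real^'n^'n \<Rightarrow> (real^'n) measure \<Rightarrow> (real^'n \<Rightarrow> real) \<Rightarrow> ereal" where
  "fisher_I A \<nu> M = Sup {ereal (\<integral>x. - generator A \<nu> u x / (u x + \<epsilon>) * M x \<partial>lborel) | u \<epsilon>.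
      u \<in> borel_measurable borel \<and> bounded (range u) \<and> (\<forall>x. 0 \<le> u x) \<and> gen_dom A \<nu> u \<and> 0 < \<epsilon>}"

end

(* Write M for the marginal density, f = sqrt M, T_h for convolution with the law mu_h of the
   symmetrised process, and E(h) = (1/2) int int (f(x+z) - f(x))^2 dx mu_h(dz). Both sides of the
   identity equal liminf E(h)/h. Upper bounds: exchanging the two ends of a jump preserves
   dx mu_h(dz), so int (w - T_h w)/w M <= E(h) for every weight w bounded away from zero and
   infinity; the logarithmic functional is reduced to this by splitting [0, h] into short steps
   along a resolvent-smoothed g, and the Fisher functional by truncating f, which makes the density
   square integrable and decreases E. Lower bounds: for u = l R_l g with g = min f n, the inequality
   (g - u)/(u + e) >= (g - u)/(g + e) leads in the limit to the energy of f under the law at an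
   exponential time, a Gamma-average of E(t)/t that concentrates at t = 0.
   The law mu_h is meaningful only because an ID law exists (Gaussian part plus an almost surely
   convergent series of compound Poisson variables) and is unique (Fourier inversion against
   Gaussians). *)

theory Submission
  imports Defs
begin

subsection \<open>Gaussian laws on Euclidean space\<close>

text \<open>The liminf is the common value because the two halves of the argument need opposite
  information on E(t)/t. An upper bound wants arbitrarily small times t with E(t) < c t, a lower
  bound wants c t \<le> E(t) at all small t. Hence the upper estimates on the two functionals carry
  a frequency hypothesis, the lower one an eventuality.

  The obstacle is a mismatch of spaces: the generator is an L2 limit and g may be unbounded, while M
  is only integrable, so L2 convergence cannot be tested against M directly. Two remedies recur: a
  family that is also uniformly bounded does vanish against M, and a truncated density is a
  legitimate L2 test function. The shift by \<epsilon> keeps weights away from zero, which makes the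
  logarithm Lipschitz and the quotients bounded.

  Resolvents serve as test functions because lack of memory gives an exact formula for T_h R g - R
  g. It yields at once a Lipschitz bound in time and membership in the domain of the generator. The
  integral of a non-integrable function counts as 0, which stays below the bounds since these are
  nonnegative.\<close>

locale borel_prob = prob_space \<mu> for \<mu> :: "(real^'n) measure" +
  assumes sets_eq [simp, measurable_cong]: "sets \<mu> = sets borel"
begin

lemma space_eq [simp]: "space \<mu> = UNIV"
  using sets_eq_imp_space_eq[OF sets_eq] by simp

lemma in_prob_algebra: "\<mu> \<in> space (prob_algebra borel)"
  by (simp add: space_prob_algebra prob_space_axioms)

lemma integrable_bounded:
  fixes g :: "real^'n \<Rightarrow> 'b::{banach,second_countable_topology}"
  assumes "g \<in> borel_measurable borel" "\<And>x. norm (g x) \<le> C"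
  shows "integrable \<mu> g"
  using assms by (intro integrable_const_bound[where B=C]) auto

end

section \<open>Convolutions and characteristic functions\<close>

lemma borel_prob_convolution:
  assumes "borel_prob \<mu>" "borel_prob \<kappa>"
  shows "borel_prob (\<mu> \<star> \<kappa>)"
proof -
  interpret \<mu>: borel_prob \<mu> by fact
  interpret \<kappa>: borel_prob \<kappa> by fact
  interpret P: pair_prob_space \<mu> \<kappa> ..
  show ?thesis
    unfolding convolution_def
    by (intro borel_prob.intro P.prob_space_distr borel_prob_axioms.intro) auto
qed

lemma integral_convolution:
  fixes g :: "real^'n \<Rightarrow> 'b::{banach,second_countable_topology}"
  assumes "borel_prob \<mu>" "borel_prob \<kappa>"
    and [measurable]: "g \<in> borel_measurable borel" and g: "\<And>x. norm (g x) \<le> C"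
  shows "(\<integral>x. g x \<partial>(\<mu> \<star> \<kappa>)) = (\<integral>x. \<integral>y. g (x + y) \<partial>\<kappa> \<partial>\<mu>)"
proof -
  interpret \<mu>: borel_prob \<mu> by fact
  interpret \<kappa>: borel_prob \<kappa> by fact
  interpret P: pair_prob_space \<mu> \<kappa> ..
  have "(\<integral>x. g x \<partial>(\<mu> \<star> \<kappa>)) = (\<integral>(x, y). g (x + y) \<partial>(\<mu> \<Otimes>\<^sub>M \<kappa>))"
    unfolding convolution_def by (subst integral_distr) (auto simp: case_prod_unfold)
  also have "\<dots> = (\<integral>x. \<integral>y. g (x + y) \<partial>\<kappa> \<partial>\<mu>)"
    by (subst P.integral_fst'[symmetric])
       (auto intro!: P.P.integrable_const_bound[where B=C] simp: g)
  finally show ?thesis .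
qed

lemma norm_exp_i [simp]: "norm (exp (\<i> * complex_of_real r)) = 1"
  by (simp add: norm_exp_i_times)

lemma charfun_convolution:
  assumes "borel_prob \<mu>" "borel_prob \<kappa>"
  shows "charfun_vec (\<mu> \<star> \<kappa>) \<xi> = charfun_vec \<mu> \<xi> * charfun_vec \<kappa> \<xi>"
  unfolding charfun_vec_def
  by (subst integral_convolution[OF assms, where C=1])
     (auto simp: inner_add_right distrib_left exp_add)

lemma charfun_reflect:
  assumes "borel_prob \<mu>"
  shows "charfun_vec (distr \<mu> borel uminus) \<xi> = charfun_vec \<mu> (- \<xi>)"
proof -
  interpret \<mu>: borel_prob \<mu> by fact
  show ?thesis unfolding charfun_vec_def by (subst integral_distr) auto
qed

lemma borel_prob_return: "borel_prob (return borel 0)"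
  by (simp add: borel_prob_def borel_prob_axioms_def prob_space_return)

lemma charfun_return: "charfun_vec (return borel 0) \<xi> = 1"
  unfolding charfun_vec_def by (subst integral_return) auto

lemma charfun_measurable [measurable]:
  assumes "borel_prob \<mu>"
  shows "charfun_vec \<mu> \<in> borel_measurable borel"
proof -
  interpret \<mu>: borel_prob \<mu> by fact
  show ?thesis unfolding charfun_vec_def[abs_def] by measurable
qed

lemma charfun_norm_le:
  assumes "borel_prob \<mu>"
  shows "norm (charfun_vec \<mu> \<xi>) \<le> 1"
proof -
  interpret \<mu>: borel_prob \<mu> by fact
  have "norm (charfun_vec \<mu> \<xi>) \<le> (\<integral>x. norm (exp (\<i> * complex_of_real (\<xi> \<bullet> x))) \<partial>\<mu>)"
    unfolding charfun_vec_def by (rule integral_norm_bound)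
  then show ?thesis by (simp add: \<mu>.prob_space[unfolded \<mu>.space_eq])
qed

text \<open>The law of a standard normal multiple of \<open>v\<close>, that is the Gaussian with
  covariance v v^T. Working with such degenerate pieces avoids densities, which do not exist for
  singular covariances.\<close>

lemma rank_one_gaussian:
  fixes v :: "real^'n"
  shows "\<exists>\<mu>. borel_prob \<mu> \<and> (\<forall>\<xi>. charfun_vec \<mu> \<xi> = exp (complex_of_real (- (\<xi> \<bullet> v)\<^sup>2 / 2)))"
proof (intro exI conjI allI)
  let ?\<mu> = "distr std_normal_distribution borel (\<lambda>s. s *\<^sub>R v)"
  interpret N: real_distribution std_normal_distribution
    by (rule real_dist_normal_dist)
  show "borel_prob ?\<mu>"
    by (intro borel_prob.intro borel_prob_axioms.intro N.prob_space_distr) auto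
  fix \<xi>
  have "charfun_vec ?\<mu> \<xi> = char std_normal_distribution (\<xi> \<bullet> v)"
    unfolding charfun_vec_def char_def by (subst integral_distr) (auto simp: ac_simps)
  then show "charfun_vec ?\<mu> \<xi> = exp (complex_of_real (- (\<xi> \<bullet> v)\<^sup>2 / 2))"
    by (simp only: char_std_normal_distribution exp_of_real)
qed

text \<open>The quadratic polynomial t -> B (x + t y) (x + t y) is nonnegative. If its leading
  coefficient \<open>B y y\<close> vanishes it is affine and its slope must be 0; otherwise its
  value at the minimiser gives the inequality.\<close>

lemma psd_cauchy_schwarz:
  fixes B :: "'a::real_vector \<Rightarrow> 'a \<Rightarrow> real"
  assumes lin: "\<And>x. linear (B x)" and sym: "\<And>x y. B x y = B y x" and pos: "\<And>x. 0 \<le> B x x"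
  shows "(B x y)\<^sup>2 \<le> B x x * B y y"
proof -
  have add2: "B u (v + w) = B u v + B u w" and scale2: "B u (c *\<^sub>R v) = c * B u v" for u v w c
    using linear_add[OF lin] linear_scale[OF lin] by auto
  have add1: "B (v + w) u = B v u + B w u" and scale1: "B (c *\<^sub>R v) u = c * B v u" for u v w c
    using add2 scale2 sym by metis+
  have *: "0 \<le> B x x + 2 * t * B x y + t\<^sup>2 * B y y" for t
    using pos[of "x + t *\<^sub>R y"] sym[of x y]
    by (simp add: add1 add2 scale1 scale2 algebra_simps power2_eq_square)
  show ?thesis
  proof (cases "B y y = 0")
    case True
    have "B x y = 0"
    proof (rule ccontr)
      assume "B x y \<noteq> 0"
      \<comment> \<open>At this t the affine function takes the value -1.\<close>
      then show False using *[of "- (B x x + 1) / (2 * B x y)"] True by (simp add: field_simps)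
    qed
    then show ?thesis using True by simp
  next
    case False
    then have "B y y > 0" using pos[of y] by simp
    with *[of "- B x y / B y y"] show ?thesis
      by (simp add: field_simps power2_eq_square)
  qed
qed

text \<open>Lagrange reduction: a diagonal entry of the form is split off as a square, which leaves a
  positive semidefinite form with one more vanishing diagonal entry.\<close>

lemma gaussian_of_psd_form:
  fixes B :: "real^'n \<Rightarrow> real^'n \<Rightarrow> real"
  assumes "\<And>x. linear (B x)" and "\<And>x y. B x y = B y x" and "\<And>x. 0 \<le> B x x"
  shows "\<exists>\<mu>. borel_prob \<mu> \<and> (\<forall>\<xi>. charfun_vec \<mu> \<xi> = exp (complex_of_real (- B \<xi> \<xi> / 2)))"
  using assms
proof (induction "card {b \<in> Basis. B b b \<noteq> 0}" arbitrary: B rule: less_induct)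
  case less
  note lin = less.prems(1) and sym = less.prems(2) and pos = less.prems(3)
  note cs = psd_cauchy_schwarz[of B, OF lin sym pos]
  show ?case
  proof (cases "\<exists>b\<in>Basis. B b b \<noteq> 0")
    case False
    have "B \<xi> \<xi> = 0" for \<xi>
    proof -
      have z: "B \<xi> b = 0" if "b \<in> Basis" for b using cs[of \<xi> b] False that by auto
      have "B \<xi> \<xi> = B \<xi> (\<Sum>b\<in>Basis. (\<xi> \<bullet> b) *\<^sub>R b)" by (simp add: euclidean_representation)
      also have "\<dots> = (\<Sum>b\<in>Basis. (\<xi> \<bullet> b) * B \<xi> b)"
        by (simp add: linear_sum[OF lin] linear_scale[OF lin])
      finally show ?thesis using z by simp
    qed
    then show ?thesis using borel_prob_return charfun_return by force
  next
    case True
    then obtain e where e: "e \<in> Basis" "B e e \<noteq> 0" by auto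
    then have epos: "B e e > 0" using pos[of e] by simp
    define C where "C = (\<lambda>x y. B x y - B x e * B e y / B e e)"
    have linC: "linear (C x)" for x
      unfolding C_def using linear_add[OF lin] linear_scale[OF lin]
      by (intro linearI) (simp_all add: algebra_simps add_divide_distrib)
    have symC: "C x y = C y x" for x y
      unfolding C_def using sym[of x y] sym[of x e] sym[of y e] by simp
    have posC: "0 \<le> C x x" for x
      unfolding C_def using cs[of x e] epos sym[of x e]
      by (simp add: field_simps power2_eq_square)
    have Cz: "C b b = 0" if "b \<in> Basis" "B b b = 0" for b
      using cs[of b e] that sym[of b e] by (simp add: C_def)
    have "C e e = 0" using epos by (simp add: C_def)
    then have "{b \<in> Basis. C b b \<noteq> 0} \<subset> {b \<in> Basis. B b b \<noteq> 0}" using Cz e by auto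
    then have "card {b \<in> Basis. C b b \<noteq> 0} < card {b \<in> Basis. B b b \<noteq> 0}"
      by (intro psubset_card_mono) auto
    from less.hyps[OF this linC symC posC] obtain \<mu> where
      \<mu>: "borel_prob \<mu>" "\<And>\<xi>. charfun_vec \<mu> \<xi> = exp (complex_of_real (- C \<xi> \<xi> / 2))" by auto
    \<comment> \<open>The vector that represents the functional \<open>B e\<close> divided by
      \<open>sqrt (B e e)\<close>, so that \<open>(\<xi> \<bullet> v)\<^sup>2\<close> is exactly the
      square removed in passing from \<open>B\<close> to \<open>C\<close>.\<close>
    define v where "v = (\<Sum>b\<in>Basis. (B e b / sqrt (B e e)) *\<^sub>R b)"
    have v: "\<xi> \<bullet> v = B e \<xi> / sqrt (B e e)" for \<xi>
    proof -
      have "B e \<xi> = B e (\<Sum>b\<in>Basis. (\<xi> \<bullet> b) *\<^sub>R b)" by (simp add: euclidean_representation)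
      also have "\<dots> = (\<Sum>b\<in>Basis. (\<xi> \<bullet> b) * B e b)"
        by (simp add: linear_sum[OF lin] linear_scale[OF lin])
      finally show ?thesis
        by (simp add: v_def inner_sum_right sum_divide_distrib mult.commute)
    qed
    from rank_one_gaussian[of v] obtain \<kappa> where
      \<kappa>: "borel_prob \<kappa>" "\<And>\<xi>. charfun_vec \<kappa> \<xi> = exp (complex_of_real (- (\<xi> \<bullet> v)\<^sup>2 / 2))" by blast
    have "charfun_vec (\<mu> \<star> \<kappa>) \<xi> = exp (complex_of_real (- B \<xi> \<xi> / 2))" for \<xi>
    proof -
      have "(\<xi> \<bullet> v)\<^sup>2 = B \<xi> e * B e \<xi> / B e e"
        using epos sym[of \<xi> e] by (simp add: v power_divide power2_eq_square)
      then have "- C \<xi> \<xi> / 2 + - (\<xi> \<bullet> v)\<^sup>2 / 2 = - B \<xi> \<xi> / 2"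
        by (simp add: C_def field_simps)
      then show ?thesis
        unfolding charfun_convolution[OF \<mu>(1) \<kappa>(1)] \<mu>(2) \<kappa>(2) exp_add[symmetric] of_real_add[symmetric]
        by simp
    qed
    then show ?thesis using borel_prob_convolution[OF \<mu>(1) \<kappa>(1)] by blast
  qed
qed

lemma gaussian_law:
  fixes A :: "real^'n^'n"
  assumes "transpose A = A" and "\<And>\<xi>. 0 \<le> \<xi> \<bullet> (A *v \<xi>)"
  shows "\<exists>\<mu>. borel_prob \<mu> \<and> (\<forall>\<xi>. charfun_vec \<mu> \<xi> = exp (complex_of_real (- (\<xi> \<bullet> (A *v \<xi>)) / 2)))"
proof (rule gaussian_of_psd_form[where B="\<lambda>x y. x \<bullet> (A *v y)"])
  show "linear (\<lambda>y. x \<bullet> (A *v y))" for x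
    by (intro linearI) (simp_all add: matrix_vector_right_distrib inner_add_right matrix_vector_mult_scaleR)
  show "x \<bullet> (A *v y) = y \<bullet> (A *v x)" for x y
    by (metis assms(1) dot_lmul_matrix inner_commute transpose_matrix_vector)
qed (rule assms(2))

text \<open>Chosen through its characteristic function, the property on which the inversion rests:
  averaging exponentials against it produces \<open>gauss_kernel\<close>.\<close>

definition std_gaussian :: "(real^'n) measure" where
  "std_gaussian = (SOME \<mu>. borel_prob \<mu> \<and> (\<forall>\<xi>. charfun_vec \<mu> \<xi> = exp (complex_of_real (- (norm \<xi>)\<^sup>2 / 2))))"

lemma std_gaussian: "borel_prob (std_gaussian :: (real^'n) measure)"
  and charfun_std_gaussian: "charfun_vec std_gaussian \<xi> = exp (complex_of_real (- (norm (\<xi> :: real^'n))\<^sup>2 / 2))"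
proof -
  have "\<exists>\<mu>::(real^'n) measure. borel_prob \<mu> \<and> (\<forall>\<xi>. charfun_vec \<mu> \<xi> = exp (complex_of_real (- (norm \<xi>)\<^sup>2 / 2)))"
    using gaussian_law[of "mat 1 :: real^'n^'n"] by (simp add: power2_norm_eq_inner transpose_mat)
  from someI_ex[OF this]
  show "borel_prob (std_gaussian :: (real^'n) measure)"
    and "charfun_vec std_gaussian \<xi> = exp (complex_of_real (- (norm (\<xi> :: real^'n))\<^sup>2 / 2))"
    unfolding std_gaussian_def by auto
qed

interpretation std_gaussian: borel_prob std_gaussian
  by (rule std_gaussian)

subsection \<open>Laws are determined by their characteristic functions\<close>

text \<open>It plays two roles: it is the characteristic function of \<open>std_gaussian\<close>,
  and an unnormalised density with respect to Lebesgue measure.\<close>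

definition gauss_kernel :: "real^'n \<Rightarrow> real" where
  "gauss_kernel z = exp (- (norm z)\<^sup>2 / 2)"

lemma gauss_kernel_measurable [measurable]: "gauss_kernel \<in> borel_measurable borel"
  unfolding gauss_kernel_def[abs_def] by measurable

lemma gauss_kernel_pos [simp]: "0 < gauss_kernel z" "0 \<le> gauss_kernel z" "gauss_kernel z \<le> 1"
  by (auto simp: gauss_kernel_def)

text \<open>Parseval's relation: the kernel is written as a characteristic function of
  \<open>std_gaussian\<close>, and the two probability integrals of the bounded exponential are
  exchanged.\<close>

lemma integral_gauss_kernel_eq_charfun:
  assumes "borel_prob \<mu>"
  shows "(\<integral>x. gauss_kernel (s *\<^sub>R (x - y)) \<partial>\<mu>) =
    Re (\<integral>z. charfun_vec \<mu> (s *\<^sub>R z) * exp (- \<i> * complex_of_real (s * (z \<bullet> y))) \<partial>std_gaussian)"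
proof -
  interpret \<mu>: borel_prob \<mu> by fact
  interpret P: pair_prob_space \<mu> std_gaussian ..
  let ?h = "\<lambda>x z. exp (\<i> * complex_of_real ((s *\<^sub>R (x - y)) \<bullet> z))"
  have "(\<integral>z. charfun_vec \<mu> (s *\<^sub>R z) * exp (- \<i> * complex_of_real (s * (z \<bullet> y))) \<partial>std_gaussian)
      = (\<integral>z. \<integral>x. ?h x z \<partial>\<mu> \<partial>std_gaussian)"
  proof (intro Bochner_Integration.integral_cong refl)
    fix z
    have "(\<integral>x. ?h x z \<partial>\<mu>) = (\<integral>x. exp (\<i> * complex_of_real ((s *\<^sub>R z) \<bullet> x)) * exp (- \<i> * complex_of_real (s * (z \<bullet> y))) \<partial>\<mu>)"
      by (intro Bochner_Integration.integral_cong refl)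
         (simp add: exp_add[symmetric] algebra_simps inner_diff_right inner_commute)
    then show "charfun_vec \<mu> (s *\<^sub>R z) * exp (- \<i> * complex_of_real (s * (z \<bullet> y))) = (\<integral>x. ?h x z \<partial>\<mu>)"
      unfolding charfun_vec_def by simp
  qed
  also have "\<dots> = (\<integral>x. \<integral>z. ?h x z \<partial>std_gaussian \<partial>\<mu>)"
    by (subst P.Fubini_integral)
       (auto intro!: P.P.integrable_const_bound[where B=1] simp: case_prod_unfold)
  also have "\<dots> = (\<integral>x. complex_of_real (gauss_kernel (s *\<^sub>R (x - y))) \<partial>\<mu>)"
  proof (intro Bochner_Integration.integral_cong refl)
    fix x
    show "(\<integral>z. ?h x z \<partial>std_gaussian) = complex_of_real (gauss_kernel (s *\<^sub>R (x - y)))"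
      using charfun_std_gaussian[of "s *\<^sub>R (x - y)"] unfolding charfun_vec_def gauss_kernel_def
      by (simp only: exp_of_real)
  qed
  finally show ?thesis by simp
qed

text \<open>A power of sqrt (2 pi). It is left unevaluated, since it serves only as a divisor that
  is positive and finite.\<close>

definition gauss_mass :: "(real^'n) itself \<Rightarrow> ennreal" where
  "gauss_mass _ = (\<integral>\<^sup>+z. ennreal (gauss_kernel (z::real^'n)) \<partial>lborel)"

lemma gauss_mass_finite: "gauss_mass TYPE(real^'n) < \<infinity>"
proof -
  have one: "(\<integral>\<^sup>+s. ennreal (exp (- s\<^sup>2 / 2)) \<partial>lborel) < \<infinity>"
  proof -
    have "integrable lborel (\<lambda>s. sqrt (2 * pi) * std_normal_density s)"
      by (intro integrable_mult_right) (simp add: integrable_normal_density)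
    then have "integrable lborel (\<lambda>s::real. exp (- s\<^sup>2 / 2))"
      by (simp add: std_normal_density_def)
    then show ?thesis by (simp add: integrable_iff_bounded)
  qed
  have "gauss_mass TYPE(real^'n) = (\<integral>\<^sup>+z. (\<Prod>b\<in>Basis. ennreal (exp (- ((z::real^'n) \<bullet> b)\<^sup>2 / 2))) \<partial>lborel)"
    unfolding gauss_mass_def
  proof (intro nn_integral_cong)
    fix z :: "real^'n"
    have "(norm z)\<^sup>2 = (\<Sum>b\<in>Basis. (z \<bullet> b)\<^sup>2)"
      unfolding power2_norm_eq_inner by (subst euclidean_inner) (simp add: power2_eq_square)
    then have "- (norm z)\<^sup>2 / 2 = (\<Sum>b\<in>Basis. - (z \<bullet> b)\<^sup>2 / 2)"
      by (simp add: sum_negf sum_divide_distrib)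
    then have "gauss_kernel z = (\<Prod>b\<in>Basis. exp (- (z \<bullet> b)\<^sup>2 / 2))"
      unfolding gauss_kernel_def by (simp add: exp_sum)
    then show "ennreal (gauss_kernel z) = (\<Prod>b\<in>Basis. ennreal (exp (- (z \<bullet> b)\<^sup>2 / 2)))"
      by (simp add: prod_ennreal)
  qed
  also have "\<dots> = (\<Prod>b\<in>(Basis::(real^'n) set). \<integral>\<^sup>+s. ennreal (exp (- s\<^sup>2 / 2)) \<partial>lborel)"
    by (rule nn_integral_lborel_prod) auto
  also have "\<dots> < \<infinity>"
    using one by (simp add: power_less_top_ennreal)
  finally show ?thesis .
qed

lemma gauss_mass_pos: "0 < gauss_mass TYPE(real^'n)"
proof -
  have "gauss_mass TYPE(real^'n) \<noteq> 0"
  proof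
    assume "gauss_mass TYPE(real^'n) = 0"
    then have "AE z in lborel. gauss_kernel (z::real^'n) = 0"
      unfolding gauss_mass_def by (subst (asm) nn_integral_0_iff_AE) (auto simp: order.antisym)
    then have "AE z::real^'n in lborel. False"
      by eventually_elim (metis gauss_kernel_pos(1) less_irrefl)
    then show False by (simp add: eventually_False ae_filter_eq_bot_iff)
  qed
  then show ?thesis by (simp add: zero_less_iff_neq_zero)
qed

text \<open>A functional of the characteristic function alone, which is what makes it serve both
  uniqueness of laws and measurability of families of laws.\<close>

definition gauss_inversion :: "(real^'n \<Rightarrow> real) \<Rightarrow> (real^'n \<Rightarrow> complex) \<Rightarrow> nat \<Rightarrow> ennreal" where
  "gauss_inversion f \<phi> k = (\<integral>\<^sup>+y. ennreal (f y) * (ennreal (real (Suc k) ^ CARD('n)) *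
     ennreal (Re (\<integral>z. \<phi> (real (Suc k) *\<^sub>R z) * exp (- \<i> * complex_of_real (real (Suc k) * (z \<bullet> y))) \<partial>std_gaussian))) \<partial>lborel)"

text \<open>Inversion is smoothing: by Parseval the inner integral is a Gaussian of width 1 / (k +
  1) around the point \<open>x\<close>, and the substitution y = x + z / (k + 1) absorbs the factor
  (k + 1)^n.\<close>

lemma gauss_inversion_charfun:
  fixes f :: "real^'n \<Rightarrow> real"
  assumes "borel_prob \<mu>" and [measurable]: "f \<in> borel_measurable borel"
  shows "gauss_inversion f (charfun_vec \<mu>) k =
    (\<integral>\<^sup>+x. \<integral>\<^sup>+z. ennreal (f (x + (1 / real (Suc k)) *\<^sub>R z)) * ennreal (gauss_kernel z) \<partial>lborel \<partial>\<mu>)"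
proof -
  interpret \<mu>: borel_prob \<mu> by fact
  interpret P: pair_sigma_finite \<mu> "lborel :: (real^'n) measure" ..
  let ?n = "real (Suc k)"
  have n: "?n > 0" by simp
  have "gauss_inversion f (charfun_vec \<mu>) k = (\<integral>\<^sup>+y. ennreal (f y) * (ennreal (?n ^ CARD('n)) *
     (\<integral>\<^sup>+x. ennreal (gauss_kernel (?n *\<^sub>R (x - y))) \<partial>\<mu>)) \<partial>lborel)"
    unfolding gauss_inversion_def integral_gauss_kernel_eq_charfun[OF assms(1), symmetric]
    by (subst nn_integral_eq_integral) (auto intro!: \<mu>.integrable_bounded[where C=1] simp: abs_of_nonneg)
  also have "\<dots> = (\<integral>\<^sup>+y. \<integral>\<^sup>+x. ennreal (f y) * (ennreal (?n ^ CARD('n)) *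
     ennreal (gauss_kernel (?n *\<^sub>R (x - y)))) \<partial>\<mu> \<partial>lborel)"
    by (simp add: nn_integral_cmult)
  also have "\<dots> = (\<integral>\<^sup>+x. \<integral>\<^sup>+y. ennreal (f y) * (ennreal (?n ^ CARD('n)) *
     ennreal (gauss_kernel (?n *\<^sub>R (x - y)))) \<partial>lborel \<partial>\<mu>)"
    by (rule P.Fubini') (simp add: case_prod_unfold)
  also have "\<dots> = (\<integral>\<^sup>+x. \<integral>\<^sup>+z. ennreal (f (x + (1 / ?n) *\<^sub>R z)) * ennreal (gauss_kernel z) \<partial>lborel \<partial>\<mu>)"
  proof (rule nn_integral_cong)
    fix x
    have "(\<integral>\<^sup>+y. ennreal (f y) * (ennreal (?n ^ CARD('n)) * ennreal (gauss_kernel (?n *\<^sub>R (x - y)))) \<partial>lborel)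
       = (\<integral>\<^sup>+y. ennreal (f y) * (ennreal (?n ^ CARD('n)) * ennreal (gauss_kernel (?n *\<^sub>R (x - y))))
           \<partial>density (distr lborel borel (\<lambda>z. x + (1 / ?n) *\<^sub>R z)) (\<lambda>_. ennreal (\<bar>1 / ?n\<bar> ^ DIM(real^'n))))"
      using n by (subst lborel_affine[of "1 / ?n" x]) auto
    also have "\<dots> = (\<integral>\<^sup>+z. ennreal ((1 / ?n) ^ CARD('n)) * (ennreal (f (x + (1 / ?n) *\<^sub>R z)) * (ennreal (?n ^ CARD('n)) *
        ennreal (gauss_kernel (?n *\<^sub>R (x - (x + (1 / ?n) *\<^sub>R z)))))) \<partial>lborel)"
      using n by (subst nn_integral_density, simp, simp) (subst nn_integral_distr, auto)
    also have "\<dots> = (\<integral>\<^sup>+z. ennreal (f (x + (1 / ?n) *\<^sub>R z)) * ennreal (gauss_kernel z) \<partial>lborel)"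
    proof (intro nn_integral_cong)
      fix z :: "real^'n"
      have "gauss_kernel (?n *\<^sub>R (x - (x + (1 / ?n) *\<^sub>R z))) = gauss_kernel z"
        by (simp add: gauss_kernel_def)
      moreover have "ennreal ((1 / ?n) ^ CARD('n)) * (a * (ennreal (?n ^ CARD('n)) * b)) = a * b" for a b
      proof -
        have "ennreal ((1 / ?n) ^ CARD('n)) * ennreal (?n ^ CARD('n)) = 1"
          using n by (subst ennreal_mult[symmetric]) (auto simp: power_mult_distrib[symmetric])
        then show ?thesis by (metis mult.assoc mult.commute mult_1)
      qed
      ultimately show "ennreal ((1 / ?n) ^ CARD('n)) * (ennreal (f (x + (1 / ?n) *\<^sub>R z)) * (ennreal (?n ^ CARD('n)) *
        ennreal (gauss_kernel (?n *\<^sub>R (x - (x + (1 / ?n) *\<^sub>R z)))))) =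
        ennreal (f (x + (1 / ?n) *\<^sub>R z)) * ennreal (gauss_kernel z)" by simp
    qed
    finally show "(\<integral>\<^sup>+y. ennreal (f y) * (ennreal (?n ^ CARD('n)) * ennreal (gauss_kernel (?n *\<^sub>R (x - y)))) \<partial>lborel)
       = (\<integral>\<^sup>+z. ennreal (f (x + (1 / ?n) *\<^sub>R z)) * ennreal (gauss_kernel z) \<partial>lborel)" .
  qed
  finally show ?thesis .
qed

lemma gauss_inversion_tendsto:
  fixes f :: "real^'n \<Rightarrow> real"
  assumes "borel_prob \<mu>" and f: "continuous_on UNIV f" and b: "\<And>x. 0 \<le> f x" "\<And>x. f x \<le> 1"
  shows "(\<lambda>k. gauss_inversion f (charfun_vec \<mu>) k) \<longlonglongrightarrow> (\<integral>\<^sup>+x. ennreal (f x) \<partial>\<mu>) * gauss_mass TYPE(real^'n)"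
proof -
  have [measurable]: "f \<in> borel_measurable borel" using f by (rule borel_measurable_continuous_onI)
  interpret \<mu>: borel_prob \<mu> by fact
  interpret P: pair_sigma_finite \<mu> "lborel :: (real^'n) measure" ..
  let ?F = "\<lambda>k p. ennreal (f (fst p + (1 / real (Suc k)) *\<^sub>R snd p)) * ennreal (gauss_kernel (snd p))"
  let ?G = "\<lambda>p :: (real^'n) \<times> (real^'n). ennreal (f (fst p)) * ennreal (gauss_kernel (snd p))"
  have lim: "(\<lambda>k. \<integral>\<^sup>+p. ?F k p \<partial>(\<mu> \<Otimes>\<^sub>M lborel)) \<longlonglongrightarrow> (\<integral>\<^sup>+p. ?G p \<partial>(\<mu> \<Otimes>\<^sub>M lborel))"
  proof (rule nn_integral_dominated_convergence[where w="\<lambda>p :: (real^'n) \<times> (real^'n). ennreal (gauss_kernel (snd p))"])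
    show "(\<integral>\<^sup>+p. ennreal (gauss_kernel (snd p)) \<partial>(\<mu> \<Otimes>\<^sub>M (lborel :: (real^'n) measure))) < \<infinity>"
      by (subst lborel.nn_integral_fst[symmetric])
         (insert gauss_mass_finite[where 'n='n, unfolded gauss_mass_def], auto simp: \<mu>.emeasure_space_1[unfolded \<mu>.space_eq])
    show "AE p in \<mu> \<Otimes>\<^sub>M lborel. ?F k p \<le> ennreal (gauss_kernel (snd p))" for k
      using b by (auto simp: ennreal_mult[symmetric] intro!: ennreal_leI mult_left_le_one_le)
    show "AE p in \<mu> \<Otimes>\<^sub>M lborel. (\<lambda>k. ?F k p) \<longlonglongrightarrow> ?G p"
    proof (intro AE_I2)
      fix p :: "(real^'n) \<times> (real^'n)"
      obtain x z where p: "p = (x, z)" by force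
      have "(\<lambda>k. x + (1 / real (Suc k)) *\<^sub>R z) \<longlonglongrightarrow> x + 0 *\<^sub>R z"
        by (intro tendsto_intros) (rule LIMSEQ_Suc[OF lim_const_over_n])
      then have "(\<lambda>k. f (x + (1 / real (Suc k)) *\<^sub>R z)) \<longlonglongrightarrow> f x"
        using f by (intro isCont_tendsto_compose[of x f]) (auto simp: continuous_on_eq_continuous_at)
      then have "(\<lambda>k. ennreal (f (x + (1 / real (Suc k)) *\<^sub>R z) * gauss_kernel z)) \<longlonglongrightarrow> ennreal (f x * gauss_kernel z)"
        by (intro tendsto_intros)
      then show "(\<lambda>k. ?F k p) \<longlonglongrightarrow> ?G p"
        using b by (simp add: ennreal_mult p)
    qed
  qed auto
  have "(\<integral>\<^sup>+p. ?G p \<partial>(\<mu> \<Otimes>\<^sub>M lborel)) = (\<integral>\<^sup>+x. ennreal (f x) \<partial>\<mu>) * gauss_mass TYPE(real^'n)"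
    by (subst lborel.nn_integral_fst[symmetric])
       (auto simp: nn_integral_cmult nn_integral_multc gauss_mass_def)
  moreover have "(\<integral>\<^sup>+p. ?F k p \<partial>(\<mu> \<Otimes>\<^sub>M lborel)) = gauss_inversion f (charfun_vec \<mu>) k" for k
    unfolding gauss_inversion_charfun[OF assms(1) \<open>f \<in> borel_measurable borel\<close>]
    by (subst lborel.nn_integral_fst[symmetric]) auto
  ultimately show ?thesis using lim by simp
qed

text \<open>Continuous functions increasing to the indicator of an open set. \<open>UNIV\<close> is
  treated apart because \<open>infdist\<close> from the empty complement is 0 by convention.\<close>

definition open_approx :: "(real^'n) set \<Rightarrow> nat \<Rightarrow> real^'n \<Rightarrow> real" where
  "open_approx U j x = (if U = UNIV then 1 else min 1 (real j * infdist x (- U)))"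

lemma open_approx_props:
  "continuous_on UNIV (open_approx U j)" "0 \<le> open_approx U j x" "open_approx U j x \<le> 1"
  by (cases "U = UNIV"; auto simp: open_approx_def[abs_def] infdist_nonneg intro!: continuous_intros)+

lemma open_approx_tendsto:
  assumes "open U"
  shows "(\<lambda>j. open_approx U j x) \<longlonglongrightarrow> indicator U x"
proof (cases "U = UNIV \<or> x \<notin> U")
  case True
  then have "open_approx U j x = indicator U x" for j by (auto simp: open_approx_def)
  then show ?thesis by simp
next
  case False
  then have "infdist x (- U) > 0"
    using assms in_closed_iff_infdist_zero[of "- U" x] infdist_nonneg[of x "- U"]
    by (auto simp: closed_Compl less_le)
  then have "LIM j sequentially. real j * infdist x (- U) :> at_top"
    by (intro filterlim_at_top_mult_tendsto_pos[OF tendsto_const]) (auto intro: filterlim_real_sequentially)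
  then have "eventually (\<lambda>j. real j * infdist x (- U) \<ge> 1) sequentially"
    by (simp add: filterlim_at_top)
  then have "eventually (\<lambda>j. open_approx U j x = 1) sequentially"
    by eventually_elim (auto simp: open_approx_def)
  then show ?thesis using False by (auto simp: tendsto_eventually)
qed

text \<open>The nested \<open>lim\<close> terms make the mass of an open set an explicit functional
  of the characteristic function, so that equality of laws and measurability in a parameter can both
  be read off from it.\<close>

lemma emeasure_open_from_charfun:
  fixes U :: "(real^'n) set"
  assumes "borel_prob \<mu>" "open U"
  shows "emeasure \<mu> U = lim (\<lambda>j. lim (\<lambda>k. gauss_inversion (open_approx U j) (charfun_vec \<mu>) k) / gauss_mass TYPE(real^'n))"
proof -
  interpret \<mu>: borel_prob \<mu> by fact
  have [measurable]: "open_approx U j \<in> borel_measurable borel" for j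
    using open_approx_props(1) by (rule borel_measurable_continuous_onI)
  have [measurable]: "U \<in> sets borel" using assms by auto
  have "lim (\<lambda>k. gauss_inversion (open_approx U j) (charfun_vec \<mu>) k) / gauss_mass TYPE(real^'n)
     = (\<integral>\<^sup>+x. ennreal (open_approx U j x) \<partial>\<mu>)" for j
    using limI[OF gauss_inversion_tendsto[OF assms(1) open_approx_props[of U j]]]
      gauss_mass_pos[where 'n='n] gauss_mass_finite[where 'n='n]
    by (simp add: ennreal_mult_divide_eq)
  moreover have "(\<lambda>j. \<integral>\<^sup>+x. ennreal (open_approx U j x) \<partial>\<mu>) \<longlonglongrightarrow> (\<integral>\<^sup>+x. ennreal (indicator U x) \<partial>\<mu>)"
  proof (rule nn_integral_dominated_convergence[where w="\<lambda>_. 1"])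
    show "AE x in \<mu>. (\<lambda>j. ennreal (open_approx U j x)) \<longlonglongrightarrow> ennreal (indicator U x)"
      by (intro AE_I2 tendsto_ennrealI open_approx_tendsto assms)
  qed (auto simp: open_approx_props \<mu>.emeasure_space_1[unfolded \<mu>.space_eq] ennreal_le_1)
  ultimately show ?thesis by (simp add: limI ennreal_indicator)
qed

lemma charfun_unique:
  fixes \<mu> \<kappa> :: "(real^'n) measure"
  assumes "borel_prob \<mu>" "borel_prob \<kappa>" "\<And>\<xi>. charfun_vec \<mu> \<xi> = charfun_vec \<kappa> \<xi>"
  shows "\<mu> = \<kappa>"
proof (rule measure_eqI_generator_eq[where E="{S. open S}" and \<Omega>=UNIV and A="\<lambda>_. UNIV"])
  interpret \<mu>: borel_prob \<mu> by fact
  interpret \<kappa>: borel_prob \<kappa> by fact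
  show "Int_stable {S :: (real^'n) set. open S}" by (auto simp: Int_stable_def)
  have "charfun_vec \<mu> = charfun_vec \<kappa>" using assms(3) by auto
  then show "emeasure \<mu> X = emeasure \<kappa> X" if "X \<in> {S. open S}" for X
    using that by (simp add: emeasure_open_from_charfun assms)
  show "sets \<mu> = sigma_sets UNIV {S. open S}" "sets \<kappa> = sigma_sets UNIV {S. open S}"
    by (simp_all add: borel_def)
qed (auto simp: borel_prob.axioms(1)[OF assms(1)] finite_measure.emeasure_finite prob_space.finite_measure)

text \<open>Measurability survives the integrals and limits in the inversion formula, hence holds
  for the mass of every open set; the open sets are an intersection-stable generator.\<close>

lemma kernel_from_charfun:
  fixes K :: "'a \<Rightarrow> (real^'n) measure"
  assumes K: "\<And>t. borel_prob (K t)"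
    and [measurable]: "(\<lambda>(t, \<xi>). charfun_vec (K t) \<xi>) \<in> borel_measurable (N \<Otimes>\<^sub>M borel)"
  shows "K \<in> N \<rightarrow>\<^sub>M prob_algebra borel"
proof (rule measurable_prob_algebra_generated[where \<Omega>=UNIV and G="{S. open S}"])
  show "Int_stable {S :: (real^'n) set. open S}" by (auto simp: Int_stable_def)
  show "sets borel = sigma_sets UNIV {S :: (real^'n) set. open S}" by (simp add: borel_def)
  show "prob_space (K a)" "sets (K a) = sets borel" for a
    using K[of a] by (auto simp: borel_prob_def borel_prob_axioms_def)
  fix U :: "(real^'n) set" assume "U \<in> {S. open S}"
  then have U: "open U" by simp
  have [measurable]: "open_approx U j \<in> borel_measurable borel" for j
    using open_approx_props(1) by (rule borel_measurable_continuous_onI)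
  show "(\<lambda>a. emeasure (K a) U) \<in> borel_measurable N"
    unfolding emeasure_open_from_charfun[OF K U] gauss_inversion_def by measurable
qed auto

subsection \<open>Compound Poisson laws and infinite convolutions\<close>

text \<open>The disintegration is applied to bounded real integrands, so the real and imaginary
  parts of the exponential are treated separately and then reassembled.\<close>

lemma charfun_bind:
  assumes M: "prob_space M" and N [measurable]: "N \<in> M \<rightarrow>\<^sub>M prob_algebra borel"
  shows "charfun_vec (M \<bind> N) \<xi> = (\<integral>a. charfun_vec (N a) \<xi> \<partial>M)"
proof -
  interpret M: prob_space M by fact
  have N': "N \<in> M \<rightarrow>\<^sub>M subprob_algebra borel" using N by (rule measurable_prob_algebraD)
  have Na: "borel_prob (N a)" if "a \<in> space M" for a
    using measurable_space[OF N that] by (auto simp: space_prob_algebra borel_prob_def borel_prob_axioms_def)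
  have B: "borel_prob (M \<bind> N)"
    using prob_space_bind'[OF _ N] sets_bind'[OF _ N] M
    by (auto simp: space_prob_algebra borel_prob_def borel_prob_axioms_def)
  interpret B: borel_prob "M \<bind> N" by (rule B)
  let ?e = "\<lambda>x. exp (\<i> * complex_of_real (\<xi> \<bullet> x))"
  have re: "(\<integral>x. g x \<partial>(M \<bind> N)) = (\<integral>a. (\<integral>x. g x \<partial>N a) \<partial>M)"
    if "g \<in> borel_measurable borel" "\<And>x. \<bar>g x\<bar> \<le> 1" for g :: "real^'b \<Rightarrow> real"
    using that Na
    by (intro integral_bind[where K=borel and B=1 and B'=1] N' M.finite_measure AE_I2)
       (auto simp: borel_prob_def prob_space.emeasure_space_1)
  have int: "integrable (N a) ?e" if "a \<in> space M" for a
    by (rule borel_prob.integrable_bounded[OF Na[OF that], where C=1]) auto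
  have intM: "integrable M (\<lambda>a. charfun_vec (N a) \<xi>)"
  proof (rule M.integrable_const_bound[where B=1])
    show "AE a in M. cmod (charfun_vec (N a) \<xi>) \<le> 1"
      using Na charfun_norm_le by (intro AE_I2) auto
    have int_meas: "(\<lambda>a. (\<integral>x. g x \<partial>N a)) \<in> borel_measurable M"
      if "g \<in> borel_measurable borel" for g :: "real^'b \<Rightarrow> real"
      using measurable_compose[OF N' integral_measurable_subprob_algebra[OF that]] by simp
    have "(\<lambda>a. (\<integral>x. Re (?e x) \<partial>N a)) \<in> borel_measurable M" "(\<lambda>a. (\<integral>x. Im (?e x) \<partial>N a)) \<in> borel_measurable M"
      by (intro int_meas; measurable)+
    then have "(\<lambda>a. Complex (\<integral>x. Re (?e x) \<partial>N a) (\<integral>x. Im (?e x) \<partial>N a)) \<in> borel_measurable M"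
      unfolding Complex_eq by measurable
    moreover have "Complex (\<integral>x. Re (?e x) \<partial>N a) (\<integral>x. Im (?e x) \<partial>N a) = charfun_vec (N a) \<xi>" if "a \<in> space M" for a
      unfolding charfun_vec_def using int[OF that] by (intro complex_eqI) (simp_all add: integral_Re integral_Im)
    ultimately show "(\<lambda>a. charfun_vec (N a) \<xi>) \<in> borel_measurable M"
      by (simp cong: measurable_cong)
  qed
  have intB: "integrable (M \<bind> N) ?e" by (rule B.integrable_bounded[where C=1]) auto
  show ?thesis
  proof (rule complex_eqI)
    have "Re (charfun_vec (M \<bind> N) \<xi>) = (\<integral>a. (\<integral>x. Re (?e x) \<partial>N a) \<partial>M)"
      unfolding charfun_vec_def integral_Re[OF intB, symmetric]
      by (rule re) (auto intro: order_trans[OF abs_Re_le_cmod])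
    also have "\<dots> = (\<integral>a. Re (charfun_vec (N a) \<xi>) \<partial>M)"
      unfolding charfun_vec_def by (intro Bochner_Integration.integral_cong refl) (simp add: integral_Re int)
    finally show "Re (charfun_vec (M \<bind> N) \<xi>) = Re (\<integral>a. charfun_vec (N a) \<xi> \<partial>M)"
      using intM by (simp add: integral_Re)
    have "Im (charfun_vec (M \<bind> N) \<xi>) = (\<integral>a. (\<integral>x. Im (?e x) \<partial>N a) \<partial>M)"
      unfolding charfun_vec_def integral_Im[OF intB, symmetric]
      by (rule re) (auto intro: order_trans[OF abs_Im_le_cmod])
    also have "\<dots> = (\<integral>a. Im (charfun_vec (N a) \<xi>) \<partial>M)"
      unfolding charfun_vec_def by (intro Bochner_Integration.integral_cong refl) (simp add: integral_Im int)
    finally show "Im (charfun_vec (M \<bind> N) \<xi>) = Im (\<integral>a. charfun_vec (N a) \<xi> \<partial>M)"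
      using intM by (simp add: integral_Im)
  qed
qed

lemma poisson_generating_function:
  fixes z :: complex
  assumes "0 < a" "norm z \<le> 1"
  shows "(\<integral>n. z ^ n \<partial>measure_pmf (poisson_pmf a)) = exp (complex_of_real a * (z - 1))"
proof -
  have int: "integrable (measure_pmf (poisson_pmf a)) (\<lambda>n. z ^ n)"
    using assms by (intro measure_pmf.integrable_const_bound[where B=1])
      (auto simp: norm_power power_le_one)
  then have int': "integrable (count_space UNIV) (\<lambda>n. pmf (poisson_pmf a) n *\<^sub>R z ^ n)"
    unfolding measure_pmf_eq_density by (subst (asm) integrable_density) auto
  have "(\<integral>n. z ^ n \<partial>measure_pmf (poisson_pmf a)) = (\<integral>n. pmf (poisson_pmf a) n *\<^sub>R z ^ n \<partial>count_space UNIV)"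
    unfolding measure_pmf_eq_density by (subst integral_density) auto
  also have "\<dots> = (\<Sum>n. pmf (poisson_pmf a) n *\<^sub>R z ^ n)"
    by (rule integral_count_space_nat[OF int'])
  also have "\<dots> = (\<Sum>n. complex_of_real (exp (- a)) * ((complex_of_real a * z) ^ n /\<^sub>R fact n))"
    using assms by (intro suminf_cong) (simp add: scaleR_conv_of_real power_mult_distrib field_simps)
  also have "\<dots> = complex_of_real (exp (- a)) * exp (complex_of_real a * z)"
    by (subst suminf_mult) (auto simp: exp_def intro: summable_exp_generic)
  also have "\<dots> = exp (complex_of_real a * (z - 1))"
    by (simp add: exp_of_real[symmetric] exp_add[symmetric] algebra_simps)
  finally show ?thesis .
qed

text \<open>The law of a sum of independent jumps with law \<open>\<kappa>\<close>, their number
  being Poisson with mean \<open>a\<close>: a Poisson mixture of convolution powers, to which the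
  generating function applies.\<close>

lemma compound_poisson:
  fixes \<kappa> :: "(real^'n) measure"
  assumes "borel_prob \<kappa>" "0 < a"
  shows "\<exists>\<mu>. borel_prob \<mu> \<and> (\<forall>\<xi>. charfun_vec \<mu> \<xi> = exp (complex_of_real a * (charfun_vec \<kappa> \<xi> - 1)))"
proof -
  define K where "K = (\<lambda>n. ((\<lambda>m. m \<star> \<kappa>) ^^ n) (return borel (0::real^'n)))"
  have K: "borel_prob (K n)" for n
    by (induction n) (auto simp: K_def borel_prob_return intro: borel_prob_convolution assms)
  have cK: "charfun_vec (K n) \<xi> = charfun_vec \<kappa> \<xi> ^ n" for n \<xi>
  proof (induction n)
    case (Suc n)
    have "charfun_vec (K (Suc n)) \<xi> = charfun_vec (K n \<star> \<kappa>) \<xi>" by (simp add: K_def)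
    then show ?case using Suc charfun_convolution[OF K[of n] assms(1)] by (simp add: mult.commute)
  qed (simp add: K_def charfun_return)
  have KM: "K \<in> measure_pmf (poisson_pmf a) \<rightarrow>\<^sub>M prob_algebra borel"
    using K borel_prob.in_prob_algebra by auto
  have P: "measure_pmf (poisson_pmf a) \<in> space (prob_algebra (measure_pmf (poisson_pmf a)))"
    by (auto simp: space_prob_algebra measure_pmf.prob_space_axioms)
  have "borel_prob (measure_pmf (poisson_pmf a) \<bind> K)"
    using prob_space_bind'[OF P KM] sets_bind'[OF P KM]
    by (auto simp: borel_prob_def borel_prob_axioms_def)
  moreover have "charfun_vec (measure_pmf (poisson_pmf a) \<bind> K) \<xi> = exp (complex_of_real a * (charfun_vec \<kappa> \<xi> - 1))" for \<xi>
    unfolding charfun_bind[OF measure_pmf.prob_space_axioms KM] cK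
    by (rule poisson_generating_function[OF assms(2) charfun_norm_le[OF assms(1)]])
  ultimately show ?thesis by blast
qed

text \<open>On the product space, Borel-Cantelli makes the k-th coordinate eventually smaller than
  2^-k almost surely, so the series converges absolutely. Dominated convergence then identifies the
  characteristic function of its sum.\<close>

lemma infinite_convolution:
  fixes K :: "nat \<Rightarrow> (real^'n) measure"
  assumes K: "\<And>k. borel_prob (K k)"
    and tail: "summable (\<lambda>k. measure (K k) {x. 1 \<le> 2 ^ k * norm x})"
    and lim: "\<And>\<xi>. (\<lambda>n. \<Prod>k<n. charfun_vec (K k) \<xi>) \<longlonglongrightarrow> \<phi> \<xi>"
  shows "\<exists>\<mu>. borel_prob \<mu> \<and> (\<forall>\<xi>. charfun_vec \<mu> \<xi> = \<phi> \<xi>)"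
proof -
  have pK: "prob_space (K k)" and sK [measurable_cong, simp]: "sets (K k) = sets borel" for k
    using K[of k] by (auto simp: borel_prob_def borel_prob_axioms_def)
  interpret P: product_prob_space K "UNIV :: nat set"
    using pK by (rule product_prob_spaceI)
  let ?P = "PiM UNIV K"
  have [measurable]: "(\<lambda>\<omega>. \<omega> k) \<in> borel_measurable ?P" for k
    using measurable_component_singleton[of k UNIV K] by simp
  \<comment> \<open>Defined at every \<omega> so as to be measurable; it is the sum of the series
    only on the almost sure event of convergence.\<close>
  define X where "X = (\<lambda>\<omega> :: nat \<Rightarrow> real^'n. \<Sum>k. \<omega> k)"
  have [measurable]: "X \<in> borel_measurable ?P" unfolding X_def by measurable
  have comp: "distr ?P (K k) (\<lambda>\<omega>. \<omega> k) = K k" for k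
    by (rule P.PiM_component) simp
  let ?A = "\<lambda>k. {\<omega> \<in> space ?P. 1 \<le> 2 ^ k * norm (\<omega> k)}"
  have "measure ?P (?A k) = measure (K k) {x. 1 \<le> 2 ^ k * norm x}" for k
  proof -
    have "measure (K k) {x. 1 \<le> 2 ^ k * norm x} = measure (distr ?P (K k) (\<lambda>\<omega>. \<omega> k)) {x. 1 \<le> 2 ^ k * norm x}"
      by (simp add: comp)
    also have "\<dots> = measure ?P ((\<lambda>\<omega>. \<omega> k) -` {x. 1 \<le> 2 ^ k * norm x} \<inter> space ?P)"
      by (intro measure_distr) auto
    also have "\<dots> = measure ?P (?A k)" by (intro arg_cong[where f="measure ?P"]) auto
    finally show ?thesis by simp
  qed
  then have "AE \<omega> in ?P. eventually (\<lambda>k. \<omega> \<in> space ?P - ?A k) sequentially"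
    using tail by (intro borel_cantelli_AE1) (auto simp: less_top[symmetric])
  then have AEsum: "AE \<omega> in ?P. (\<lambda>n. \<Sum>k<n. \<omega> k) \<longlonglongrightarrow> X \<omega>"
  proof eventually_elim
    case (elim \<omega>)
    then have "eventually (\<lambda>k. norm (\<omega> k) \<le> (1/2) ^ k) sequentially"
      by eventually_elim (auto simp: field_simps)
    then have "summable \<omega>"
      by (rule summable_comparison_test_ev) (simp add: summable_geometric)
    then show ?case unfolding X_def by (rule summable_LIMSEQ)
  qed
  define \<mu> where "\<mu> = distr ?P borel X"
  have \<mu>: "borel_prob \<mu>"
    unfolding \<mu>_def by (intro borel_prob.intro P.P.prob_space_distr borel_prob_axioms.intro) auto
  have "charfun_vec \<mu> \<xi> = \<phi> \<xi>" for \<xi>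
  proof (rule LIMSEQ_unique)
    let ?e = "\<lambda>x. exp (\<i> * complex_of_real (\<xi> \<bullet> x))"
    show "(\<lambda>n. \<integral>\<omega>. ?e (\<Sum>k<n. \<omega> k) \<partial>?P) \<longlonglongrightarrow> charfun_vec \<mu> \<xi>"
      unfolding charfun_vec_def \<mu>_def
    proof (subst integral_distr)
      show "(\<lambda>n. \<integral>\<omega>. ?e (\<Sum>k<n. \<omega> k) \<partial>?P) \<longlonglongrightarrow> (\<integral>\<omega>. ?e (X \<omega>) \<partial>?P)"
      proof (rule integral_dominated_convergence[where w="\<lambda>_. 1"])
        show "AE \<omega> in ?P. (\<lambda>n. ?e (\<Sum>k<n. \<omega> k)) \<longlonglongrightarrow> ?e (X \<omega>)"
          using AEsum by eventually_elim (intro tendsto_intros)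
      qed auto
    qed auto
    have "(\<integral>\<omega>. ?e (\<Sum>k<n. \<omega> k) \<partial>?P) = (\<Prod>k<n. charfun_vec (K k) \<xi>)" for n
    proof -
      \<comment> \<open>The integrand depends on the first \<open>n\<close> coordinates only, so the
        infinite product measure can be projected to a finite one, where the integral
        factorises.\<close>
      have "(\<integral>\<omega>. ?e (\<Sum>k<n. \<omega> k) \<partial>?P) = (\<integral>\<omega>. (\<Prod>k<n. ?e (restrict \<omega> {..<n} k)) \<partial>?P)"
        by (intro Bochner_Integration.integral_cong refl)
           (simp add: inner_sum_right sum_distrib_left exp_sum)
      also have "\<dots> = (\<integral>\<omega>. (\<Prod>k<n. ?e (\<omega> k)) \<partial>distr ?P (PiM {..<n} K) (\<lambda>\<omega>. restrict \<omega> {..<n}))"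
      proof (subst integral_distr)
        have "(\<lambda>\<omega>. \<omega> k) \<in> borel_measurable (PiM {..<n} K)" if "k < n" for k
        proof -
          have "(\<lambda>\<omega>. \<omega> k) \<in> PiM {..<n} K \<rightarrow>\<^sub>M K k"
            using that by (intro measurable_component_singleton) auto
          then show ?thesis by (subst measurable_cong_sets[OF refl sK[symmetric]])
        qed
        then show "(\<lambda>\<omega>. \<Prod>k<n. ?e (\<omega> k)) \<in> borel_measurable (PiM {..<n} K)"
          by (intro borel_measurable_prod) (auto intro!: borel_measurable_exp borel_measurable_times borel_measurable_of_real borel_measurable_inner)
      qed (auto intro!: measurable_restrict_subset)
      also have "\<dots> = (\<integral>\<omega>. (\<Prod>k<n. ?e (\<omega> k)) \<partial>PiM {..<n} K)"
        by (subst P.distr_PiM_restrict_finite) auto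
      also have "\<dots> = (\<Prod>k<n. charfun_vec (K k) \<xi>)"
        unfolding charfun_vec_def
        by (intro P.product_integral_prod borel_prob.integrable_bounded[OF K, where C=1]) auto
      finally show ?thesis .
    qed
    then show "(\<lambda>n. \<integral>\<omega>. ?e (\<Sum>k<n. \<omega> k) \<partial>?P) \<longlonglongrightarrow> \<phi> \<xi>"
      using lim by simp
  qed
  then show ?thesis using \<mu> by blast
qed

text \<open>Where s |x| is at least 1, the function \<open>1 - gauss_kernel (s *\<^sub>R x)\<close>
  is at least 1 - exp (-1/2). Parseval turns its mean into a Gaussian average of the characteristic
  function near the origin.\<close>

lemma tail_bound_charfun:
  fixes \<mu> :: "(real^'n) measure"
  assumes "borel_prob \<mu>" and \<phi>: "\<And>\<xi>. charfun_vec \<mu> \<xi> = exp (complex_of_real (- \<psi> \<xi>))" and "0 < s"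
    and pos: "\<And>\<xi>. 0 \<le> \<psi> \<xi>" and [measurable]: "\<psi> \<in> borel_measurable borel"
  shows "(1 - exp (-1/2)) * measure \<mu> {x. 1 \<le> s * norm x} \<le> (\<integral>z. 1 - exp (- \<psi> (s *\<^sub>R z)) \<partial>std_gaussian)"
proof -
  interpret \<mu>: borel_prob \<mu> by fact
  have [measurable]: "{x :: real^'n. 1 \<le> s * norm x} \<in> sets borel" by measurable
  have [simp]: "integrable \<mu> (\<lambda>x. gauss_kernel (s *\<^sub>R x))"
    by (rule \<mu>.integrable_bounded[where C=1]) (auto simp: abs_of_nonneg)
  have [simp]: "integrable std_gaussian (\<lambda>z. exp (- \<psi> (s *\<^sub>R z)))"
    by (rule std_gaussian.integrable_bounded[where C=1]) (auto simp: pos)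
  have [simp]: "integrable std_gaussian (\<lambda>z. exp (complex_of_real (- \<psi> (s *\<^sub>R z))))"
    by (rule std_gaussian.integrable_bounded[where C=1]) (auto simp: pos)
  have "(1 - exp (-1/2)) * measure \<mu> {x. 1 \<le> s * norm x}
      = (\<integral>x. (1 - exp (-1/2)) * indicator {x. 1 \<le> s * norm x} x \<partial>\<mu>)" by simp
  also have "\<dots> \<le> (\<integral>x. 1 - gauss_kernel (s *\<^sub>R x) \<partial>\<mu>)"
  proof (rule integral_mono)
    show "integrable \<mu> (\<lambda>x. (1 - exp (-1/2)) * indicator {x. 1 \<le> s * norm x} x :: real)"
      by (intro integrable_mult_right integrable_real_indicator) (auto simp: less_top[symmetric])
    fix x
    show "(1 - exp (-1/2)) * indicator {x. 1 \<le> s * norm x} x \<le> 1 - gauss_kernel (s *\<^sub>R x)"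
    proof (cases "1 \<le> s * norm x")
      case True
      then have "1 \<le> (s * norm x)\<^sup>2" by (simp add: one_le_power)
      then show ?thesis using True \<open>0 < s\<close> by (simp add: gauss_kernel_def)
    qed auto
  qed auto
  also have "\<dots> = 1 - (\<integral>x. gauss_kernel (s *\<^sub>R (x - 0)) \<partial>\<mu>)"
    by (simp add: \<mu>.prob_space[unfolded \<mu>.space_eq])
  also have "\<dots> = 1 - Re (\<integral>z. exp (complex_of_real (- \<psi> (s *\<^sub>R z))) \<partial>std_gaussian)"
    unfolding integral_gauss_kernel_eq_charfun[OF assms(1)] \<phi> by simp
  also have "\<dots> = 1 - (\<integral>z. exp (- \<psi> (s *\<^sub>R z)) \<partial>std_gaussian)"
    by (simp only: exp_of_real integral_complex_of_real Re_complex_of_real)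
  also have "\<dots> = (\<integral>z. 1 - exp (- \<psi> (s *\<^sub>R z)) \<partial>std_gaussian)"
    by (simp add: std_gaussian.prob_space[unfolded std_gaussian.space_eq])
  finally show ?thesis .
qed

subsection \<open>Laws with a symmetric Levy measure\<close>

text \<open>Minus the real part of the Levy-Khintchine integral over the jumps in \<open>B\<close>.
  For symmetric \<open>N\<close> and \<open>B\<close> the imaginary part cancels, so this is the
  whole jump contribution.\<close>

definition jump_exponent :: "(real^'n) measure \<Rightarrow> (real^'n) set \<Rightarrow> real^'n \<Rightarrow> real" where
  "jump_exponent N B \<xi> = (\<integral>x. indicator B x * (1 - cos (\<xi> \<bullet> x)) \<partial>N)"

lemma one_minus_cos_le: "1 - cos t \<le> t\<^sup>2 / 2" for t :: real
proof -
  have "1 - cos t = 2 * (sin (t/2))\<^sup>2"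
    using cos_double_sin[of "t/2"] by simp
  also have "(sin (t/2))\<^sup>2 \<le> (t/2)\<^sup>2"
    using abs_sin_x_le_abs_x[of "t/2"] by (simp only: abs_le_square_iff)
  finally show ?thesis by (simp add: power_divide)
qed

lemma abs_sin_minus_le: "\<bar>sin t - t\<bar> \<le> t\<^sup>2 / 2" for t :: real
  using Maclaurin_sin_bound[of t 2] by (simp add: numeral_2_eq_2 sin_coeff_def power2_eq_square)

locale sym_levy_measure =
  fixes N :: "(real^'n) measure"
  assumes levy: "levy_measure N" and sym: "distr N borel uminus = N"
begin

lemma sets_eq [simp, measurable_cong]: "sets N = sets borel"
  using levy by (simp add: levy_measure_def)

lemma space_eq [simp]: "space N = UNIV"
  using sets_eq_imp_space_eq[OF sets_eq] by simp

lemma integrable_min: "integrable N (\<lambda>x. min 1 ((norm x)\<^sup>2))"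
  using levy by (auto simp: levy_measure_def integrable_iff_bounded abs_of_nonneg)

lemma integrable_min_bound:
  fixes g :: "real^'n \<Rightarrow> 'b::{banach,second_countable_topology}"
  assumes "g \<in> borel_measurable borel" "\<And>x. norm (g x) \<le> C * min 1 ((norm x)\<^sup>2)"
  shows "integrable N g"
  by (rule Bochner_Integration.integrable_bound[OF integrable_mult_right[OF integrable_min, of C]])
     (use assms in \<open>auto intro!: AE_I2 order_trans[OF assms(2)] abs_ge_self\<close>)

text \<open>Large jumps cost at most 2, small ones at most |\<xi>|^2 |x|^2 / 2; the constant covers
  both regimes at once.\<close>

lemma cos_bound: "\<bar>indicator B x * (1 - cos (\<xi> \<bullet> x))\<bar> \<le> (2 + (norm \<xi>)\<^sup>2) * min 1 ((norm x)\<^sup>2)"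
proof -
  have "1 - cos (\<xi> \<bullet> x) \<le> (2 + (norm \<xi>)\<^sup>2) * min 1 ((norm x)\<^sup>2)"
  proof (cases "1 \<le> (norm x)\<^sup>2")
    case True
    have "1 - cos (\<xi> \<bullet> x) \<le> 2" using cos_ge_minus_one[of "\<xi> \<bullet> x"] by linarith
    also have "2 \<le> 2 + (norm \<xi>)\<^sup>2" by simp
    finally show ?thesis unfolding min_absorb1[OF True] by simp
  next
    case False
    have "1 - cos (\<xi> \<bullet> x) \<le> (\<xi> \<bullet> x)\<^sup>2 / 2" by (rule one_minus_cos_le)
    also have "(\<xi> \<bullet> x)\<^sup>2 \<le> (norm \<xi> * norm x)\<^sup>2"
      using Cauchy_Schwarz_ineq2[of \<xi> x] by (simp add: abs_le_square_iff[symmetric] abs_mult)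
    also have "(norm \<xi> * norm x)\<^sup>2 / 2 \<le> (2 + (norm \<xi>)\<^sup>2) * (norm x)\<^sup>2"
      by (simp add: power_mult_distrib algebra_simps)
    finally show ?thesis using False by simp
  qed
  moreover have "0 \<le> 1 - cos (\<xi> \<bullet> x)" by simp
  ultimately show ?thesis by (auto simp: indicator_def)
qed

lemma integrable_cos: "B \<in> sets borel \<Longrightarrow> integrable N (\<lambda>x. indicator B x * (1 - cos (\<xi> \<bullet> x)) :: real)"
  by (rule integrable_min_bound[where C="2 + (norm \<xi>)\<^sup>2"]) (use cos_bound in auto)

lemma jump_exponent_nonneg: "0 \<le> jump_exponent N B \<xi>"
  unfolding jump_exponent_def by (intro integral_nonneg_AE AE_I2) auto

lemma jump_exponent_mono:
  assumes "B \<subseteq> C" "B \<in> sets borel" "C \<in> sets borel"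
  shows "jump_exponent N B \<xi> \<le> jump_exponent N C \<xi>"
  unfolding jump_exponent_def
  using assms by (intro integral_mono integrable_cos) (auto simp: indicator_def)

lemma jump_exponent_Un:
  assumes "B \<inter> C = {}" "B \<in> sets borel" "C \<in> sets borel"
  shows "jump_exponent N (B \<union> C) \<xi> = jump_exponent N B \<xi> + jump_exponent N C \<xi>"
  unfolding jump_exponent_def Bochner_Integration.integral_add[OF integrable_cos[OF assms(2)] integrable_cos[OF assms(3)], symmetric]
  using assms(1) by (intro Bochner_Integration.integral_cong refl) (auto simp: indicator_def)

text \<open>Sets and frequencies vary together so that one statement gives continuity in \<xi> as
  well as limits along annuli. Convergence of the sets is asked only off the origin, where the
  integrand vanishes.\<close>

lemma jump_exponent_tendsto:
  assumes "\<And>n. B n \<in> sets borel" "C \<in> sets borel" "\<xi> \<longlonglongrightarrow> \<eta>"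
    and "\<And>x. x \<noteq> 0 \<Longrightarrow> (\<lambda>n. indicator (B n) x :: real) \<longlonglongrightarrow> indicator C x"
  shows "(\<lambda>n. jump_exponent N (B n) (\<xi> n)) \<longlonglongrightarrow> jump_exponent N C \<eta>"
proof -
  from assms(3) have "bounded (range \<xi>)" by (rule convergent_imp_bounded)
  then obtain K where K: "\<And>n. norm (\<xi> n) \<le> K" by (auto simp: bounded_iff)
  have K2: "(norm (\<xi> n))\<^sup>2 \<le> K\<^sup>2" for n using K by (intro power_mono) auto
  show ?thesis
    unfolding jump_exponent_def
  proof (rule integral_dominated_convergence[where w="\<lambda>x. (2 + K\<^sup>2) * min 1 ((norm x)\<^sup>2)"])
    show "AE x in N. norm (indicator (B n) x * (1 - cos (\<xi> n \<bullet> x))) \<le> (2 + K\<^sup>2) * min 1 ((norm x)\<^sup>2)" for n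
      unfolding real_norm_def
      by (intro AE_I2 order_trans[OF cos_bound[of "B n" _ "\<xi> n"] mult_right_mono]) (use K2[of n] in auto)
    show "AE x in N. (\<lambda>n. indicator (B n) x * (1 - cos (\<xi> n \<bullet> x))) \<longlonglongrightarrow> indicator C x * (1 - cos (\<eta> \<bullet> x))"
    proof (intro AE_I2)
      fix x
      show "(\<lambda>n. indicator (B n) x * (1 - cos (\<xi> n \<bullet> x))) \<longlonglongrightarrow> indicator C x * (1 - cos (\<eta> \<bullet> x))"
        using assms(3,4) by (cases "x = 0") (auto intro!: tendsto_intros)
    qed
  qed (use assms in \<open>auto intro!: integrable_mult_right integrable_min\<close>)
qed

lemma jump_exponent_measurable [measurable]:
  assumes "B \<in> sets borel"
  shows "jump_exponent N B \<in> borel_measurable borel"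
proof (rule borel_measurable_continuous_onI)
  show "continuous_on UNIV (jump_exponent N B)"
    unfolding continuous_on_sequentially comp_def
    using assms by (auto intro!: jump_exponent_tendsto)
qed

lemma finite_far:
  assumes "0 < r"
  shows "emeasure N {x. r \<le> norm x} < \<infinity>"
proof -
  let ?m = "min 1 (r\<^sup>2)"
  have m: "?m > 0" using assms by simp
  have [measurable]: "{x :: real^'n. r \<le> norm x} \<in> sets borel" by measurable
  have "emeasure N {x. r \<le> norm x} = (\<integral>\<^sup>+x. indicator {x. r \<le> norm x} x \<partial>N)" by simp
  also have "\<dots> \<le> (\<integral>\<^sup>+x. ennreal (norm (min 1 ((norm x)\<^sup>2) / ?m)) \<partial>N)"
  proof (intro nn_integral_mono)
    fix x :: "real^'n"
    have "1 \<le> min 1 ((norm x)\<^sup>2) / ?m" if "r \<le> norm x"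
    proof -
      have "r\<^sup>2 \<le> (norm x)\<^sup>2" using that assms by (intro power_mono) auto
      then show ?thesis using m by (simp add: le_divide_eq)
    qed
    then show "indicator {x. r \<le> norm x} x \<le> ennreal (norm (min 1 ((norm x)\<^sup>2) / ?m))"
      using m by (auto simp: indicator_def abs_of_nonneg)
  qed
  also have "\<dots> < \<infinity>"
    using integrable_divide[OF integrable_min, of ?m] unfolding integrable_iff_bounded by auto
  finally show ?thesis .
qed

lemma integral_odd:
  fixes g :: "real^'n \<Rightarrow> real"
  assumes "g \<in> borel_measurable borel" "\<And>x. g (- x) = - g x"
  shows "(\<integral>x. g x \<partial>N) = 0"
proof -
  have "(\<integral>x. g x \<partial>N) = (\<integral>x. g x \<partial>distr N borel uminus)" by (simp add: sym)
  also have "\<dots> = - (\<integral>x. g x \<partial>N)" using assms by (subst integral_distr) auto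
  finally show ?thesis by simp
qed

text \<open>Away from the origin \<open>N\<close> is finite, so normalising it on \<open>B\<close>
  gives a jump law for a compound Poisson variable of intensity N(B). Symmetry of \<open>B\<close>
  removes the sine part of its characteristic function.\<close>

lemma finite_jump_law:
  assumes B [measurable]: "B \<in> sets borel" and "\<And>x. x \<in> B \<Longrightarrow> - x \<in> B"
    and "0 < r" "\<And>x. x \<in> B \<Longrightarrow> r \<le> norm x"
  shows "\<exists>\<mu>. borel_prob \<mu> \<and> (\<forall>\<xi>. charfun_vec \<mu> \<xi> = exp (complex_of_real (- jump_exponent N B \<xi>)))"
proof -
  have [measurable]: "{x :: real^'n. r \<le> norm x} \<in> sets borel" by measurable
  have fin: "emeasure N B < \<infinity>"
    using finite_far[OF \<open>0 < r\<close>] emeasure_mono[of B "{x. r \<le> norm x}" N] assms(4) by (auto intro: le_less_trans)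
  have symB: "- x \<in> B \<longleftrightarrow> x \<in> B" for x using assms(2)[of x] assms(2)[of "-x"] by auto
  show ?thesis
  \<comment> \<open>A null set of jumps cannot be normalised; the law is then the point mass at
    0.\<close>
  proof (cases "emeasure N B = 0")
    case True
    then have "AE x in N. x \<notin> B" by (intro AE_not_in) (auto simp: null_sets_def)
    then have "jump_exponent N B \<xi> = 0" for \<xi>
      unfolding jump_exponent_def by (intro integral_eq_zero_AE) (auto elim!: eventually_mono)
    then show ?thesis using borel_prob_return charfun_return by force
  next
    case False
    define a where "a = measure N B"
    have a: "0 < a" "emeasure N B = ennreal a"
      using False fin by (auto simp: a_def emeasure_eq_ennreal_measure zero_less_measure_iff less_top)
    define \<kappa> where "\<kappa> = uniform_measure N B"
    have "prob_space \<kappa>" unfolding \<kappa>_def using False fin by (intro prob_space_uniform_measure) auto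
    then have \<kappa>: "borel_prob \<kappa>" by (simp add: borel_prob_def borel_prob_axioms_def \<kappa>_def)
    obtain \<mu> where \<mu>: "borel_prob \<mu>" "\<And>\<xi>. charfun_vec \<mu> \<xi> = exp (complex_of_real a * (charfun_vec \<kappa> \<xi> - 1))"
      using compound_poisson[OF \<kappa> a(1)] by blast
    have "complex_of_real a * (charfun_vec \<kappa> \<xi> - 1) = complex_of_real (- jump_exponent N B \<xi>)" for \<xi>
    proof -
      let ?e = "\<lambda>x. exp (\<i> * complex_of_real (\<xi> \<bullet> x))"
      have ind: "integrable N (\<lambda>x. indicator B x :: real)"
        using fin by (intro integrable_real_indicator) auto
      have "charfun_vec \<kappa> \<xi> = (\<integral>x. ?e x \<partial>density N (\<lambda>x. ennreal (indicator B x / a)))"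
        unfolding charfun_vec_def \<kappa>_def uniform_measure_def a(2) using a(1)
        by (intro arg_cong2[where f="integral\<^sup>L"] density_cong) (auto simp: divide_ennreal[symmetric] ennreal_indicator)
      also have "\<dots> = (\<integral>x. (indicator B x / a) *\<^sub>R ?e x \<partial>N)"
        using a(1) by (subst integral_density) auto
      also have "\<dots> = (\<integral>x. complex_of_real (indicator B x * cos (\<xi> \<bullet> x) / a) + \<i> * complex_of_real (indicator B x * sin (\<xi> \<bullet> x) / a) \<partial>N)"
        by (intro Bochner_Integration.integral_cong refl)
           (simp add: cis_conv_exp[symmetric] complex_eq_iff mult.commute)
      also have "\<dots> = complex_of_real (\<integral>x. indicator B x * cos (\<xi> \<bullet> x) / a \<partial>N) + \<i> * complex_of_real (\<integral>x. indicator B x * sin (\<xi> \<bullet> x) / a \<partial>N)"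
      proof -
        have "integrable N (\<lambda>x. indicator B x * cos (\<xi> \<bullet> x) / a)" "integrable N (\<lambda>x. indicator B x * sin (\<xi> \<bullet> x) / a)"
          by (intro integrable_divide Bochner_Integration.integrable_bound[OF ind] AE_I2; auto simp: indicator_def)+
        then show ?thesis
          by (subst Bochner_Integration.integral_add) (auto simp del: of_real_divide of_real_mult)
      qed
      also have "(\<integral>x. indicator B x * sin (\<xi> \<bullet> x) / a \<partial>N) = 0"
        by (rule integral_odd) (auto simp: indicator_def symB)
      also have "(\<integral>x. indicator B x * cos (\<xi> \<bullet> x) / a \<partial>N) = (\<integral>x. indicator B x / a - indicator B x * (1 - cos (\<xi> \<bullet> x)) / a \<partial>N)"
        by (intro Bochner_Integration.integral_cong refl) (simp add: algebra_simps diff_divide_distrib)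
      also have "\<dots> = (\<integral>x. indicator B x / a \<partial>N) - (\<integral>x. indicator B x * (1 - cos (\<xi> \<bullet> x)) / a \<partial>N)"
        by (intro Bochner_Integration.integral_diff integrable_divide ind integrable_cos B)
      also have "\<dots> = 1 - jump_exponent N B \<xi> / a"
        using a(1) by (simp add: jump_exponent_def a_def)
      finally have eq: "charfun_vec \<kappa> \<xi> = complex_of_real (1 - jump_exponent N B \<xi> / a) + \<i> * complex_of_real 0" .
      show ?thesis unfolding eq using a(1) by (simp add: algebra_simps)
    qed
    then show ?thesis using \<mu> by auto
  qed
qed

text \<open>The balls shrink to the origin, which contributes nothing, and the integrands lie in
  [0, 1]. At every fixed scale \<open>s\<close> this makes the right side of the tail bound as small
  as desired.\<close>

lemma small_jumps_vanish:
  "(\<lambda>j. \<integral>z. 1 - exp (- jump_exponent N {x. norm x < 1 / real (Suc j)} (s *\<^sub>R z)) \<partial>std_gaussian) \<longlonglongrightarrow> 0"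
proof -
  have [measurable]: "{x :: real^'n. norm x < c} \<in> sets borel" for c by measurable
  have "(\<lambda>j. \<integral>z. 1 - exp (- jump_exponent N {x. norm x < 1 / real (Suc j)} (s *\<^sub>R z)) \<partial>std_gaussian)
    \<longlonglongrightarrow> (\<integral>z. 0 \<partial>(std_gaussian :: (real^'n) measure))"
  proof (rule integral_dominated_convergence[where w="\<lambda>_. 1"])
    show "AE z in std_gaussian. (\<lambda>j. 1 - exp (- jump_exponent N {x. norm x < 1 / real (Suc j)} (s *\<^sub>R z))) \<longlonglongrightarrow> 0"
    proof (intro AE_I2)
      fix z :: "real^'n"
      have "(\<lambda>j. jump_exponent N {x. norm x < 1 / real (Suc j)} (s *\<^sub>R z)) \<longlonglongrightarrow> jump_exponent N {} (s *\<^sub>R z)"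
      proof (rule jump_exponent_tendsto)
        fix x :: "real^'n" assume "x \<noteq> 0"
        then have "eventually (\<lambda>j. 1 / real (Suc j) < norm x) sequentially"
          by (intro order_tendstoD(2)[OF LIMSEQ_Suc[OF lim_const_over_n]]) simp
        then have "eventually (\<lambda>j. indicator {x. norm x < 1 / real (Suc j)} x = (indicator {} x :: real)) sequentially"
          by eventually_elim (auto simp: indicator_def)
        then show "(\<lambda>j. indicator {x. norm x < 1 / real (Suc j)} x :: real) \<longlonglongrightarrow> indicator {} x"
          by (rule tendsto_eventually)
      qed auto
      then have "(\<lambda>j. 1 - exp (- jump_exponent N {x. norm x < 1 / real (Suc j)} (s *\<^sub>R z))) \<longlonglongrightarrow> 1 - exp (- jump_exponent N {} (s *\<^sub>R z))"
        by (intro tendsto_intros)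
      then show "(\<lambda>j. 1 - exp (- jump_exponent N {x. norm x < 1 / real (Suc j)} (s *\<^sub>R z))) \<longlonglongrightarrow> 0"
        by (simp add: jump_exponent_def)
    qed
  qed (auto simp: jump_exponent_nonneg)
  then show ?thesis by simp
qed

text \<open>The jumps are cut into annuli that shrink fast enough for Borel--Cantelli to make the series
  of the independent compound Poisson variables converge absolutely.\<close>

lemma jump_law:
  "\<exists>\<mu>. borel_prob \<mu> \<and> (\<forall>\<xi>. charfun_vec \<mu> \<xi> = exp (complex_of_real (- jump_exponent N UNIV \<xi>)))"
proof -
  have [measurable]: "{x :: real^'n. norm x < c} \<in> sets borel" "{x :: real^'n. c \<le> norm x} \<in> sets borel" for c
    by measurable
  let ?I = "\<lambda>s B. \<integral>z. 1 - exp (- jump_exponent N B (s *\<^sub>R z)) \<partial>std_gaussian"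
  have int: "integrable std_gaussian (\<lambda>z. 1 - exp (- jump_exponent N B (s *\<^sub>R z)))" if "B \<in> sets borel" for B s
    using that by (intro std_gaussian.integrable_bounded[where C=1]) (auto simp: jump_exponent_nonneg)
  \<comment> \<open>The scale \<open>2 ^ Suc k\<close> is the threshold prescribed for the
    coordinate with index \<open>Suc k\<close>; the bound 2^-k makes the tail probabilities
    summable.\<close>
  have "\<exists>j. ?I (2 ^ Suc k) {x. norm x < 1 / real (Suc j)} \<le> (1/2) ^ k" for k
    using order_tendstoD(2)[OF small_jumps_vanish[of "2 ^ Suc k"], of "(1/2) ^ k"]
    by (auto simp: eventually_sequentially intro: less_imp_le)
  then obtain j where j: "\<And>k. ?I (2 ^ Suc k) {x. norm x < 1 / real (Suc (j k))} \<le> (1/2) ^ k" by metis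
  \<comment> \<open>Partial sums replace \<open>j\<close> itself: they dominate every
    \<open>j k\<close> and grow at least linearly, so the radii below decrease to 0 and still
    respect the chosen smallness.\<close>
  define J where "J = (\<lambda>k. \<Sum>i\<le>k. Suc (j i))"
  define \<rho> where "\<rho> = (\<lambda>k. 1 / real (Suc (J k)))"
  have Jj: "j k \<le> J k" for k unfolding J_def by (rule order_trans[OF _ member_le_sum[of k]]) auto
  have Jk: "k \<le> J k" for k by (induction k) (auto simp: J_def)
  have \<rho>pos: "0 < \<rho> k" for k by (simp add: \<rho>_def)
  have "J k \<le> J (Suc k)" for k by (simp add: J_def)
  then have \<rho>dec: "\<rho> (Suc k) \<le> \<rho> k" for k unfolding \<rho>_def by (intro frac_le) auto
  have \<rho>0: "\<rho> \<longlonglongrightarrow> 0"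
  proof (rule tendsto_sandwich[OF _ _ tendsto_const LIMSEQ_Suc[OF lim_const_over_n[of "1::real"]]])
    show "eventually (\<lambda>k. \<rho> k \<le> 1 / real (Suc k)) sequentially"
      using Jk by (intro always_eventually allI) (auto simp: \<rho>_def intro!: divide_left_mono)
  qed (auto intro!: always_eventually less_imp_le \<rho>pos)
  \<comment> \<open>\<open>B 0\<close> is the unbounded exterior region; the others are half-open
    annuli, hence disjoint.\<close>
  define B where "B = (\<lambda>k. {x :: real^'n. \<rho> k \<le> norm x} \<inter> (if k = 0 then UNIV else {x. norm x < \<rho> (k - 1)}))"
  have [measurable]: "B k \<in> sets borel" for k unfolding B_def by auto
  have "\<exists>\<mu>. borel_prob \<mu> \<and> (\<forall>\<xi>. charfun_vec \<mu> \<xi> = exp (complex_of_real (- jump_exponent N (B k) \<xi>)))" for k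
    by (rule finite_jump_law[OF _ _ \<rho>pos[of k]]) (auto simp: B_def split: if_splits)
  then obtain K where K: "\<And>k. borel_prob (K k)"
    "\<And>k \<xi>. charfun_vec (K k) \<xi> = exp (complex_of_real (- jump_exponent N (B k) \<xi>))" by metis
  have sumB: "(\<Sum>k\<le>n. jump_exponent N (B k) \<xi>) = jump_exponent N {x. \<rho> n \<le> norm x} \<xi>" for n \<xi>
  proof (induction n)
    case 0
    then show ?case by (simp add: B_def)
  next
    case (Suc n)
    have "{x. \<rho> (Suc n) \<le> norm x} = {x. \<rho> n \<le> norm x} \<union> B (Suc n)"
      using \<rho>dec[of n] by (auto simp: B_def)
    moreover have "{x. \<rho> n \<le> norm x} \<inter> B (Suc n) = {}" by (auto simp: B_def)
    ultimately show ?case using Suc by (simp add: jump_exponent_Un)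
  qed
  show ?thesis
  proof (rule infinite_convolution[OF K(1)])
    show "summable (\<lambda>k. measure (K k) {x. 1 \<le> 2 ^ k * norm x})"
    \<comment> \<open>The index 0 is dropped: the exterior region carries the large jumps and has no
      smallness bound.\<close>
    proof (subst summable_Suc_iff[symmetric], rule summable_comparison_test')
      show "summable (\<lambda>k. (1/2) ^ k / (1 - exp (-1/2)) :: real)"
        by (intro summable_divide summable_geometric) simp
      fix k :: nat
      have pos: "0 < 1 - exp (-1/2 :: real)" by simp
      have "(1 - exp (-1/2)) * measure (K (Suc k)) {x. 1 \<le> 2 ^ Suc k * norm x} \<le> ?I (2 ^ Suc k) (B (Suc k))"
        by (rule tail_bound_charfun[OF K(1) K(2)]) (auto simp: jump_exponent_nonneg)
      also have "\<dots> \<le> ?I (2 ^ Suc k) {x. norm x < 1 / real (Suc (j k))}"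
      proof (intro integral_mono int)
        fix z :: "real^'n"
        have "\<rho> k \<le> 1 / real (Suc (j k))" using Jj[of k] by (auto simp: \<rho>_def intro!: divide_left_mono)
        then have "B (Suc k) \<subseteq> {x. norm x < 1 / real (Suc (j k))}" by (auto simp: B_def)
        then show "1 - exp (- jump_exponent N (B (Suc k)) (2 ^ Suc k *\<^sub>R z)) \<le>
            1 - exp (- jump_exponent N {x. norm x < 1 / real (Suc (j k))} (2 ^ Suc k *\<^sub>R z))"
          using jump_exponent_mono by simp
      qed auto
      also have "\<dots> \<le> (1/2) ^ k" by (rule j)
      finally show "norm (measure (K (Suc k)) {x. 1 \<le> 2 ^ Suc k * norm x}) \<le> (1/2) ^ k / (1 - exp (-1/2))"
        using pos by (simp add: le_divide_eq mult.commute)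
    qed
    fix \<xi> :: "real^'n"
    have "(\<lambda>n. jump_exponent N {x. \<rho> n \<le> norm x} \<xi>) \<longlonglongrightarrow> jump_exponent N UNIV \<xi>"
    proof (rule jump_exponent_tendsto)
      fix x :: "real^'n" assume "x \<noteq> 0"
      then have "eventually (\<lambda>n. \<rho> n < norm x) sequentially"
        by (intro order_tendstoD(2)[OF \<rho>0]) simp
      then have "eventually (\<lambda>n. indicator {x. \<rho> n \<le> norm x} x = (indicator UNIV x :: real)) sequentially"
        by eventually_elim (auto simp: indicator_def)
      then show "(\<lambda>n. indicator {x. \<rho> n \<le> norm x} x :: real) \<longlonglongrightarrow> indicator UNIV x"
        by (rule tendsto_eventually)
    qed auto
    then have "(\<lambda>n. exp (complex_of_real (- jump_exponent N {x. \<rho> n \<le> norm x} \<xi>))) \<longlonglongrightarrow> exp (complex_of_real (- jump_exponent N UNIV \<xi>))"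
      by (intro tendsto_intros)
    moreover have "(\<Prod>k<Suc n. charfun_vec (K k) \<xi>) = exp (complex_of_real (- jump_exponent N {x. \<rho> n \<le> norm x} \<xi>))" for n
      by (simp only: K(2) sumB[symmetric] lessThan_Suc_atMost sum_negf[symmetric] of_real_sum exp_sum[OF finite_atMost])
    ultimately have "(\<lambda>n. \<Prod>k<Suc n. charfun_vec (K k) \<xi>) \<longlonglongrightarrow> exp (complex_of_real (- jump_exponent N UNIV \<xi>))"
      by simp
    then show "(\<lambda>n. \<Prod>k<n. charfun_vec (K k) \<xi>) \<longlonglongrightarrow> exp (complex_of_real (- jump_exponent N UNIV \<xi>))"
      by (rule LIMSEQ_imp_Suc)
  qed
qed

text \<open>The sine and its compensator are kept together, since the sine alone may fail to be
  integrable near 0. Their difference is odd and dominated by a multiple of min 1 |x|^2, hence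
  integrates to 0.\<close>

lemma levy_exponent_eq:
  "levy_exponent A N 0 \<xi> = complex_of_real (- (\<xi> \<bullet> (A *v \<xi>)) / 2 - jump_exponent N UNIV \<xi>)"
proof -
  let ?o = "\<lambda>x. sin (\<xi> \<bullet> x) - (\<xi> \<bullet> x) * indicator (cball 0 1) x"
  have bound: "\<bar>?o x\<bar> \<le> (1 + (norm \<xi>)\<^sup>2) * min 1 ((norm x)\<^sup>2)" for x
  proof (cases "norm x \<le> 1")
    case True
    have "\<bar>?o x\<bar> \<le> (\<xi> \<bullet> x)\<^sup>2 / 2" using True abs_sin_minus_le[of "\<xi> \<bullet> x"] by simp
    also have "(\<xi> \<bullet> x)\<^sup>2 \<le> (norm \<xi> * norm x)\<^sup>2"
      using Cauchy_Schwarz_ineq2[of \<xi> x] by (simp add: abs_le_square_iff[symmetric] abs_mult)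
    also have "(norm \<xi> * norm x)\<^sup>2 / 2 \<le> (1 + (norm \<xi>)\<^sup>2) * (norm x)\<^sup>2"
      by (simp add: power_mult_distrib algebra_simps)
    also have "(norm x)\<^sup>2 = min 1 ((norm x)\<^sup>2)" using True by (simp add: power_le_one)
    finally show ?thesis by simp
  next
    case False
    then have "1 \<le> (norm x)\<^sup>2" by (simp add: one_le_power)
    then have m: "min 1 ((norm x)\<^sup>2) = 1" by (rule min_absorb1)
    have "\<bar>?o x\<bar> \<le> 1" using False by simp
    also have "1 \<le> 1 + (norm \<xi>)\<^sup>2" by simp
    finally show ?thesis unfolding m by simp
  qed
  have [measurable]: "cball 0 1 \<in> sets (borel :: (real^'n) measure)" by auto
  have [measurable]: "?o \<in> borel_measurable borel" by measurable
  have int_o: "integrable N ?o"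
    by (rule integrable_min_bound[where C="1 + (norm \<xi>)\<^sup>2"]) (use bound in simp_all)
  have int_c: "integrable N (\<lambda>x. 1 - cos (\<xi> \<bullet> x))"
    using integrable_cos[of UNIV \<xi>] by simp
  have "(\<integral>x. exp (\<i> * complex_of_real (\<xi> \<bullet> x)) - 1 - \<i> * complex_of_real ((\<xi> \<bullet> x) * indicator (cball 0 1) x) \<partial>N)
    = (\<integral>x. \<i> * complex_of_real (?o x) - complex_of_real (1 - cos (\<xi> \<bullet> x)) \<partial>N)"
    by (intro Bochner_Integration.integral_cong refl)
       (simp add: cis_conv_exp[symmetric] complex_eq_iff)
  also have "\<dots> = \<i> * complex_of_real (\<integral>x. ?o x \<partial>N) - complex_of_real (\<integral>x. 1 - cos (\<xi> \<bullet> x) \<partial>N)"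
    using int_o int_c by (subst Bochner_Integration.integral_diff) (auto simp del: of_real_diff)
  also have "(\<integral>x. ?o x \<partial>N) = 0"
    by (rule integral_odd) (auto simp: indicator_def)
  finally show ?thesis
    by (simp add: levy_exponent_def jump_exponent_def)
qed

lemma ID_law_charfun:
  fixes A :: "real^'n^'n"
  assumes "transpose A = A" and "\<And>\<xi>. 0 \<le> \<xi> \<bullet> (A *v \<xi>)"
  shows "borel_prob (ID_law A N 0)"
    and "charfun_vec (ID_law A N 0) \<xi> = exp (complex_of_real (- (\<xi> \<bullet> (A *v \<xi>)) / 2 - jump_exponent N UNIV \<xi>))"
proof -
  obtain \<mu> where \<mu>: "borel_prob \<mu>" "\<And>\<xi>. charfun_vec \<mu> \<xi> = exp (complex_of_real (- (\<xi> \<bullet> (A *v \<xi>)) / 2))"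
    using gaussian_law[OF assms] by blast
  obtain \<kappa> where \<kappa>: "borel_prob \<kappa>" "\<And>\<xi>. charfun_vec \<kappa> \<xi> = exp (complex_of_real (- jump_exponent N UNIV \<xi>))"
    using jump_law by blast
  have is_ID: "is_ID m A N 0 \<longleftrightarrow> borel_prob m \<and>
    (\<forall>\<xi>. charfun_vec m \<xi> = exp (complex_of_real (- (\<xi> \<bullet> (A *v \<xi>)) / 2 - jump_exponent N UNIV \<xi>)))" for m
    unfolding is_ID_def levy_exponent_eq by (auto simp: borel_prob_def borel_prob_axioms_def)
  have "is_ID (\<mu> \<star> \<kappa>) A N 0"
    unfolding is_ID charfun_convolution[OF \<mu>(1) \<kappa>(1)] \<mu>(2) \<kappa>(2)
    by (auto simp: borel_prob_convolution \<mu> \<kappa> exp_add[symmetric] of_real_add[symmetric] simp del: of_real_add of_real_diff of_real_minus of_real_divide)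
  then have "is_ID (ID_law A N 0) A N 0"
    unfolding ID_law_def
  proof (rule theI)
    fix m assume "is_ID m A N 0"
    with \<open>is_ID (\<mu> \<star> \<kappa>) A N 0\<close> show "m = (\<mu> \<star> \<kappa>)"
      unfolding is_ID by (intro charfun_unique) auto
  qed
  then show "borel_prob (ID_law A N 0)"
    "charfun_vec (ID_law A N 0) \<xi> = exp (complex_of_real (- (\<xi> \<bullet> (A *v \<xi>)) / 2 - jump_exponent N UNIV \<xi>))"
    unfolding is_ID by auto
qed

end

subsection \<open>The convolution semigroup of the symmetrised process\<close>

lemma sets_sym_levy [simp, measurable_cong]: "sets (sym_levy \<nu>) = sets borel"
  unfolding sym_levy_def using sets.sets_measure_of_eq[of borel] by simp

text \<open>A measure given by \<open>measure_of\<close> has the prescribed values only once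
  countable additivity is verified. Rewriting the reflected image as a preimage turns the second
  summand into a push-forward, for which additivity is known.\<close>

lemma emeasure_sym_levy:
  fixes \<nu> :: "(real^'n) measure"
  assumes [measurable_cong]: "sets \<nu> = sets borel" and B: "B \<in> sets borel"
  shows "emeasure (sym_levy \<nu>) B = emeasure \<nu> B + emeasure (distr \<nu> borel uminus) B"
proof -
  have sp: "space \<nu> = UNIV" using sets_eq_imp_space_eq[OF assms(1)] by simp
  have eq: "emeasure \<nu> C + emeasure \<nu> (uminus ` C) = emeasure \<nu> C + emeasure (distr \<nu> borel uminus) C"
    if C: "C \<in> sets borel" for C
  proof -
    have "uminus ` C = uminus -` C" by (auto simp: image_iff) (metis minus_minus)
    then show ?thesis using C by (subst emeasure_distr) (auto simp: sp)
  qed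
  have "emeasure (sym_levy \<nu>) B = emeasure \<nu> B + emeasure \<nu> (uminus ` B)"
    unfolding sym_levy_def
  proof (rule emeasure_measure_of_sigma)
    show "sigma_algebra UNIV (sets (borel :: (real^'n) measure))"
      using sets.sigma_algebra_axioms[of "borel :: (real^'n) measure"] by simp
    show "positive (sets borel) (\<lambda>B. emeasure \<nu> B + emeasure \<nu> (uminus ` B))"
      by (simp add: positive_def)
    show "countably_additive (sets borel) (\<lambda>B. emeasure \<nu> B + emeasure \<nu> (uminus ` B))"
    proof (rule countably_additiveI)
      fix C :: "nat \<Rightarrow> (real^'n) set"
      assume C: "range C \<subseteq> sets borel" "disjoint_family C" "(\<Union>i. C i) \<in> sets borel"
      have "(\<Sum>i. emeasure \<nu> (C i) + emeasure \<nu> (uminus ` C i)) = (\<Sum>i. emeasure \<nu> (C i) + emeasure (distr \<nu> borel uminus) (C i))"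
        using C by (intro suminf_cong eq) auto
      also have "\<dots> = (\<Sum>i. emeasure \<nu> (C i)) + (\<Sum>i. emeasure (distr \<nu> borel uminus) (C i))"
        by (rule suminf_add[symmetric]) (auto intro: summableI)
      also have "\<dots> = emeasure \<nu> (\<Union>i. C i) + emeasure (distr \<nu> borel uminus) (\<Union>i. C i)"
        using C assms(1) by (subst (1 2) suminf_emeasure) auto
      finally show "(\<Sum>i. emeasure \<nu> (C i) + emeasure \<nu> (uminus ` C i)) = emeasure \<nu> (\<Union>i. C i) + emeasure \<nu> (uminus ` (\<Union>i. C i))"
        by (simp only: eq[OF C(3)])
    qed
  qed (rule B)
  then show ?thesis using eq[OF B] by simp
qed

lemma nn_integral_sym_levy:
  fixes \<nu> :: "(real^'n) measure"
  assumes [measurable_cong]: "sets \<nu> = sets borel" and f: "f \<in> borel_measurable borel"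
  shows "(\<integral>\<^sup>+x. f x \<partial>sym_levy \<nu>) = (\<integral>\<^sup>+x. f x \<partial>\<nu>) + (\<integral>\<^sup>+x. f x \<partial>distr \<nu> borel uminus)"
  using f
proof (induction f rule: borel_measurable_induct)
  case (cong f g)
  then have "f = g" by auto
  then show ?case using cong by simp
next
  case (set B)
  then show ?case using emeasure_sym_levy[OF assms(1), of B] by simp
next
  case (mult u c)
  then show ?case by (simp add: nn_integral_cmult distrib_left)
next
  case (add u v)
  then show ?case by (simp add: nn_integral_add ac_simps)
next
  case (seq U)
  have [measurable]: "U i \<in> borel_measurable borel" for i using seq by auto
  have mono: "incseq (\<lambda>i. integral\<^sup>N M (U i))" for M
    using \<open>incseq U\<close> by (auto simp: incseq_def le_fun_def intro!: nn_integral_mono)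
  have eq: "(\<integral>\<^sup>+x. (SUP i. U i) x \<partial>M) = (SUP i. integral\<^sup>N M (U i))" if "sets M = sets borel" for M
  proof -
    have [measurable_cong]: "sets M = sets borel" by fact
    show ?thesis unfolding SUP_apply using \<open>incseq U\<close>
      by (intro nn_integral_monotone_convergence_SUP) auto
  qed
  have IH: "integral\<^sup>N (sym_levy \<nu>) (U i) = integral\<^sup>N \<nu> (U i) + integral\<^sup>N (distr \<nu> borel uminus) (U i)" for i
    using seq by blast
  show ?case
    unfolding eq[OF sets_sym_levy] eq[OF assms(1)] eq[OF sets_distr] IH
    by (rule ennreal_SUP_add[OF mono mono])
qed

lemma sym_levy_measure_sym_levy:
  fixes \<nu> :: "(real^'n) measure"
  assumes "levy_measure \<nu>"
  shows "sym_levy_measure (sym_levy \<nu>)"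
proof
  have s [measurable_cong]: "sets \<nu> = sets borel" using assms by (simp add: levy_measure_def)
  have sp: "space \<nu> = UNIV" using sets_eq_imp_space_eq[OF s] by simp
  have "emeasure (distr \<nu> borel uminus) {0} = 0"
    using assms by (subst emeasure_distr) (auto simp: levy_measure_def sp vimage_def)
  then show "levy_measure (sym_levy \<nu>)"
    using assms unfolding levy_measure_def
    by (auto simp: emeasure_sym_levy nn_integral_sym_levy nn_integral_distr)
  show "distr (sym_levy \<nu>) borel uminus = sym_levy \<nu>"
  proof (rule measure_eqI)
    fix B assume "B \<in> sets (distr (sym_levy \<nu>) borel uminus)"
    then have B [measurable]: "B \<in> sets borel" by simp
    have B': "uminus -` B \<in> sets borel" using measurable_sets[of uminus borel borel B] by simp
    have "emeasure (distr (sym_levy \<nu>) borel uminus) B = emeasure (sym_levy \<nu>) (uminus -` B)"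
      using sets_eq_imp_space_eq[OF sets_sym_levy[of \<nu>]] by (subst emeasure_distr) auto
    also have "\<dots> = emeasure \<nu> (uminus -` B) + emeasure \<nu> (uminus -` (uminus -` B))"
      using B' by (subst emeasure_sym_levy[OF s B'], subst emeasure_distr) (auto simp: sp)
    also have "uminus -` (uminus -` B) = B" by auto
    also have "emeasure \<nu> (uminus -` B) + emeasure \<nu> B = emeasure (sym_levy \<nu>) B"
      by (subst emeasure_sym_levy[OF s B], subst emeasure_distr) (auto simp: sp add.commute)
    finally show "emeasure (distr (sym_levy \<nu>) borel uminus) B = emeasure (sym_levy \<nu>) B" .
  qed simp
qed

lemma scale_measure_h_eq_density:
  fixes N :: "(real^'n) measure"
  assumes s: "sets N = sets borel"
  shows "scale_measure_h h N = density N (\<lambda>_. ennreal h)"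
proof -
  have sp: "space N = UNIV" using sets_eq_imp_space_eq[OF s] by simp
  have "scale_measure_h h N = scale_measure (ennreal h) N"
    unfolding scale_measure_h_def scale_measure_def by (simp add: s sp)
  also have "\<dots> = density N (\<lambda>_. ennreal h)"
    by (rule measure_eqI) (auto simp: emeasure_density nn_integral_cmult_indicator)
  finally show ?thesis .
qed

lemma (in sym_levy_measure) sym_levy_measure_scale:
  "sym_levy_measure (scale_measure_h h N)"
  and jump_exponent_scale: "0 \<le> h \<Longrightarrow> jump_exponent (scale_measure_h h N) UNIV \<xi> = h * jump_exponent N UNIV \<xi>"
proof -
  show "sym_levy_measure (scale_measure_h h N)"
  proof
    have "emeasure N {0} = 0" "(\<integral>\<^sup>+x. ennreal (min 1 ((norm x)\<^sup>2)) \<partial>N) < \<infinity>"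
      using levy by (auto simp: levy_measure_def)
    then show "levy_measure (scale_measure_h h N)"
      unfolding levy_measure_def scale_measure_h_eq_density[OF sets_eq]
      by (auto simp: emeasure_density nn_integral_cmult_indicator nn_integral_density nn_integral_cmult ennreal_mult_less_top)
    have "distr (density N (\<lambda>_. ennreal h)) borel uminus = density (distr N borel uminus) (\<lambda>_. ennreal h)"
    proof (rule measure_eqI)
      fix B assume "B \<in> sets (distr (density N (\<lambda>_. ennreal h)) borel uminus)"
      then have B [measurable]: "B \<in> sets borel" by simp
      have B': "uminus -` B \<in> sets borel" using measurable_sets[of uminus borel borel B] by simp
      show "emeasure (distr (density N (\<lambda>_. ennreal h)) borel uminus) B = emeasure (density (distr N borel uminus) (\<lambda>_. ennreal h)) B"
        using B' by (simp add: emeasure_distr emeasure_density nn_integral_cmult_indicator)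
    qed simp
    then show "distr (scale_measure_h h N) borel uminus = scale_measure_h h N"
      unfolding scale_measure_h_eq_density[OF sets_eq] by (simp add: sym)
  qed
  show "0 \<le> h \<Longrightarrow> jump_exponent (scale_measure_h h N) UNIV \<xi> = h * jump_exponent N UNIV \<xi>"
    unfolding jump_exponent_def scale_measure_h_eq_density[OF sets_eq]
    by (subst integral_density) auto
qed

text \<open>The exponent per unit time of the symmetrised process, with the sign that makes it
  nonnegative. There is no 1/2 in front of the quadratic form because the covariance is 2
  \<open>A\<close>.\<close>

definition sym_symbol :: "real^'n^'n \<Rightarrow> (real^'n) measure \<Rightarrow> real^'n \<Rightarrow> real" where
  "sym_symbol A \<nu> \<xi> = \<xi> \<bullet> (A *v \<xi>) + jump_exponent (sym_levy \<nu>) UNIV \<xi>"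

text \<open>Extended by the point mass at 0 to nonpositive times, so that it is a kernel on the
  whole real line and can be mixed over any law of random times.\<close>

definition levy_law :: "real^'n^'n \<Rightarrow> (real^'n) measure \<Rightarrow> real \<Rightarrow> (real^'n) measure" where
  "levy_law A \<nu> t = (if 0 < t then ID_law ((2 * t) *\<^sub>R A) (scale_measure_h t (sym_levy \<nu>)) 0 else return borel 0)"

section \<open>The laws at all times: symbol, symmetry, semigroup property, continuity at 0\<close>

context
  fixes A :: "real^'n^'n" and \<nu> :: "(real^'n) measure"
  assumes A_sym: "transpose A = A" and A_psd: "\<And>\<xi>. 0 \<le> \<xi> \<bullet> (A *v \<xi>)" and levy: "levy_measure \<nu>"
begin

interpretation L: sym_levy_measure "sym_levy \<nu>"
  by (rule sym_levy_measure_sym_levy[OF levy])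

lemma sym_symbol_nonneg: "0 \<le> sym_symbol A \<nu> \<xi>"
  unfolding sym_symbol_def using A_psd L.jump_exponent_nonneg by (simp add: add_nonneg_nonneg)

lemma sym_symbol_measurable [measurable]: "sym_symbol A \<nu> \<in> borel_measurable borel"
proof -
  have "continuous_on UNIV (\<lambda>\<xi>. \<xi> \<bullet> (A *v \<xi>))"
    by (intro continuous_intros linear_continuous_on matrix_vector_mul_bounded_linear)
  then have [measurable]: "(\<lambda>\<xi>. \<xi> \<bullet> (A *v \<xi>)) \<in> borel_measurable borel"
    by (rule borel_measurable_continuous_onI)
  show ?thesis unfolding sym_symbol_def[abs_def] by measurable
qed

lemma sym_symbol_even: "sym_symbol A \<nu> (- \<xi>) = sym_symbol A \<nu> \<xi>"
  unfolding sym_symbol_def jump_exponent_def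
  by (simp add: linear_neg[OF matrix_vector_mul_linear])

lemma levy_law: "borel_prob (levy_law A \<nu> t)"
  and charfun_levy_law: "charfun_vec (levy_law A \<nu> t) \<xi> = exp (complex_of_real (- (max t 0 * sym_symbol A \<nu> \<xi>)))"
proof -
  have "borel_prob (levy_law A \<nu> t) \<and> charfun_vec (levy_law A \<nu> t) \<xi> = exp (complex_of_real (- (max t 0 * sym_symbol A \<nu> \<xi>)))"
  proof (cases "0 < t")
    case True
    interpret S: sym_levy_measure "scale_measure_h t (sym_levy \<nu>)"
      by (rule L.sym_levy_measure_scale)
    have 1: "transpose ((2 * t) *\<^sub>R A) = (2 * t) *\<^sub>R A" using A_sym by (simp add: transpose_scalar scalar_matrix_assoc)
    have 2: "\<xi> \<bullet> (((2 * t) *\<^sub>R A) *v \<xi>) = 2 * t * (\<xi> \<bullet> (A *v \<xi>))" for \<xi>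
      by (simp only: scaleR_matrix_vector_assoc[symmetric] inner_scaleR_right)
    have 3: "0 \<le> \<xi> \<bullet> (((2 * t) *\<^sub>R A) *v \<xi>)" for \<xi> unfolding 2 using A_psd True by simp
    have eq: "- (\<xi> \<bullet> (((2 * t) *\<^sub>R A) *v \<xi>)) / 2 - jump_exponent (scale_measure_h t (sym_levy \<nu>)) UNIV \<xi> = - (max t 0 * sym_symbol A \<nu> \<xi>)"
      unfolding 2 using True by (simp add: L.jump_exponent_scale sym_symbol_def algebra_simps)
    then show ?thesis
      using S.ID_law_charfun(1)[OF 1 3] S.ID_law_charfun(2)[OF 1 3, of \<xi>, unfolded eq] True
      by (simp only: levy_law_def if_True)
  next
    case False
    then show ?thesis by (simp add: levy_law_def borel_prob_return charfun_return)
  qed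
  then show "borel_prob (levy_law A \<nu> t)"
    "charfun_vec (levy_law A \<nu> t) \<xi> = exp (complex_of_real (- (max t 0 * sym_symbol A \<nu> \<xi>)))" by auto
qed

lemma levy_law_symmetric: "distr (levy_law A \<nu> t) borel uminus = levy_law A \<nu> t"
proof (rule charfun_unique[OF _ levy_law])
  interpret borel_prob "levy_law A \<nu> t" by (rule levy_law)
  show "borel_prob (distr (levy_law A \<nu> t) borel uminus)"
    by (intro borel_prob.intro borel_prob_axioms.intro prob_space_distr) auto
qed (simp only: charfun_reflect[OF levy_law] charfun_levy_law sym_symbol_even)

lemma levy_law_convolution:
  assumes "0 \<le> s" "0 \<le> t"
  shows "(levy_law A \<nu> s \<star> levy_law A \<nu> t) = levy_law A \<nu> (s + t)"
proof (rule charfun_unique[OF borel_prob_convolution[OF levy_law levy_law] levy_law])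
  fix \<xi>
  have "- (max s 0 * sym_symbol A \<nu> \<xi>) + - (max t 0 * sym_symbol A \<nu> \<xi>) = - (max (s + t) 0 * sym_symbol A \<nu> \<xi>)"
    using assms by (simp add: algebra_simps)
  then show "charfun_vec (levy_law A \<nu> s \<star> levy_law A \<nu> t) \<xi> = charfun_vec (levy_law A \<nu> (s + t)) \<xi>"
    unfolding charfun_convolution[OF levy_law levy_law] charfun_levy_law exp_add[symmetric] of_real_add[symmetric]
    by simp
qed

lemma levy_law_kernel: "levy_law A \<nu> \<in> borel \<rightarrow>\<^sub>M prob_algebra borel"
proof (rule kernel_from_charfun[OF levy_law])
  show "(\<lambda>(t, \<xi>). charfun_vec (levy_law A \<nu> t) \<xi>) \<in> borel_measurable (borel \<Otimes>\<^sub>M borel)"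
    unfolding charfun_levy_law by measurable
qed

text \<open>The Gaussian tail bound at scale 1 / r, whose right side tends to 0 with t by dominated
  convergence.\<close>

lemma levy_law_concentrates:
  assumes "0 < r"
  shows "((\<lambda>t. measure (levy_law A \<nu> t) {x. r \<le> norm x}) \<longlongrightarrow> 0) (at_right 0)"
proof -
  let ?c = "1 - exp (-1/2) :: real"
  let ?J = "\<lambda>t. \<integral>z. 1 - exp (- (max t 0 * sym_symbol A \<nu> ((1/r) *\<^sub>R z))) \<partial>std_gaussian"
  have c: "0 < ?c" by simp
  have "(?J \<longlongrightarrow> (\<integral>z. 0 \<partial>(std_gaussian :: (real^'n) measure))) (at_right 0)"
  proof (rule tendsto_at_right_sequentially[of 0 1])
    fix S :: "nat \<Rightarrow> real" assume S: "S \<longlonglongrightarrow> 0"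
    show "(\<lambda>n. ?J (S n)) \<longlonglongrightarrow> (\<integral>z. 0 \<partial>(std_gaussian :: (real^'n) measure))"
    proof (rule integral_dominated_convergence[where w="\<lambda>_. 1"])
      have "(\<lambda>n. 1 - exp (- (max (S n) 0 * sym_symbol A \<nu> ((1/r) *\<^sub>R z)))) \<longlonglongrightarrow> 1 - exp (- (max 0 0 * sym_symbol A \<nu> ((1/r) *\<^sub>R z)))" for z
        by (intro tendsto_intros S)
      then show "AE z in std_gaussian. (\<lambda>n. 1 - exp (- (max (S n) 0 * sym_symbol A \<nu> ((1/r) *\<^sub>R z)))) \<longlonglongrightarrow> 0"
        by simp
    qed (auto simp: sym_symbol_nonneg)
  qed simp
  then have J: "((\<lambda>t. ?J t / ?c) \<longlongrightarrow> 0) (at_right 0)" by (auto intro: tendsto_divide_zero)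
  have "measure (levy_law A \<nu> t) {x. r \<le> norm x} \<le> ?J t / ?c" for t
  proof -
    have "?c * measure (levy_law A \<nu> t) {x. 1 \<le> (1/r) * norm x} \<le> ?J t"
      by (rule tail_bound_charfun[OF levy_law charfun_levy_law]) (use assms in \<open>auto simp: sym_symbol_nonneg\<close>)
    moreover have "{x :: real^'n. 1 \<le> (1/r) * norm x} = {x. r \<le> norm x}" using assms by (auto simp: field_simps)
    ultimately show ?thesis using c by (simp add: le_divide_eq mult.commute)
  qed
  then show ?thesis
    by (intro tendsto_sandwich[OF _ _ tendsto_const J]) (auto intro!: always_eventually)
qed

end

subsection \<open>Translations and square-integrable functions\<close>

lemma
  fixes g :: "'a::euclidean_space \<Rightarrow> real"
  assumes "integrable lborel g"
  shows integrable_translate: "integrable lborel (\<lambda>x. g (x + z))"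
    and integral_translate: "(\<integral>x. g (x + z) \<partial>lborel) = (\<integral>x. g x \<partial>lborel)"
proof -
  have [measurable]: "g \<in> borel_measurable borel" using assms by auto
  have "integrable (distr lborel borel ((+) z)) g" using assms by (simp add: lborel_distr_plus)
  then show "integrable lborel (\<lambda>x. g (x + z))"
    by (subst (asm) integrable_distr_eq) (auto simp: add.commute)
  have "(\<integral>x. g x \<partial>lborel) = (\<integral>x. g x \<partial>distr lborel borel ((+) z))" by (simp add: lborel_distr_plus)
  also have "\<dots> = (\<integral>x. g (x + z) \<partial>lborel)" by (subst integral_distr) (auto simp: add.commute)
  finally show "(\<integral>x. g (x + z) \<partial>lborel) = (\<integral>x. g x \<partial>lborel)" by simp
qed

text \<open>\<open>f\<close> is compared with \<open>g\<close> at both ends of the translation; by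
  invariance of Lebesgue measure the two errors agree, whence the factor 2.\<close>

lemma integral_abs_translate_diff_le:
  fixes f g :: "'a::euclidean_space \<Rightarrow> real"
  assumes f: "integrable lborel f" and g: "integrable lborel g"
  shows "(\<integral>x. \<bar>f (x + z) - f x\<bar> \<partial>lborel) \<le> 2 * (\<integral>x. \<bar>f x - g x\<bar> \<partial>lborel) + (\<integral>x. \<bar>g (x + z) - g x\<bar> \<partial>lborel)"
proof -
  note [simp] = f g integrable_translate[OF f] integrable_translate[OF g]
  have d: "integrable lborel (\<lambda>x. \<bar>f x - g x\<bar>)" by simp
  have "(\<integral>x. \<bar>f (x + z) - f x\<bar> \<partial>lborel) \<le> (\<integral>x. \<bar>f (x + z) - g (x + z)\<bar> + \<bar>f x - g x\<bar> + \<bar>g (x + z) - g x\<bar> \<partial>lborel)"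
    by (intro integral_mono) auto
  also have "\<dots> = (\<integral>x. \<bar>f (x + z) - g (x + z)\<bar> \<partial>lborel) + (\<integral>x. \<bar>f x - g x\<bar> \<partial>lborel) + (\<integral>x. \<bar>g (x + z) - g x\<bar> \<partial>lborel)"
    by simp
  also have "(\<integral>x. \<bar>f (x + z) - g (x + z)\<bar> \<partial>lborel) = (\<integral>x. \<bar>f x - g x\<bar> \<partial>lborel)"
    using integral_translate[OF d, of z] .
  finally show ?thesis by simp
qed

text \<open>For an open set the positive part of the difference of the indicators vanishes pointwise in the
  limit, and since the difference has integral zero its negative part follows.\<close>

lemma translation_continuous_indicator:
  fixes A :: "'a::euclidean_space set"
  assumes A: "A \<in> sets borel" "emeasure lborel A < \<infinity>" and u: "u \<longlonglongrightarrow> 0"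
  shows "(\<lambda>n. \<integral>x. \<bar>indicator A (x + u n) - indicator A x :: real\<bar> \<partial>lborel) \<longlonglongrightarrow> 0"
proof (rule LIMSEQ_I)
  fix e :: real assume e: "0 < e"
  \<comment> \<open>The approximation error is paid twice, which leaves e/2 for the translates of
    \<open>U\<close>.\<close>
  obtain U where U: "open U" "A \<subseteq> U" "emeasure lborel (U - A) < e / 4"
    using outer_regular_lborel[OF A(1), of "e/4"] e by auto
  have [measurable]: "U \<in> sets borel" "A \<in> sets borel" using U(1) A by auto
  have "emeasure lborel U \<le> emeasure lborel A + emeasure lborel (U - A)"
    using U(2) by (subst plus_emeasure) (auto simp: Un_absorb1)
  then have finU: "emeasure lborel U < \<infinity>" using A(2) U(3)
    by (metis ennreal_add_less_top ennreal_less_top infinity_ennreal_def le_less_trans less_trans)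
  have iU: "integrable lborel (indicator U :: _ \<Rightarrow> real)" using finU by (intro integrable_real_indicator) auto
  have iA: "integrable lborel (indicator A :: _ \<Rightarrow> real)" using A by (intro integrable_real_indicator) auto
  note [simp] = iU integrable_translate[OF iU] iA
  have AU: "(\<integral>x. \<bar>indicator A x - indicator U x\<bar> \<partial>lborel) \<le> e / 4"
  proof -
    have "(\<integral>x. \<bar>indicator A x - indicator U x :: real\<bar> \<partial>lborel) = (\<integral>x. indicator (U - A) x \<partial>lborel)"
      using U(2) by (intro Bochner_Integration.integral_cong) (auto simp: indicator_def)
    also have "\<dots> = measure lborel (U - A)" by simp
    also have "\<dots> \<le> e / 4" using U(3) e unfolding measure_def
      by (intro enn2real_leI) auto
    finally show ?thesis .
  qed
  have "(\<lambda>n. \<integral>x. max 0 (indicator U x - indicator U (x + u n) :: real) \<partial>lborel) \<longlonglongrightarrow> (\<integral>x. 0 \<partial>(lborel :: 'a measure))"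
  proof (rule integral_dominated_convergence[where w="indicator U :: 'a \<Rightarrow> real"])
    show "AE x in lborel. (\<lambda>n. max 0 (indicator U x - indicator U (x + u n)) :: real) \<longlonglongrightarrow> 0"
    proof (intro AE_I2)
      fix x
      show "(\<lambda>n. max 0 (indicator U x - indicator U (x + u n)) :: real) \<longlonglongrightarrow> 0"
      proof (cases "x \<in> U")
        case True
        have "(\<lambda>n. x + u n) \<longlonglongrightarrow> x + 0" by (intro tendsto_intros u)
        then have "eventually (\<lambda>n. x + u n \<in> U) sequentially"
          using U(1) True by (intro topological_tendstoD) auto
        then have "eventually (\<lambda>n. max 0 (indicator U x - indicator U (x + u n)) = (0::real)) sequentially"
          by eventually_elim auto
        then show ?thesis by (rule tendsto_eventually)
      next
        case False
        then have "max 0 (indicator U x - indicator U (x + u n)) = (0::real)" for n by (simp add: indicator_def)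
        then show ?thesis by simp
      qed
    qed
  qed (auto simp: indicator_def)
  then have "(\<lambda>n. 2 * (\<integral>x. max 0 (indicator U x - indicator U (x + u n) :: real) \<partial>lborel)) \<longlonglongrightarrow> 2 * (0::real)"
    by (intro tendsto_intros) simp
  then have "eventually (\<lambda>n. 2 * (\<integral>x. max 0 (indicator U x - indicator U (x + u n) :: real) \<partial>lborel) < e / 2) sequentially"
    by (rule order_tendstoD(2)) (use e in simp)
  then obtain n0 where n0: "\<And>n. n \<ge> n0 \<Longrightarrow> 2 * (\<integral>x. max 0 (indicator U x - indicator U (x + u n) :: real) \<partial>lborel) < e / 2"
    by (auto simp: eventually_sequentially)
  show "\<exists>n0. \<forall>n\<ge>n0. norm ((\<integral>x. \<bar>indicator A (x + u n) - indicator A x :: real\<bar> \<partial>lborel) - 0) < e"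
  proof (intro exI[of _ n0] allI impI)
    fix n assume "n \<ge> n0"
    have "(\<integral>x. \<bar>indicator U (x + u n) - indicator U x :: real\<bar> \<partial>lborel)
       = (\<integral>x. 2 * max 0 (indicator U x - indicator U (x + u n)) + (indicator U (x + u n) - indicator U x) \<partial>lborel)"
      by (intro Bochner_Integration.integral_cong) (auto simp: indicator_def)
    also have "\<dots> = 2 * (\<integral>x. max 0 (indicator U x - indicator U (x + u n) :: real) \<partial>lborel)"
      using integral_translate[OF iU, of "u n"] by (subst Bochner_Integration.integral_add) auto
    finally have "(\<integral>x. \<bar>indicator U (x + u n) - indicator U x :: real\<bar> \<partial>lborel) < e / 2"
      using n0[OF \<open>n \<ge> n0\<close>] by simp
    then have "(\<integral>x. \<bar>indicator A (x + u n) - indicator A x :: real\<bar> \<partial>lborel) < e"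
      using integral_abs_translate_diff_le[OF iA iU, of "u n"] AU by linarith
    then show "norm ((\<integral>x. \<bar>indicator A (x + u n) - indicator A x :: real\<bar> \<partial>lborel) - 0) < e"
      by (simp add: integral_nonneg_AE)
  qed
qed

lemma translation_continuous_L1:
  fixes f :: "'a::euclidean_space \<Rightarrow> real"
  assumes "integrable lborel f" and u: "u \<longlonglongrightarrow> 0"
  shows "(\<lambda>n. \<integral>x. \<bar>f (x + u n) - f x\<bar> \<partial>lborel) \<longlonglongrightarrow> 0"
  using assms(1)
proof (induction f rule: integrable_induct)
  case (base A c)
  have "(\<lambda>n. \<bar>c\<bar> * (\<integral>x. \<bar>indicator A (x + u n) - indicator A x :: real\<bar> \<partial>lborel)) \<longlonglongrightarrow> \<bar>c\<bar> * 0"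
    using base by (intro tendsto_intros translation_continuous_indicator u) auto
  moreover have "(\<integral>x. \<bar>indicator A (x + u n) *\<^sub>R c - indicator A x *\<^sub>R c\<bar> \<partial>lborel) = \<bar>c\<bar> * (\<integral>x. \<bar>indicator A (x + u n) - indicator A x :: real\<bar> \<partial>lborel)" for n
    by (subst integral_mult_right_zero[symmetric]) (auto simp: abs_mult[symmetric] algebra_simps)
  ultimately show ?case by simp
next
  case (add f g)
  note fg = \<open>integrable lborel f\<close> \<open>integrable lborel g\<close>
  note [simp] = fg fg[THEN integrable_translate]
  have "(\<lambda>n. (\<integral>x. \<bar>f (x + u n) - f x\<bar> \<partial>lborel) + (\<integral>x. \<bar>g (x + u n) - g x\<bar> \<partial>lborel)) \<longlonglongrightarrow> 0 + 0"
    by (intro tendsto_intros add)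
  then have L: "(\<lambda>n. (\<integral>x. \<bar>f (x + u n) - f x\<bar> \<partial>lborel) + (\<integral>x. \<bar>g (x + u n) - g x\<bar> \<partial>lborel)) \<longlonglongrightarrow> 0" by simp
  have "(\<integral>x. \<bar>f (x + u n) + g (x + u n) - (f x + g x)\<bar> \<partial>lborel) \<le> (\<integral>x. \<bar>f (x + u n) - f x\<bar> \<partial>lborel) + (\<integral>x. \<bar>g (x + u n) - g x\<bar> \<partial>lborel)" for n
  proof -
    have "(\<integral>x. \<bar>f (x + u n) + g (x + u n) - (f x + g x)\<bar> \<partial>lborel) \<le> (\<integral>x. \<bar>f (x + u n) - f x\<bar> + \<bar>g (x + u n) - g x\<bar> \<partial>lborel)"
      by (intro integral_mono) auto
    then show ?thesis by simp
  qed
  then show ?case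
    by (intro tendsto_sandwich[OF _ _ tendsto_const L]) (auto intro!: always_eventually integral_nonneg_AE)
next
  case (lim f s)
  have s_int: "integrable lborel (s i)" and f_int: "integrable lborel f"
    and s_lim: "(\<lambda>i. s i x) \<longlonglongrightarrow> f x" and s_bound: "norm (s i x) \<le> 2 * norm (f x)"
    and s_tr: "(\<lambda>n. \<integral>x. \<bar>s i (x + u n) - s i x\<bar> \<partial>lborel) \<longlonglongrightarrow> 0" for i x
    using lim by auto
  have "(\<lambda>i. \<integral>x. \<bar>f x - s i x\<bar> \<partial>lborel) \<longlonglongrightarrow> (\<integral>x. 0 \<partial>(lborel :: 'a measure))"
  proof (rule integral_dominated_convergence[where w="\<lambda>x. 3 * \<bar>f x\<bar>"])
    show "AE x in lborel. (\<lambda>i. \<bar>f x - s i x\<bar>) \<longlonglongrightarrow> 0"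
    proof (intro AE_I2)
      fix x :: 'a
      have "(\<lambda>i. \<bar>f x - s i x\<bar>) \<longlonglongrightarrow> \<bar>f x - f x\<bar>" using s_lim[of x] by (intro tendsto_intros) auto
      then show "(\<lambda>i. \<bar>f x - s i x\<bar>) \<longlonglongrightarrow> 0" by simp
    qed
    show "AE x in lborel. norm \<bar>f x - s i x\<bar> \<le> 3 * \<bar>f x\<bar>" for i
    proof (intro AE_I2)
      fix x :: 'a
      have "\<bar>s i x\<bar> \<le> 2 * \<bar>f x\<bar>" using s_bound[of i x] by auto
      then show "norm \<bar>f x - s i x\<bar> \<le> 3 * \<bar>f x\<bar>" by (simp add: abs_if split: if_splits)
    qed
  qed (use s_int f_int in auto)
  then have L: "(\<lambda>i. \<integral>x. \<bar>f x - s i x\<bar> \<partial>lborel) \<longlonglongrightarrow> 0" by simp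
  show ?case
  proof (rule LIMSEQ_I)
    fix e :: real assume e: "0 < e"
    have "eventually (\<lambda>i. (\<integral>x. \<bar>f x - s i x\<bar> \<partial>lborel) < e / 4) sequentially"
      using L e by (intro order_tendstoD(2)) auto
    then obtain i where i: "(\<integral>x. \<bar>f x - s i x\<bar> \<partial>lborel) < e / 4" by (auto simp: eventually_sequentially)
    have "eventually (\<lambda>n. (\<integral>x. \<bar>s i (x + u n) - s i x\<bar> \<partial>lborel) < e / 2) sequentially"
      using s_tr[of i] e by (intro order_tendstoD(2)) auto
    then obtain n0 where n0: "\<And>n. n \<ge> n0 \<Longrightarrow> (\<integral>x. \<bar>s i (x + u n) - s i x\<bar> \<partial>lborel) < e / 2"
      by (auto simp: eventually_sequentially)
    have "(\<integral>x. \<bar>f (x + u n) - f x\<bar> \<partial>lborel) < e" if "n \<ge> n0" for n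
      using integral_abs_translate_diff_le[OF f_int s_int[of i], of "u n"] i n0[OF that] by linarith
    then show "\<exists>n0. \<forall>n\<ge>n0. norm ((\<integral>x. \<bar>f (x + u n) - f x\<bar> \<partial>lborel) - 0) < e"
      by (intro exI[of _ n0]) (auto simp: integral_nonneg_AE)
  qed
qed

section \<open>Square-integrable functions and their pairing with L2 functions and integrable
  densities\<close>

lemma L2fun_integrable: "L2fun f \<Longrightarrow> integrable lborel (\<lambda>x. (f x)\<^sup>2)"
  by (simp add: L2fun_def)

lemma L2fun_bound:
  assumes "L2fun g" "f \<in> borel_measurable borel" "\<And>x. \<bar>f x\<bar> \<le> \<bar>g x\<bar>"
  shows "L2fun f"
  unfolding L2fun_def
proof
  show "integrable lborel (\<lambda>x. (f x)\<^sup>2)"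
    using assms(2,3) by (intro Bochner_Integration.integrable_bound[OF L2fun_integrable[OF assms(1)]])
      (auto simp: abs_le_square_iff)
qed (use assms in simp)

lemma L2fun_mult_integrable:
  assumes "L2fun f" "L2fun g"
  shows "integrable lborel (\<lambda>x. f x * g x)"
proof (rule Bochner_Integration.integrable_bound)
  show "integrable lborel (\<lambda>x. (f x)\<^sup>2 + (g x)\<^sup>2)" using assms by (simp add: L2fun_def)
  show "(\<lambda>x. f x * g x) \<in> borel_measurable lborel" using assms by (auto simp: L2fun_def)
  show "AE x in lborel. norm (f x * g x) \<le> norm ((f x)\<^sup>2 + (g x)\<^sup>2)"
  proof (intro AE_I2)
    fix x
    have "2 * \<bar>f x * g x\<bar> \<le> (f x)\<^sup>2 + (g x)\<^sup>2"
      using sum_squares_bound[of "\<bar>f x\<bar>" "\<bar>g x\<bar>"] by (simp add: abs_mult)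
    then show "norm (f x * g x) \<le> norm ((f x)\<^sup>2 + (g x)\<^sup>2)"
      unfolding real_norm_def using abs_ge_zero[of "f x * g x"] by linarith
  qed
qed

lemma L2fun_add:
  assumes "L2fun f" "L2fun g"
  shows "L2fun (\<lambda>x. f x + g x)"
  using assms L2fun_mult_integrable[OF assms] by (auto simp: L2fun_def power2_sum mult.assoc)

lemma L2fun_cmult:
  assumes "L2fun f"
  shows "L2fun (\<lambda>x. c * f x)"
  using assms by (auto simp: L2fun_def power_mult_distrib)

lemma L2fun_diff:
  assumes "L2fun f" "L2fun g"
  shows "L2fun (\<lambda>x. f x - g x)"
  using L2fun_add[OF assms(1) L2fun_cmult[OF assms(2), of "-1"]] by simp

lemma L2fun_translate:
  assumes "L2fun f"
  shows "L2fun (\<lambda>x. f (x + z))"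
  using assms integrable_translate[of "\<lambda>x. (f x)\<^sup>2" z] by (auto simp: L2fun_def)

definition sq_int :: "(real^'n \<Rightarrow> real) \<Rightarrow> real" where
  "sq_int f = (\<integral>x. (f x)\<^sup>2 \<partial>lborel)"

lemma sq_int_nonneg [simp]: "0 \<le> sq_int f"
  unfolding sq_int_def by (intro integral_nonneg_AE) auto

lemma sq_int_add_le:
  assumes "L2fun f" "L2fun g"
  shows "sq_int (\<lambda>x. f x + g x) \<le> 2 * sq_int f + 2 * sq_int g"
proof -
  have "(f x + g x)\<^sup>2 \<le> 2 * (f x)\<^sup>2 + 2 * (g x)\<^sup>2" for x
    using sum_squares_bound[of "f x" "g x"] by (simp add: power2_sum)
  then have "sq_int (\<lambda>x. f x + g x) \<le> (\<integral>x. 2 * (f x)\<^sup>2 + 2 * (g x)\<^sup>2 \<partial>lborel)"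
    unfolding sq_int_def
    using assms L2fun_integrable[OF L2fun_add[OF assms]]
    by (intro integral_mono) (auto simp: L2fun_def)
  also have "\<dots> = 2 * sq_int f + 2 * sq_int g"
    using assms by (simp add: sq_int_def L2fun_def)
  finally show ?thesis .
qed

lemma sq_int_diff_le:
  assumes "L2fun f" "L2fun g"
  shows "sq_int (\<lambda>x. f x - g x) \<le> 2 * sq_int f + 2 * sq_int g"
  using sq_int_add_le[OF assms(1) L2fun_cmult[OF assms(2), of "-1"]] by (simp add: sq_int_def)

lemma sq_int_cmult: "sq_int (\<lambda>x. c * f x) = c\<^sup>2 * sq_int f"
  unfolding sq_int_def power_mult_distrib by simp

lemma tendsto_L2norm_iff: "((\<lambda>a. L2norm (v a)) \<longlongrightarrow> 0) F \<longleftrightarrow> ((\<lambda>a. sq_int (v a)) \<longlongrightarrow> 0) F"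
proof
  assume "((\<lambda>a. L2norm (v a)) \<longlongrightarrow> 0) F"
  then have "((\<lambda>a. (L2norm (v a))\<^sup>2) \<longlongrightarrow> 0\<^sup>2) F" by (rule tendsto_power)
  then show "((\<lambda>a. sq_int (v a)) \<longlongrightarrow> 0) F"
    by (simp add: L2norm_def sq_int_def[symmetric])
next
  assume "((\<lambda>a. sq_int (v a)) \<longlongrightarrow> 0) F"
  then have "((\<lambda>a. sqrt (sq_int (v a))) \<longlongrightarrow> sqrt 0) F" by (rule tendsto_real_sqrt)
  then show "((\<lambda>a. L2norm (v a)) \<longlongrightarrow> 0) F"
    by (simp add: L2norm_def sq_int_def[symmetric])
qed

text \<open>A weighted Young inequality in the role of Cauchy-Schwarz: the free weight
  \<open>c\<close> lets the fixed factor be made negligible before the other one tends to 0.\<close>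

lemma integral_mult_le:
  assumes "L2fun f" "L2fun g" "0 < (c::real)"
  shows "\<bar>\<integral>x. f x * g x \<partial>lborel\<bar> \<le> c * sq_int f + sq_int g / c"
proof -
  have "\<bar>\<integral>x. f x * g x \<partial>lborel\<bar> \<le> (\<integral>x. \<bar>f x * g x\<bar> \<partial>lborel)"
    using integral_norm_bound[of lborel "\<lambda>x. f x * g x"] by simp
  also have "\<dots> \<le> (\<integral>x. c * (f x)\<^sup>2 + (g x)\<^sup>2 / c \<partial>lborel)"
  proof (intro integral_mono)
    show "integrable lborel (\<lambda>x. \<bar>f x * g x\<bar>)" using L2fun_mult_integrable[OF assms(1,2)] by simp
    show "integrable lborel (\<lambda>x. c * (f x)\<^sup>2 + (g x)\<^sup>2 / c)" using assms by (simp add: L2fun_def)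
    fix x
    have "2 * (\<bar>c * f x\<bar> * \<bar>g x\<bar>) \<le> \<bar>c * f x\<bar>\<^sup>2 + \<bar>g x\<bar>\<^sup>2"
      using sum_squares_bound[of "\<bar>c * f x\<bar>" "\<bar>g x\<bar>"] by simp
    moreover have "\<bar>c * f x\<bar> * \<bar>g x\<bar> = c * \<bar>f x * g x\<bar>" "0 \<le> c * \<bar>f x * g x\<bar>"
      using assms(3) by (auto simp: abs_mult)
    ultimately have "c * \<bar>f x * g x\<bar> \<le> c\<^sup>2 * (f x)\<^sup>2 + (g x)\<^sup>2"
      by (simp add: power_mult_distrib)
    then show "\<bar>f x * g x\<bar> \<le> c * (f x)\<^sup>2 + (g x)\<^sup>2 / c"
      using assms(3) by (simp add: field_simps power2_eq_square)
  qed
  also have "\<dots> = c * sq_int f + sq_int g / c"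
    using assms by (simp add: sq_int_def L2fun_def)
  finally show ?thesis .
qed

lemma L2_tendsto_integral:
  assumes ev: "eventually (\<lambda>a. L2fun (v a)) F" and lim: "((\<lambda>a. sq_int (v a)) \<longlongrightarrow> 0) F" and q: "L2fun q"
  shows "((\<lambda>a. \<integral>x. v a x * q x \<partial>lborel) \<longlongrightarrow> 0) F"
proof (rule tendstoI)
  fix e :: real assume e: "0 < e"
  \<comment> \<open>Chosen so that the contribution of \<open>q\<close> is below e/2; the summand 1
    keeps \<open>c\<close> positive and the inequality strict when \<open>q\<close>
    vanishes.\<close>
  define c where "c = 2 * (sq_int q + 1) / e"
  have c: "0 < c" using e by (simp add: c_def add_nonneg_pos)
  have "sq_int q / c < e / 2"
    using e c unfolding c_def by (simp add: field_simps add_nonneg_pos) 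
  moreover have "((\<lambda>a. c * sq_int (v a)) \<longlongrightarrow> c * 0) F" by (intro tendsto_intros lim)
  then have "eventually (\<lambda>a. c * sq_int (v a) < e / 2) F" using e by (intro order_tendstoD(2)) auto
  ultimately have qc: "sq_int q / c < e / 2" and ev': "eventually (\<lambda>a. c * sq_int (v a) < e / 2) F" by auto
  from ev ev' show "eventually (\<lambda>a. dist (\<integral>x. v a x * q x \<partial>lborel) 0 < e) F"
  proof eventually_elim
    case (elim a)
    then show ?case using integral_mult_le[OF elim(1) q c] qc
      unfolding dist_real_def diff_zero by linarith
  qed
qed

text \<open>Bounded functions that vanish in the limit in L2 vanish against any integrable density: the part of
  the density above a large level is negligible, the part below it lies in L2.\<close>

lemma bounded_L2_tendsto_integral:
  fixes M :: "real^'n \<Rightarrow> real"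
  assumes ev: "eventually (\<lambda>a. L2fun (v a) \<and> (\<forall>x. \<bar>v a x\<bar> \<le> C)) F" and lim: "((\<lambda>a. sq_int (v a)) \<longlongrightarrow> 0) F"
    and M: "integrable lborel M" "\<And>x. 0 \<le> M x"
  shows "((\<lambda>a. \<integral>x. v a x * M x \<partial>lborel) \<longlongrightarrow> 0) F"
proof (rule tendstoI)
  fix e :: real assume e: "0 < e"
  have [measurable]: "M \<in> borel_measurable borel" using M by auto
  define K where "K = (\<lambda>k::nat. \<lambda>x. min (M x) (real k))"
  have KM: "0 \<le> K k x" "K k x \<le> M x" "K k x \<le> real k" for k x using M(2)[of x] by (auto simp: K_def)
  have [measurable]: "K k \<in> borel_measurable borel" for k unfolding K_def by measurable
  have iK: "integrable lborel (K k)" for k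
    by (rule Bochner_Integration.integrable_bound[OF M(1)]) (auto simp: KM abs_of_nonneg M(2))
  have "(\<lambda>k. \<integral>x. M x - K k x \<partial>lborel) \<longlonglongrightarrow> (\<integral>x. 0 \<partial>(lborel :: (real^'n) measure))"
  proof (rule integral_dominated_convergence[where w=M])
    show "AE x in lborel. (\<lambda>k. M x - K k x) \<longlonglongrightarrow> 0"
    proof (intro AE_I2 tendsto_eventually)
      fix x
      obtain k0 :: nat where "M x \<le> real k0" using real_arch_simple by blast
      then show "eventually (\<lambda>k. M x - K k x = 0) sequentially"
        unfolding eventually_sequentially K_def by (intro exI[of _ k0]) auto
    qed
    show "AE x in lborel. norm (M x - K k x) \<le> M x" for k
    proof (intro AE_I2)
      fix x
      show "norm (M x - K k x) \<le> M x" using KM(1)[of k x] KM(2)[of k x] by (simp add: abs_le_iff)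
    qed
  qed (use M in auto)
  then have "(\<lambda>k. \<bar>C\<bar> * (\<integral>x. M x - K k x \<partial>lborel)) \<longlonglongrightarrow> \<bar>C\<bar> * 0" by (intro tendsto_intros) simp
  then have "eventually (\<lambda>k. \<bar>C\<bar> * (\<integral>x. M x - K k x \<partial>lborel) < e / 2) sequentially"
    using e by (intro order_tendstoD(2)) auto
  then obtain k where k: "\<bar>C\<bar> * (\<integral>x. M x - K k x \<partial>lborel) < e / 2" by (auto simp: eventually_sequentially)
  have LK: "L2fun (K k)"
    unfolding L2fun_def
  proof
    show "integrable lborel (\<lambda>x. (K k x)\<^sup>2)"
      by (rule Bochner_Integration.integrable_bound[OF integrable_mult_right[OF iK[of k], of "real k"]])
         (auto simp: power2_eq_square KM abs_of_nonneg intro!: mult_right_mono)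
  qed simp
  have "((\<lambda>a. \<integral>x. v a x * K k x \<partial>lborel) \<longlongrightarrow> 0) F"
    using ev by (intro L2_tendsto_integral lim LK) (auto elim: eventually_mono)
  then have "eventually (\<lambda>a. dist (\<integral>x. v a x * K k x \<partial>lborel) 0 < e / 2) F"
    using e by (intro tendstoD) auto
  then show "eventually (\<lambda>a. dist (\<integral>x. v a x * M x \<partial>lborel) 0 < e) F"
    using ev
  proof eventually_elim
    case (elim a)
    have [measurable]: "v a \<in> borel_measurable borel" using elim by (auto simp: L2fun_def)
    have C: "\<bar>v a x\<bar> \<le> \<bar>C\<bar>" for x using elim by (metis abs_ge_self order_trans)
    have i1: "integrable lborel (\<lambda>x. v a x * g x)" if "integrable lborel g" for g
      using C by (intro Bochner_Integration.integrable_bound[OF integrable_mult_right[OF that, of "\<bar>C\<bar>"]])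
        (use that in \<open>auto simp: abs_mult intro!: mult_right_mono\<close>)
    have "(\<integral>x. v a x * M x \<partial>lborel) = (\<integral>x. v a x * K k x \<partial>lborel) + (\<integral>x. v a x * (M x - K k x) \<partial>lborel)"
      using i1[OF iK] i1[OF Bochner_Integration.integrable_diff[OF M(1) iK]]
      by (subst Bochner_Integration.integral_add[symmetric]) (auto simp: algebra_simps)
    moreover have "\<bar>\<integral>x. v a x * (M x - K k x) \<partial>lborel\<bar> \<le> (\<integral>x. \<bar>C\<bar> * (M x - K k x) \<partial>lborel)"
    proof -
      have "\<bar>\<integral>x. v a x * (M x - K k x) \<partial>lborel\<bar> \<le> (\<integral>x. \<bar>v a x * (M x - K k x)\<bar> \<partial>lborel)"
        using integral_norm_bound[of lborel "\<lambda>x. v a x * (M x - K k x)"] by simp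
      also have "\<dots> \<le> (\<integral>x. \<bar>C\<bar> * (M x - K k x) \<partial>lborel)"
      proof (intro integral_mono integrable_abs i1 Bochner_Integration.integrable_diff M(1) iK integrable_mult_right)
        fix x
        show "\<bar>v a x * (M x - K k x)\<bar> \<le> \<bar>C\<bar> * (M x - K k x)"
          using KM(2)[of k x] C[of x] by (auto simp: abs_mult intro!: mult_right_mono)
      qed
      finally show ?thesis .
    qed
    moreover have "(\<integral>x. \<bar>C\<bar> * (M x - K k x) \<partial>lborel) = \<bar>C\<bar> * (\<integral>x. M x - K k x \<partial>lborel)" by simp
    ultimately show ?case using elim(1) k by (simp add: dist_real_def)
  qed
qed

subsection \<open>Convolution operators and their energy\<close>

definition conv_op :: "(real^'n) measure \<Rightarrow> (real^'n \<Rightarrow> real) \<Rightarrow> real^'n \<Rightarrow> real" where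
  "conv_op \<kappa> g x = (\<integral>z. g (x + z) \<partial>\<kappa>)"

definition shift_dist :: "(real^'n \<Rightarrow> real) \<Rightarrow> real^'n \<Rightarrow> real" where
  "shift_dist f z = sq_int (\<lambda>x. f (x + z) - f x)"

text \<open>For \<open>f\<close> in L2 and a probability \<open>\<kappa>\<close> this equals the
  integral of f (f - conv_op \<kappa> f). With the time-t law and divided by t it is the usual
  approximation of the Dirichlet form.\<close>

definition energy :: "(real^'n) measure \<Rightarrow> (real^'n \<Rightarrow> real) \<Rightarrow> real" where
  "energy \<kappa> f = (\<integral>z. shift_dist f z \<partial>\<kappa>) / 2"

lemma shift_dist_nonneg [simp]: "0 \<le> shift_dist f z"
  by (simp add: shift_dist_def)

lemma shift_dist_measurable [measurable]:
  assumes [measurable]: "f \<in> borel_measurable borel"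
  shows "shift_dist f \<in> borel_measurable borel"
  unfolding shift_dist_def[abs_def] sq_int_def by measurable

lemma shift_dist_le:
  assumes "L2fun f"
  shows "shift_dist f z \<le> 4 * sq_int f"
proof -
  have "sq_int (\<lambda>x. f (x + z)) = sq_int f"
    using integral_translate[OF L2fun_integrable[OF assms], of z] by (simp add: sq_int_def)
  then show ?thesis
    unfolding shift_dist_def using sq_int_diff_le[OF L2fun_translate[OF assms, of z] assms] by simp
qed

text \<open>For nonnegative a and b one has (a - b)^2 \<le> |a^2 - b^2|, so continuity of
  translations in L2 follows from continuity in L1 for the square.\<close>

lemma shift_dist_tendsto:
  assumes f: "L2fun f" "\<And>x. 0 \<le> f x" and u: "u \<longlonglongrightarrow> 0"
  shows "(\<lambda>n. shift_dist f (u n)) \<longlonglongrightarrow> 0"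
proof (rule tendsto_sandwich[OF _ _ tendsto_const translation_continuous_L1[OF L2fun_integrable[OF f(1)] u]])
  have "shift_dist f z \<le> (\<integral>x. \<bar>(f (x + z))\<^sup>2 - (f x)\<^sup>2\<bar> \<partial>lborel)" for z
    unfolding shift_dist_def sq_int_def
  proof (rule integral_mono)
    show "integrable lborel (\<lambda>x. (f (x + z) - f x)\<^sup>2)"
      by (intro L2fun_integrable L2fun_diff L2fun_translate f)
    show "integrable lborel (\<lambda>x. \<bar>(f (x + z))\<^sup>2 - (f x)\<^sup>2\<bar>)"
      by (intro integrable_abs Bochner_Integration.integrable_diff L2fun_integrable L2fun_translate f)
    fix x
    have "(f (x + z) - f x)\<^sup>2 = \<bar>f (x + z) - f x\<bar> * \<bar>f (x + z) - f x\<bar>" by (simp add: power2_eq_square)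
    also have "\<dots> \<le> \<bar>f (x + z) - f x\<bar> * \<bar>f (x + z) + f x\<bar>"
      using f(2)[of x] f(2)[of "x + z"] by (intro mult_left_mono) auto
    also have "\<dots> = \<bar>(f (x + z))\<^sup>2 - (f x)\<^sup>2\<bar>" by (simp add: abs_mult[symmetric] algebra_simps power2_eq_square)
    finally show "(f (x + z) - f x)\<^sup>2 \<le> \<bar>(f (x + z))\<^sup>2 - (f x)\<^sup>2\<bar>" .
  qed
  then show "eventually (\<lambda>n. shift_dist f (u n) \<le> (\<integral>x. \<bar>(f (x + u n))\<^sup>2 - (f x)\<^sup>2\<bar> \<partial>lborel)) sequentially"
    by (intro always_eventually) auto
qed (auto intro!: always_eventually)

context borel_prob
begin

interpretation P: pair_sigma_finite "lborel :: (real^'n) measure" \<mu> ..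

lemma conv_op_measurable [measurable]:
  assumes [measurable]: "g \<in> borel_measurable borel"
  shows "conv_op \<mu> g \<in> borel_measurable borel"
  unfolding conv_op_def[abs_def] by measurable

lemma integrable_translate_bounded:
  fixes g :: "real^'n \<Rightarrow> real"
  assumes "g \<in> borel_measurable borel" "\<And>x. \<bar>g x\<bar> \<le> C"
  shows "integrable \<mu> (\<lambda>z. g (x + z))"
  using assms by (intro integrable_bounded[where C=C]) auto

lemma conv_op_bounds:
  assumes "g \<in> borel_measurable borel" "\<And>x. a \<le> g x" "\<And>x. g x \<le> b"
  shows "a \<le> conv_op \<mu> g x" "conv_op \<mu> g x \<le> b"
proof -
  have "\<bar>g x\<bar> \<le> \<bar>a\<bar> + \<bar>b\<bar>" for x using assms(2,3)[of x] by linarith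
  note i = integrable_translate_bounded[OF assms(1) this]
  have "(\<integral>z. a \<partial>\<mu>) \<le> (\<integral>z. g (x + z) \<partial>\<mu>)" by (intro integral_mono i) (auto simp: assms)
  then show "a \<le> conv_op \<mu> g x" by (simp add: conv_op_def prob_space[unfolded space_eq])
  have "(\<integral>z. g (x + z) \<partial>\<mu>) \<le> (\<integral>z. b \<partial>\<mu>)" by (intro integral_mono i) (auto simp: assms)
  then show "conv_op \<mu> g x \<le> b" by (simp add: conv_op_def prob_space[unfolded space_eq])
qed

lemma conv_op_diff:
  assumes "f \<in> borel_measurable borel" "\<And>x. \<bar>f x\<bar> \<le> C" "g \<in> borel_measurable borel" "\<And>x. \<bar>g x\<bar> \<le> D"
  shows "conv_op \<mu> (\<lambda>x. f x - g x) x = conv_op \<mu> f x - conv_op \<mu> g x"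
  unfolding conv_op_def
  by (intro Bochner_Integration.integral_diff integrable_translate_bounded[OF assms(1,2)] integrable_translate_bounded[OF assms(3,4)])

lemma conv_op_const [simp]: "conv_op \<mu> (\<lambda>x. c) x = c"
  by (simp add: conv_op_def prob_space[unfolded space_eq])

text \<open>Jensen's inequality, obtained from the nonnegativity of the variance.\<close>

lemma square_integral_le:
  fixes a :: "real^'n \<Rightarrow> real"
  assumes "a \<in> borel_measurable borel" "\<And>x. \<bar>a x\<bar> \<le> C"
  shows "(\<integral>z. a z \<partial>\<mu>)\<^sup>2 \<le> (\<integral>z. (a z)\<^sup>2 \<partial>\<mu>)"
proof -
  have sq: "(a z)\<^sup>2 \<le> C\<^sup>2" for z using power_mono[OF assms(2)[of z] abs_ge_zero, of 2] by simp
  have i: "integrable \<mu> a" "integrable \<mu> (\<lambda>z. (a z)\<^sup>2)"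
    by (rule integrable_bounded[where C=C], use assms in simp_all)
       (rule integrable_bounded[where C="C\<^sup>2"], use assms(1) sq in simp_all)
  have "0 \<le> variance a" by simp
  then show ?thesis using variance_eq[OF i] by simp
qed

text \<open>Start and end point of a jump are both Lebesgue distributed under dx \<mu>(dz), because
  every section at fixed z is a translate. This is stationarity of Lebesgue measure.\<close>

lemma distr_fst_lborel: "distr (lborel \<Otimes>\<^sub>M \<mu>) borel fst = (lborel :: (real^'n) measure)"
  and distr_sum_lborel: "distr (lborel \<Otimes>\<^sub>M \<mu>) borel (\<lambda>p. fst p + snd p) = lborel"
proof -
  have em: "emeasure (distr (lborel \<Otimes>\<^sub>M \<mu>) borel h) B = (\<integral>\<^sup>+z. emeasure lborel {x. h (x, z) \<in> B} \<partial>\<mu>)"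
    if [measurable]: "h \<in> borel_measurable (lborel \<Otimes>\<^sub>M \<mu>)" "B \<in> sets borel" for h :: "(real^'n) \<times> (real^'n) \<Rightarrow> real^'n" and B
  proof -
    have "emeasure (distr (lborel \<Otimes>\<^sub>M \<mu>) borel h) B = (\<integral>\<^sup>+p. indicator B (h p) \<partial>(lborel \<Otimes>\<^sub>M \<mu>))"
      by (subst nn_integral_indicator[symmetric], simp, subst nn_integral_distr) auto
    also have "\<dots> = (\<integral>\<^sup>+z. \<integral>\<^sup>+x. indicator B (h (x, z)) \<partial>lborel \<partial>\<mu>)"
      by (rule P.nn_integral_snd[symmetric]) simp
    also have "\<dots> = (\<integral>\<^sup>+z. emeasure lborel {x. h (x, z) \<in> B} \<partial>\<mu>)"
    proof (rule nn_integral_cong)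
      fix z assume "z \<in> space \<mu>"
      have [measurable]: "(\<lambda>x. h (x, z)) \<in> borel_measurable borel"
        using measurable_compose[OF measurable_Pair2'[OF \<open>z \<in> space \<mu>\<close>] that(1)] by simp
      have "(\<integral>\<^sup>+x. indicator B (h (x, z)) \<partial>lborel) = (\<integral>\<^sup>+x. indicator {x. h (x, z) \<in> B} x \<partial>(lborel :: (real^'n) measure))"
        by (intro nn_integral_cong) (auto split: split_indicator)
      then show "(\<integral>\<^sup>+x. indicator B (h (x, z)) \<partial>lborel) = emeasure lborel {x. h (x, z) \<in> B}"
        by (subst (asm) nn_integral_indicator) auto
    qed
    finally show ?thesis .
  qed
  show "distr (lborel \<Otimes>\<^sub>M \<mu>) borel fst = (lborel :: (real^'n) measure)"
  proof (rule measure_eqI)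
    fix B :: "(real^'n) set" assume "B \<in> sets (distr (lborel \<Otimes>\<^sub>M \<mu>) borel fst)"
    then have B [measurable]: "B \<in> sets borel" by simp
    have fm: "fst \<in> borel_measurable ((lborel :: (real^'n) measure) \<Otimes>\<^sub>M \<mu>)" by measurable
    show "emeasure (distr (lborel \<Otimes>\<^sub>M \<mu>) borel fst) B = emeasure lborel B"
      using em[OF fm B] by (simp add: emeasure_space_1[unfolded space_eq])
  qed simp
  show "distr (lborel \<Otimes>\<^sub>M \<mu>) borel (\<lambda>p. fst p + snd p) = lborel"
  proof (rule measure_eqI)
    fix B assume "B \<in> sets (distr (lborel \<Otimes>\<^sub>M \<mu>) borel (\<lambda>p. fst p + snd p))"
    then have B [measurable]: "B \<in> sets borel" by simp
    have "emeasure lborel {x. x + z \<in> B} = emeasure lborel B" for z :: "real^'n"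
    proof -
      have "emeasure lborel B = emeasure (distr lborel borel ((+) z)) B" by (simp add: lborel_distr_plus)
      also have "\<dots> = emeasure lborel {x. x + z \<in> B}"
        by (subst emeasure_distr) (auto intro!: arg_cong[where f="emeasure lborel"] simp: add.commute)
      finally show ?thesis by simp
    qed
    then show "emeasure (distr (lborel \<Otimes>\<^sub>M \<mu>) borel (\<lambda>p. fst p + snd p)) B = emeasure lborel B"
      by (simp add: em emeasure_space_1[unfolded space_eq])
  qed simp
qed

lemma
  fixes g :: "real^'n \<Rightarrow> real"
  assumes "integrable lborel g"
  shows integrable_product_fst: "integrable (lborel \<Otimes>\<^sub>M \<mu>) (\<lambda>p. g (fst p))"
    and integrable_product_sum: "integrable (lborel \<Otimes>\<^sub>M \<mu>) (\<lambda>p. g (fst p + snd p))"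
    and integral_product_fst: "(\<integral>p. g (fst p) \<partial>(lborel \<Otimes>\<^sub>M \<mu>)) = (\<integral>x. g x \<partial>lborel)"
    and integral_product_sum: "(\<integral>p. g (fst p + snd p) \<partial>(lborel \<Otimes>\<^sub>M \<mu>)) = (\<integral>x. g x \<partial>lborel)"
proof -
  have [measurable]: "g \<in> borel_measurable borel" using assms by auto
  have "integrable (distr (lborel \<Otimes>\<^sub>M \<mu>) borel fst) g" using assms by (simp add: distr_fst_lborel)
  then show "integrable (lborel \<Otimes>\<^sub>M \<mu>) (\<lambda>p. g (fst p))" by (subst (asm) integrable_distr_eq) auto
  have "integrable (distr (lborel \<Otimes>\<^sub>M \<mu>) borel (\<lambda>p. fst p + snd p)) g" using assms by (simp add: distr_sum_lborel)
  then show "integrable (lborel \<Otimes>\<^sub>M \<mu>) (\<lambda>p. g (fst p + snd p))" by (subst (asm) integrable_distr_eq) auto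
  have "(\<integral>x. g x \<partial>distr (lborel \<Otimes>\<^sub>M \<mu>) borel fst) = (\<integral>p. g (fst p) \<partial>(lborel \<Otimes>\<^sub>M \<mu>))"
    by (subst integral_distr) auto
  then show "(\<integral>p. g (fst p) \<partial>(lborel \<Otimes>\<^sub>M \<mu>)) = (\<integral>x. g x \<partial>lborel)" by (simp add: distr_fst_lborel)
  have "(\<integral>x. g x \<partial>distr (lborel \<Otimes>\<^sub>M \<mu>) borel (\<lambda>p. fst p + snd p)) = (\<integral>p. g (fst p + snd p) \<partial>(lborel \<Otimes>\<^sub>M \<mu>))"
    by (subst integral_distr) auto
  then show "(\<integral>p. g (fst p + snd p) \<partial>(lborel \<Otimes>\<^sub>M \<mu>)) = (\<integral>x. g x \<partial>lborel)" by (simp add: distr_sum_lborel)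
qed

lemma integrable_product_diff:
  assumes f: "L2fun f"
  shows "integrable (lborel \<Otimes>\<^sub>M \<mu>) (\<lambda>p. (f (fst p + snd p) - f (fst p))\<^sup>2)"
proof (rule Bochner_Integration.integrable_bound)
  show "integrable (lborel \<Otimes>\<^sub>M \<mu>) (\<lambda>p. 2 * (f (fst p + snd p))\<^sup>2 + 2 * (f (fst p))\<^sup>2)"
    using integrable_product_fst[OF L2fun_integrable[OF f]] integrable_product_sum[OF L2fun_integrable[OF f]] by simp
  have [measurable]: "f \<in> borel_measurable borel" using f by (simp add: L2fun_def)
  show "(\<lambda>p. (f (fst p + snd p) - f (fst p))\<^sup>2) \<in> borel_measurable (lborel \<Otimes>\<^sub>M \<mu>)" by measurable
  have "(a - b)\<^sup>2 \<le> 2 * a\<^sup>2 + 2 * b\<^sup>2" for a b :: real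
    using sum_squares_bound[of a "- b"] by (simp add: power2_diff)
  then show "AE p in lborel \<Otimes>\<^sub>M \<mu>. norm ((f (fst p + snd p) - f (fst p))\<^sup>2) \<le> norm (2 * (f (fst p + snd p))\<^sup>2 + 2 * (f (fst p))\<^sup>2)"
    by (intro AE_I2) (simp add: abs_of_nonneg)
qed

lemma energy_eq_product:
  assumes f: "L2fun f"
  shows "energy \<mu> f = (\<integral>p. (f (fst p + snd p) - f (fst p))\<^sup>2 \<partial>(lborel \<Otimes>\<^sub>M \<mu>)) / 2"
  unfolding energy_def shift_dist_def sq_int_def
  using P.integral_snd[of "\<lambda>x z. (f (x + z) - f x)\<^sup>2"] integrable_product_diff[OF f]
  by (simp add: case_prod_unfold)

lemma energy_nonneg: "0 \<le> energy \<mu> f"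
  unfolding energy_def by (intro divide_nonneg_nonneg integral_nonneg_AE) auto

lemma energy_min_le:
  assumes f: "L2fun f" and g: "L2fun (\<lambda>x. min (f x) c)"
  shows "energy \<mu> (\<lambda>x. min (f x) c) \<le> energy \<mu> f"
proof -
  have "(min a c - min b c)\<^sup>2 \<le> (a - b)\<^sup>2" for a b
    unfolding abs_le_square_iff[symmetric] by (auto simp: min_def)
  then show ?thesis
    unfolding energy_eq_product[OF f] energy_eq_product[OF g]
    by (intro divide_right_mono integral_mono integrable_product_diff f integrable_product_diff[OF g]) auto
qed

text \<open>All three follow from Jensen at each point and stationarity. The last one turns
  vanishing energy into L2 approximation of \<open>g\<close> by its smoothed version.\<close>

lemma
  assumes g: "L2fun g" "\<And>x. \<bar>g x\<bar> \<le> C"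
  shows L2fun_conv_op: "L2fun (conv_op \<mu> g)" and sq_int_conv_op_le: "sq_int (conv_op \<mu> g) \<le> sq_int g"
    and sq_int_conv_op_diff_le: "sq_int (\<lambda>x. conv_op \<mu> g x - g x) \<le> 2 * energy \<mu> g"
proof -
  have [measurable]: "g \<in> borel_measurable borel" using g by (simp add: L2fun_def)
  have m: "conv_op \<mu> g \<in> borel_measurable borel" by (rule conv_op_measurable) simp
  have ip: "integrable lborel (\<lambda>x. \<integral>z. (g (x + z))\<^sup>2 \<partial>\<mu>)"
    using P.integrable_fst'[OF integrable_product_sum[OF L2fun_integrable[OF g(1)]]] by simp
  have le: "(conv_op \<mu> g x)\<^sup>2 \<le> (\<integral>z. (g (x + z))\<^sup>2 \<partial>\<mu>)" for x
    unfolding conv_op_def by (rule square_integral_le[where C=C]) (use g in auto)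
  show L: "L2fun (conv_op \<mu> g)"
    unfolding L2fun_def using m
    by (auto intro!: Bochner_Integration.integrable_bound[OF ip] AE_I2 order_trans[OF le abs_ge_self] le)
  have "sq_int (conv_op \<mu> g) \<le> (\<integral>x. (\<integral>z. (g (x + z))\<^sup>2 \<partial>\<mu>) \<partial>lborel)"
    unfolding sq_int_def by (intro integral_mono ip L2fun_integrable L le)
  also have "\<dots> = sq_int g"
    unfolding sq_int_def
    using P.integral_fst'[OF integrable_product_sum[OF L2fun_integrable[OF g(1)]]]
      integral_product_sum[OF L2fun_integrable[OF g(1)]] by simp
  finally show "sq_int (conv_op \<mu> g) \<le> sq_int g" .
  have ip': "integrable lborel (\<lambda>x. \<integral>z. (g (x + z) - g x)\<^sup>2 \<partial>\<mu>)"
    using P.integrable_fst'[OF integrable_product_diff[OF g(1)]] by simp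
  have le': "(conv_op \<mu> g x - g x)\<^sup>2 \<le> (\<integral>z. (g (x + z) - g x)\<^sup>2 \<partial>\<mu>)" for x
  proof -
    have "conv_op \<mu> g x - g x = (\<integral>z. g (x + z) - g x \<partial>\<mu>)"
      unfolding conv_op_def
      by (subst Bochner_Integration.integral_diff) (auto intro!: integrable_translate_bounded[OF _ g(2)] simp: prob_space[unfolded space_eq])
    moreover have "(\<integral>z. g (x + z) - g x \<partial>\<mu>)\<^sup>2 \<le> (\<integral>z. (g (x + z) - g x)\<^sup>2 \<partial>\<mu>)"
    proof (rule square_integral_le[where C="2 * C"])
      fix z show "\<bar>g (x + z) - g x\<bar> \<le> 2 * C" using g(2)[of "x + z"] g(2)[of x] by linarith
    qed simp
    ultimately show ?thesis by simp
  qed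
  have "sq_int (\<lambda>x. conv_op \<mu> g x - g x) \<le> (\<integral>x. (\<integral>z. (g (x + z) - g x)\<^sup>2 \<partial>\<mu>) \<partial>lborel)"
    unfolding sq_int_def by (intro integral_mono ip' L2fun_integrable L2fun_diff L g le')
  also have "\<dots> = 2 * energy \<mu> g"
    unfolding energy_eq_product[OF g(1)]
    using P.integral_fst'[OF integrable_product_diff[OF g(1)]] by simp
  finally show "sq_int (\<lambda>x. conv_op \<mu> g x - g x) \<le> 2 * energy \<mu> g" .
qed

text \<open>Without truncation and shift the integrand would be (f - conv f) f, whose integral is
  the energy. Tying the shift 1 / (n + 1) to the truncation level leaves a single limit, taken by
  dominated convergence on the product space.\<close>

lemma energy_as_limit:
  assumes f: "L2fun f" "\<And>x. 0 \<le> f x"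
  shows "(\<lambda>n. \<integral>x. (min (f x) (real n) - conv_op \<mu> (\<lambda>y. min (f y) (real n)) x) / (min (f x) (real n) + 1 / real (Suc n)) * (f x)\<^sup>2 \<partial>lborel) \<longlonglongrightarrow> energy \<mu> f"
proof -
  have [measurable]: "f \<in> borel_measurable borel" using f by (simp add: L2fun_def)
  define g where "g = (\<lambda>n::nat. \<lambda>x. min (f x) (real n))"
  define e where "e = (\<lambda>n::nat. 1 / real (Suc n))"
  have e: "0 < e n" for n by (simp add: e_def)
  have e0: "e \<longlonglongrightarrow> 0" unfolding e_def by (rule LIMSEQ_Suc[OF lim_const_over_n])
  have [measurable]: "g n \<in> borel_measurable borel" for n unfolding g_def by measurable
  have g: "0 \<le> g n x" "g n x \<le> f x" "g n x \<le> real n" for n x using f(2)[of x] by (auto simp: g_def)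
  have g': "\<bar>g n x\<bar> \<le> real n" for n x using g[of n x] by simp
  define G where "G = (\<lambda>n p. (g n (fst p) - g n (fst p + snd p)) / (g n (fst p) + e n) * (f (fst p))\<^sup>2)"
  define W where "W = (\<lambda>p. 3 * (f (fst p))\<^sup>2 + (f (fst p + snd p))\<^sup>2)"
  note f2 = L2fun_integrable[OF f(1)]
  have iW: "integrable (lborel \<Otimes>\<^sub>M \<mu>) W"
    unfolding W_def using integrable_product_fst[OF f2] integrable_product_sum[OF f2] by simp
  have bound: "\<bar>G n p\<bar> \<le> W p" for n p
  proof -
    let ?x = "fst p" and ?y = "fst p + snd p"
    have d: "0 < g n ?x + e n" using g(1)[of n ?x] e[of n] by simp
    have 1: "g n ?x / (g n ?x + e n) * (f ?x)\<^sup>2 \<le> (f ?x)\<^sup>2"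
      using d e[of n] g(1)[of n ?x] by (intro mult_left_le_one_le) (auto simp: divide_le_eq)
    have 2: "g n ?y / (g n ?x + e n) * (f ?x)\<^sup>2 \<le> 2 * (f ?x)\<^sup>2 + (f ?y)\<^sup>2"
    \<comment> \<open>Below the level, one factor of f(x) cancels against the denominator and f(x)
      f(y) remains. Above it, g(y) \<le> n = g(x), so the quotient is at most 1.\<close>
    proof (cases "f ?x \<le> real n")
      case True
      then have gx: "g n ?x = f ?x" by (simp add: g_def)
      have "g n ?y / (g n ?x + e n) * (f ?x)\<^sup>2 = g n ?y * f ?x * (f ?x / (f ?x + e n))"
        by (simp add: gx power2_eq_square)
      also have "\<dots> \<le> g n ?y * f ?x * 1"
        using f(2)[of ?x] e[of n] g(1)[of n ?y] by (intro mult_left_mono) (auto simp: divide_le_eq add_nonneg_pos)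
      also have "\<dots> \<le> f ?y * f ?x" using g(2)[of n ?y] f(2)[of ?x] by (simp add: mult_right_mono)
      also have "\<dots> \<le> (f ?y)\<^sup>2 + (f ?x)\<^sup>2"
      proof -
        have "2 * (f ?y * f ?x) \<le> (f ?y)\<^sup>2 + (f ?x)\<^sup>2"
          using sum_squares_bound[of "f ?y" "f ?x"] by (simp only: mult.assoc)
        moreover have "0 \<le> f ?y * f ?x" using f(2) by simp
        ultimately show ?thesis by linarith
      qed
      finally show ?thesis using zero_le_power2[of "f ?x"] by linarith
    next
      case False
      then have gx: "g n ?x = real n" by (simp add: g_def)
      have "g n ?y / (g n ?x + e n) \<le> 1" using g(3)[of n ?y] e[of n] d by (simp add: gx divide_le_eq)
      then have "g n ?y / (g n ?x + e n) * (f ?x)\<^sup>2 \<le> 1 * (f ?x)\<^sup>2" by (intro mult_right_mono) auto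
      then show ?thesis using zero_le_power2[of "f ?x"] zero_le_power2[of "f ?y"] by linarith
    qed
    have 3: "0 \<le> g n ?x / (g n ?x + e n) * (f ?x)\<^sup>2" "0 \<le> g n ?y / (g n ?x + e n) * (f ?x)\<^sup>2"
      using g(1)[of n] d by (auto intro!: mult_nonneg_nonneg divide_nonneg_nonneg)
    have "G n p = g n ?x / (g n ?x + e n) * (f ?x)\<^sup>2 - g n ?y / (g n ?x + e n) * (f ?x)\<^sup>2"
      by (simp add: G_def diff_divide_distrib left_diff_distrib)
    then show ?thesis unfolding W_def using 1 2 3 zero_le_power2[of "f ?x"] zero_le_power2[of "f ?y"] by linarith
  qed
  have iG: "integrable (lborel \<Otimes>\<^sub>M \<mu>) (G n)" for n
  proof (rule Bochner_Integration.integrable_bound[OF iW])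
    show "G n \<in> borel_measurable (lborel \<Otimes>\<^sub>M \<mu>)" unfolding G_def by measurable
    show "AE p in lborel \<Otimes>\<^sub>M \<mu>. norm (G n p) \<le> norm (W p)"
      unfolding real_norm_def by (intro AE_I2 order_trans[OF bound abs_ge_self])
  qed
  have lim: "(\<lambda>n. \<integral>p. G n p \<partial>(lborel \<Otimes>\<^sub>M \<mu>)) \<longlonglongrightarrow> (\<integral>p. (f (fst p) - f (fst p + snd p)) * f (fst p) \<partial>(lborel \<Otimes>\<^sub>M \<mu>))"
  proof (rule integral_dominated_convergence[OF _ _ iW])
    show "AE p in lborel \<Otimes>\<^sub>M \<mu>. (\<lambda>n. G n p) \<longlonglongrightarrow> (f (fst p) - f (fst p + snd p)) * f (fst p)"
    proof (intro AE_I2)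
      fix p :: "(real^'n) \<times> (real^'n)"
      let ?x = "fst p" and ?y = "fst p + snd p"
      have gl: "(\<lambda>n. g n x) \<longlonglongrightarrow> f x" for x
      proof (rule tendsto_eventually)
        obtain k0 :: nat where "f x \<le> real k0" using real_arch_simple by blast
        then show "eventually (\<lambda>k. g k x = f x) sequentially"
          unfolding eventually_sequentially g_def by (intro exI[of _ k0]) auto
      qed
      show "(\<lambda>n. G n p) \<longlonglongrightarrow> (f ?x - f ?y) * f ?x"
      \<comment> \<open>Where f vanishes the denominator tends to 0, but the factor f^2 makes every
        term 0.\<close>
      proof (cases "f ?x = 0")
        case True
        then show ?thesis by (simp add: G_def)
      next
        case False
        have "(\<lambda>n. G n p) \<longlonglongrightarrow> (f ?x - f ?y) / (f ?x + 0) * (f ?x)\<^sup>2"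
          unfolding G_def using False by (intro tendsto_intros gl e0) auto
        then show ?thesis using False by (simp add: power2_eq_square)
      qed
    qed
    show "AE p in lborel \<Otimes>\<^sub>M \<mu>. norm (G n p) \<le> W p" for n using bound by simp
  qed (use iG in \<open>auto simp: G_def\<close>)
  \<comment> \<open>Polarisation, (a - b) a = ((b - a)^2 + a^2 - b^2) / 2; by stationarity the last
    two squares have equal integrals.\<close>
  have "(\<integral>p. (f (fst p) - f (fst p + snd p)) * f (fst p) \<partial>(lborel \<Otimes>\<^sub>M \<mu>))
      = (\<integral>p. ((f (fst p + snd p) - f (fst p))\<^sup>2 + (f (fst p))\<^sup>2 - (f (fst p + snd p))\<^sup>2) / 2 \<partial>(lborel \<Otimes>\<^sub>M \<mu>))"
    by (intro Bochner_Integration.integral_cong refl) (simp add: power2_eq_square algebra_simps)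
  also have "\<dots> = energy \<mu> f"
    unfolding energy_eq_product[OF f(1)]
    using integrable_product_fst[OF f2] integrable_product_sum[OF f2] integrable_product_diff[OF f(1)]
    by (simp add: integral_product_fst[OF f2] integral_product_sum[OF f2])
  finally have lim': "(\<lambda>n. \<integral>p. G n p \<partial>(lborel \<Otimes>\<^sub>M \<mu>)) \<longlonglongrightarrow> energy \<mu> f" using lim by simp
  have "(\<integral>p. G n p \<partial>(lborel \<Otimes>\<^sub>M \<mu>)) = (\<integral>x. (g n x - conv_op \<mu> (g n) x) / (g n x + e n) * (f x)\<^sup>2 \<partial>lborel)" for n
  proof -
    have "(\<integral>z. G n (x, z) \<partial>\<mu>) = (g n x - conv_op \<mu> (g n) x) / (g n x + e n) * (f x)\<^sup>2" for x
    proof -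
      have "(\<integral>z. G n (x, z) \<partial>\<mu>) = (\<integral>z. g n x - g n (x + z) \<partial>\<mu>) / (g n x + e n) * (f x)\<^sup>2"
        by (simp add: G_def)
      also have "(\<integral>z. g n x - g n (x + z) \<partial>\<mu>) = g n x - conv_op \<mu> (g n) x"
        unfolding conv_op_def
        by (subst Bochner_Integration.integral_diff) (auto intro!: integrable_translate_bounded[OF _ g'] simp: prob_space[unfolded space_eq])
      finally show ?thesis .
    qed
    then show ?thesis using P.integral_fst'[OF iG[of n]] by simp
  qed
  then show ?thesis using lim' by (simp add: g_def e_def)
qed

end

section \<open>Reversibility under symmetric laws\<close>

locale sym_prob = borel_prob \<mu> for \<mu> :: "(real^'n) measure" +
  assumes symmetric: "distr \<mu> borel uminus = \<mu>"
begin

interpretation P: pair_sigma_finite "lborel :: (real^'n) measure" \<mu> ..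

text \<open>At fixed z the end point x + z is a translate of x, and z may then be replaced by -z by
  symmetry of \<mu>. This is detailed balance with respect to Lebesgue measure.\<close>

lemma flip_invariant:
  "distr (lborel \<Otimes>\<^sub>M \<mu>) (lborel \<Otimes>\<^sub>M \<mu>) (\<lambda>p. (fst p + snd p, - snd p)) = lborel \<Otimes>\<^sub>M \<mu>"
proof (rule measure_eqI)
  fix B assume "B \<in> sets (distr (lborel \<Otimes>\<^sub>M \<mu>) (lborel \<Otimes>\<^sub>M \<mu>) (\<lambda>p. (fst p + snd p, - snd p)))"
  then have B: "B \<in> sets (lborel \<Otimes>\<^sub>M \<mu>)" by simp
  also have "sets (lborel \<Otimes>\<^sub>M \<mu>) = sets (borel \<Otimes>\<^sub>M borel)" by (rule sets_pair_measure_cong) auto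
  finally have [measurable]: "B \<in> sets (borel \<Otimes>\<^sub>M borel)" .
  have "emeasure (distr (lborel \<Otimes>\<^sub>M \<mu>) (lborel \<Otimes>\<^sub>M \<mu>) (\<lambda>p. (fst p + snd p, - snd p))) B
      = (\<integral>\<^sup>+p. indicator B p \<partial>distr (lborel \<Otimes>\<^sub>M \<mu>) (lborel \<Otimes>\<^sub>M \<mu>) (\<lambda>p. (fst p + snd p, - snd p)))"
    by (rule nn_integral_indicator[symmetric]) (simp add: B)
  also have "\<dots> = (\<integral>\<^sup>+p. indicator B (fst p + snd p, - snd p) \<partial>(lborel \<Otimes>\<^sub>M \<mu>))"
    by (subst nn_integral_distr) auto
  also have "\<dots> = (\<integral>\<^sup>+z. \<integral>\<^sup>+x. indicator B (x + z, - z) \<partial>lborel \<partial>\<mu>)"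
    by (subst P.nn_integral_snd[symmetric]) auto
  also have "\<dots> = (\<integral>\<^sup>+z. \<integral>\<^sup>+x. indicator B (x, - z) \<partial>lborel \<partial>\<mu>)"
  proof (rule nn_integral_cong)
    fix z
    have "(\<integral>\<^sup>+x. indicator B (x, - z) \<partial>lborel) = (\<integral>\<^sup>+x. indicator B (x, - z) \<partial>distr lborel borel ((+) z))"
      by (simp add: lborel_distr_plus)
    also have "\<dots> = (\<integral>\<^sup>+x. indicator B (x + z, - z) \<partial>lborel)"
      by (subst nn_integral_distr) (auto simp: add.commute)
    finally show "(\<integral>\<^sup>+x. indicator B (x + z, - z) \<partial>lborel) = (\<integral>\<^sup>+x. indicator B (x, - z) \<partial>lborel)" ..
  qed
  also have "\<dots> = (\<integral>\<^sup>+z. \<integral>\<^sup>+x. indicator B (x, z) \<partial>lborel \<partial>distr \<mu> borel uminus)"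
    by (subst nn_integral_distr) auto
  also have "\<dots> = emeasure (lborel \<Otimes>\<^sub>M \<mu>) B"
    unfolding symmetric by (subst P.nn_integral_snd) auto
  finally show "emeasure (distr (lborel \<Otimes>\<^sub>M \<mu>) (lborel \<Otimes>\<^sub>M \<mu>) (\<lambda>p. (fst p + snd p, - snd p))) B = emeasure (lborel \<Otimes>\<^sub>M \<mu>) B" .
qed simp

text \<open>The flip exchanges the two ends of a jump and inverts the ratio of the weights, and
  a^2 r + b^2 / r is at least 2 a b.\<close>

lemma quotient_le_energy:
  assumes f: "L2fun f" and w [measurable]: "w \<in> borel_measurable borel"
    and \<epsilon>: "0 < \<epsilon>" "\<And>x. \<epsilon> \<le> w x" "\<And>x. w x \<le> C"
  shows "(\<integral>x. (w x - conv_op \<mu> w x) / w x * (f x)\<^sup>2 \<partial>lborel) \<le> energy \<mu> f"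
proof -
  have [measurable]: "f \<in> borel_measurable borel" using f by (simp add: L2fun_def)
  have wpos: "0 < w x" for x using \<epsilon>(1) \<epsilon>(2)[of x] by linarith
  note f2 = L2fun_integrable[OF f]
  let ?M = "lborel \<Otimes>\<^sub>M \<mu>"
  define G where "G = (\<lambda>p. w (fst p + snd p) / w (fst p) * (f (fst p))\<^sup>2)"
  define H where "H = (\<lambda>p. w (fst p) / w (fst p + snd p) * (f (fst p + snd p))\<^sup>2)"
  have [measurable]: "G \<in> borel_measurable ?M" "H \<in> borel_measurable ?M" unfolding G_def H_def by measurable
  have iG: "integrable ?M G"
  proof (rule Bochner_Integration.integrable_bound[OF integrable_mult_right[OF integrable_product_fst[OF f2], of "C / \<epsilon>"]])
    show "AE p in ?M. norm (G p) \<le> norm (C / \<epsilon> * (f (fst p))\<^sup>2)"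
    proof (intro AE_I2)
      fix p :: "(real^'n) \<times> (real^'n)"
      have "w (fst p + snd p) / w (fst p) \<le> C / \<epsilon>"
        using \<epsilon> wpos less_le_trans[OF wpos \<epsilon>(3)] by (intro frac_le) (auto intro: less_imp_le)
      then have "G p \<le> C / \<epsilon> * (f (fst p))\<^sup>2" unfolding G_def by (intro mult_right_mono) auto
      moreover have "0 \<le> G p" unfolding G_def using wpos by (simp add: less_imp_le)
      ultimately show "norm (G p) \<le> norm (C / \<epsilon> * (f (fst p))\<^sup>2)" unfolding real_norm_def by linarith
    qed
  qed simp
  have GH: "G (fst p + snd p, - snd p) = H p" for p by (simp add: G_def H_def)
  have "integrable (distr ?M ?M (\<lambda>p. (fst p + snd p, - snd p))) G" using iG by (simp add: flip_invariant)
  then have iH: "integrable ?M H" by (subst (asm) integrable_distr_eq) (auto simp: GH)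
  have "(\<integral>p. G p \<partial>?M) = (\<integral>p. G p \<partial>distr ?M ?M (\<lambda>p. (fst p + snd p, - snd p)))" by (simp add: flip_invariant)
  also have "\<dots> = (\<integral>p. H p \<partial>?M)" by (subst integral_distr) (auto simp: GH)
  finally have eqGH: "(\<integral>p. G p \<partial>?M) = (\<integral>p. H p \<partial>?M)" .
  have "(\<integral>x. (w x - conv_op \<mu> w x) / w x * (f x)\<^sup>2 \<partial>lborel) = (\<integral>x. (\<integral>z. (f x)\<^sup>2 - G (x, z) \<partial>\<mu>) \<partial>lborel)"
  proof (intro Bochner_Integration.integral_cong refl)
    fix x
    have iw: "integrable \<mu> (\<lambda>z. w (x + z))"
      by (rule integrable_translate_bounded[where C=C]) (use \<epsilon> wpos in \<open>auto simp: abs_of_pos\<close>)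
    have "(\<integral>z. (f x)\<^sup>2 - G (x, z) \<partial>\<mu>) = (f x)\<^sup>2 - conv_op \<mu> w x / w x * (f x)\<^sup>2"
      unfolding G_def conv_op_def using iw
      by (subst Bochner_Integration.integral_diff) (auto simp: prob_space[unfolded space_eq])
    then show "(w x - conv_op \<mu> w x) / w x * (f x)\<^sup>2 = (\<integral>z. (f x)\<^sup>2 - G (x, z) \<partial>\<mu>)"
      using wpos[of x] by (simp add: diff_divide_distrib left_diff_distrib)
  qed
  also have "\<dots> = (\<integral>p. (f (fst p))\<^sup>2 - G p \<partial>?M)"
    using P.integral_fst'[OF Bochner_Integration.integrable_diff[OF integrable_product_fst[OF f2] iG]] by simp
  \<comment> \<open>The integrand is averaged with its image under the flip: \<open>G\<close> and
    \<open>H\<close> have equal integrals, and so do the two squares.\<close>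
  also have "\<dots> = (\<integral>p. ((f (fst p))\<^sup>2 + (f (fst p + snd p))\<^sup>2 - G p - H p) / 2 \<partial>?M)"
    using iG iH integrable_product_fst[OF f2] integrable_product_sum[OF f2] eqGH
    by (simp add: integral_product_fst[OF f2] integral_product_sum[OF f2])
  also have "\<dots> \<le> (\<integral>p. (f (fst p + snd p) - f (fst p))\<^sup>2 / 2 \<partial>?M)"
  proof (rule integral_mono)
    fix p :: "(real^'n) \<times> (real^'n)"
    define a b r where "a = f (fst p)" and "b = f (fst p + snd p)" and "r = w (fst p + snd p) / w (fst p)"
    have r: "0 < r" unfolding r_def using wpos by simp
    have "0 \<le> (a * r - b)\<^sup>2 / r" using r by simp
    also have "(a * r - b)\<^sup>2 / r = r * a\<^sup>2 + b\<^sup>2 / r - 2 * a * b"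
      using r by (simp add: power2_eq_square field_simps)
    finally have "a\<^sup>2 + b\<^sup>2 - r * a\<^sup>2 - b\<^sup>2 / r \<le> (b - a)\<^sup>2" by (simp add: power2_diff algebra_simps)
    moreover have "G p = r * a\<^sup>2" "H p = b\<^sup>2 / r" by (simp_all add: G_def H_def a_def b_def r_def)
    ultimately show "((f (fst p))\<^sup>2 + (f (fst p + snd p))\<^sup>2 - G p - H p) / 2 \<le> (f (fst p + snd p) - f (fst p))\<^sup>2 / 2"
      by (simp add: a_def b_def)
  qed (use iG iH integrable_product_fst[OF f2] integrable_product_sum[OF f2] integrable_product_diff[OF f] in auto)
  also have "\<dots> = energy \<mu> f" by (simp add: energy_eq_product[OF f])
  finally show ?thesis .
qed

end

subsection \<open>Resolvents of symmetric convolution semigroups\<close>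

lemma exp_quotient_tendsto: "((\<lambda>h::real. (exp (l * h) - 1) / h) \<longlongrightarrow> l) (at_right 0)"
proof -
  have "((\<lambda>h. exp (l * h)) has_real_derivative exp (l * 0) * l) (at 0)"
    by (auto intro!: derivative_eq_intros)
  then have "((\<lambda>h. (exp (l * h) - 1) / h) \<longlongrightarrow> l) (at 0)"
    by (simp add: DERIV_def)
  then show ?thesis by (rule tendsto_mono[OF at_le, rotated]) simp
qed

text \<open>The properties of the Levy laws on which the analysis rests. Measurability in t allows
  mixing over random times, concentration at small t gives strong continuity, and symmetry gives
  reversibility at each time.\<close>

locale sym_conv_semigroup =
  fixes \<mu> :: "real \<Rightarrow> (real^'n) measure"
  assumes sym_prob: "sym_prob (\<mu> t)"
    and convolution: "0 \<le> s \<Longrightarrow> 0 \<le> t \<Longrightarrow> (\<mu> s \<star> \<mu> t) = \<mu> (s + t)"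
    and kernel [measurable]: "\<mu> \<in> borel \<rightarrow>\<^sub>M prob_algebra borel"
    and concentrates: "0 < r \<Longrightarrow> ((\<lambda>t. measure (\<mu> t) {x. r \<le> norm x}) \<longlongrightarrow> 0) (at_right 0)"
    and zero: "\<mu> 0 = return borel 0"
begin

sublocale \<mu>: sym_prob "\<mu> t" for t
  by (rule sym_prob)

lemma borel_prob_\<mu>: "borel_prob (\<mu> t)"
  by unfold_locales

lemma kernel': "\<mu> \<in> borel \<rightarrow>\<^sub>M subprob_algebra borel"
  by (rule measurable_prob_algebraD[OF kernel])

lemma integral_kernel_measurable [measurable]:
  fixes g :: "real^'n \<Rightarrow> real"
  assumes "g \<in> borel_measurable borel"
  shows "(\<lambda>t. \<integral>z. g z \<partial>\<mu> t) \<in> borel_measurable borel"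
  using measurable_compose[OF kernel' integral_measurable_subprob_algebra[OF assms]] by simp

lemma conv_op_time_measurable [measurable]:
  assumes [measurable]: "g \<in> borel_measurable borel"
  shows "(\<lambda>t. conv_op (\<mu> t) g x) \<in> borel_measurable borel"
  unfolding conv_op_def by (rule integral_kernel_measurable) measurable

lemma energy_time_measurable [measurable]:
  assumes [measurable]: "f \<in> borel_measurable borel"
  shows "(\<lambda>t. energy (\<mu> t) f) \<in> borel_measurable borel"
  unfolding energy_def by (intro borel_measurable_divide integral_kernel_measurable) auto

lemma conv_op_0 [simp]:
  assumes "g \<in> borel_measurable borel"
  shows "conv_op (\<mu> 0) g x = g x"
  unfolding conv_op_def zero using assms by (subst integral_return) auto

lemma conv_op_semigroup:
  assumes "0 \<le> s" "0 \<le> t" and [measurable]: "g \<in> borel_measurable borel" and g: "\<And>x. \<bar>g x\<bar> \<le> C"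
  shows "conv_op (\<mu> s) (conv_op (\<mu> t) g) x = conv_op (\<mu> (s + t)) g x"
  unfolding conv_op_def convolution[OF assms(1,2), symmetric]
  by (subst integral_convolution[OF borel_prob_\<mu> borel_prob_\<mu>, where C=C]) (auto simp: g ac_simps)

lemma energy_le:
  assumes "L2fun f"
  shows "energy (\<mu> t) f \<le> 2 * sq_int f"
proof -
  have [measurable]: "f \<in> borel_measurable borel" using assms by (simp add: L2fun_def)
  have "(\<integral>z. shift_dist f z \<partial>\<mu> t) \<le> (\<integral>z. 4 * sq_int f \<partial>\<mu> t)"
    using shift_dist_le[OF assms]
    by (intro integral_mono \<mu>.integrable_bounded[where C="4 * sq_int f"]) auto
  then show ?thesis by (simp add: energy_def \<mu>.prob_space[unfolded \<mu>.space_eq])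
qed

text \<open>Short jumps contribute little by continuity of translations, long ones because the law
  concentrates while \<open>shift_dist\<close> stays bounded.\<close>

lemma energy_tendsto_0:
  assumes f: "L2fun f" "\<And>x. 0 \<le> f x"
  shows "((\<lambda>t. energy (\<mu> t) f) \<longlongrightarrow> 0) (at_right 0)"
proof (rule tendstoI)
  fix e :: real assume e: "0 < e"
  have [measurable]: "f \<in> borel_measurable borel" using f by (simp add: L2fun_def)
  have "shift_dist f 0 = 0" by (simp add: shift_dist_def sq_int_def)
  then have "continuous (at 0) (shift_dist f)"
    using shift_dist_tendsto[OF f] by (intro continuous_at_sequentiallyI) auto
  then obtain r where r: "0 < r" "\<And>z. norm z < r \<Longrightarrow> shift_dist f z < e"
    using e \<open>shift_dist f 0 = 0\<close> unfolding continuous_at_eps_delta by (auto simp: dist_real_def)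
  have [measurable]: "{x :: real^'n. r \<le> norm x} \<in> sets borel" by measurable
  have le: "energy (\<mu> t) f \<le> e / 2 + 2 * sq_int f * measure (\<mu> t) {x. r \<le> norm x}" for t
  proof -
    have "(\<integral>z. shift_dist f z \<partial>\<mu> t) \<le> (\<integral>z. e + 4 * sq_int f * indicator {x. r \<le> norm x} z \<partial>\<mu> t)"
    proof (rule integral_mono)
      fix z
      show "shift_dist f z \<le> e + 4 * sq_int f * indicator {x. r \<le> norm x} z"
        using r(2)[of z] shift_dist_le[OF f(1), of z] e by (cases "norm z < r") (auto simp: indicator_def)
    qed (use shift_dist_le[OF f(1)] in \<open>auto intro!: \<mu>.integrable_bounded[where C="4 * sq_int f"]
        integrable_mult_right integrable_real_indicator simp: less_top[symmetric]\<close>)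
    also have "\<dots> = e + 4 * sq_int f * measure (\<mu> t) {x. r \<le> norm x}"
      by (subst Bochner_Integration.integral_add)
         (auto intro!: integrable_mult_right integrable_real_indicator simp: less_top[symmetric] \<mu>.prob_space[unfolded \<mu>.space_eq])
    finally show ?thesis by (simp add: energy_def)
  qed
  have "((\<lambda>t. 2 * sq_int f * measure (\<mu> t) {x. r \<le> norm x}) \<longlongrightarrow> 2 * sq_int f * 0) (at_right 0)"
    by (intro tendsto_intros concentrates r)
  then have "eventually (\<lambda>t. 2 * sq_int f * measure (\<mu> t) {x. r \<le> norm x} < e / 2) (at_right 0)"
    by (rule order_tendstoD(2)) (use e in simp)
  then show "eventually (\<lambda>t. dist (energy (\<mu> t) f) 0 < e) (at_right 0)"
  proof eventually_elim
    case (elim t)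
    then show ?case using le[of t] \<mu>.energy_nonneg[of t f] by (simp add: dist_real_def)
  qed
qed

text \<open>The law of the process at an independent random time with law
  \<open>\<tau>\<close>.\<close>

definition mix :: "real measure \<Rightarrow> (real^'n) measure" where
  "mix \<tau> = \<tau> \<bind> \<mu>"

context
  fixes \<tau> :: "real measure"
  assumes \<tau>: "prob_space \<tau>" and sets_\<tau> [measurable_cong, simp]: "sets \<tau> = sets borel"
begin

interpretation \<tau>: prob_space \<tau> by (rule \<tau>)

lemma kernel_\<tau>: "\<mu> \<in> \<tau> \<rightarrow>\<^sub>M subprob_algebra borel"
  using kernel' by simp

lemma sym_prob_mix: "sym_prob (mix \<tau>)"
proof -
  have k: "\<mu> \<in> \<tau> \<rightarrow>\<^sub>M prob_algebra borel" using kernel by simp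
  have p: "\<tau> \<in> space (prob_algebra \<tau>)" by (simp add: space_prob_algebra \<tau>)
  have ne: "space \<tau> \<noteq> {}" using sets_eq_imp_space_eq[OF sets_\<tau>] by simp
  have "distr (mix \<tau>) borel uminus = mix \<tau>"
    unfolding mix_def by (subst distr_bind[OF kernel_\<tau> ne]) (auto simp: \<mu>.symmetric)
  then show ?thesis
    using prob_space_bind'[OF p k] sets_bind'[OF p k]
    by (auto simp: sym_prob_def sym_prob_axioms_def borel_prob_def borel_prob_axioms_def mix_def)
qed

lemma integral_mix:
  fixes g :: "real^'n \<Rightarrow> real"
  assumes "g \<in> borel_measurable borel" "\<And>x. \<bar>g x\<bar> \<le> C"
  shows "(\<integral>z. g z \<partial>mix \<tau>) = (\<integral>t. (\<integral>z. g z \<partial>\<mu> t) \<partial>\<tau>)"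
  unfolding mix_def using assms
  by (intro integral_bind[where K=borel and B=C and B'=1] kernel_\<tau> \<tau>.finite_measure AE_I2)
     (auto simp: \<mu>.emeasure_space_1[unfolded \<mu>.space_eq])

lemma conv_op_mix:
  assumes [measurable]: "g \<in> borel_measurable borel" and "\<And>x. \<bar>g x\<bar> \<le> C"
  shows "conv_op (mix \<tau>) g x = (\<integral>t. conv_op (\<mu> t) g x \<partial>\<tau>)"
  unfolding conv_op_def by (rule integral_mix[where C=C]) (auto simp: assms)

text \<open>The energy is linear in the law, hence averages over the random time; the bound on
  \<open>shift_dist\<close> justifies the exchange.\<close>

lemma energy_mix:
  assumes f: "L2fun f"
  shows "energy (mix \<tau>) f = (\<integral>t. energy (\<mu> t) f \<partial>\<tau>)"
proof -
  have [measurable]: "f \<in> borel_measurable borel" using f by (simp add: L2fun_def)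
  show ?thesis
    unfolding energy_def
    using integral_mix[of "shift_dist f" "4 * sq_int f"] shift_dist_le[OF f] by simp
qed

lemma integrable_energy:
  assumes f: "L2fun f"
  shows "integrable \<tau> (\<lambda>t. energy (\<mu> t) f)"
proof -
  have [measurable]: "f \<in> borel_measurable borel" using f by (simp add: L2fun_def)
  show ?thesis
    using energy_le[OF f] \<mu>.energy_nonneg
    by (intro \<tau>.integrable_const_bound[where B="2 * sq_int f"]) auto
qed

end

section \<open>Exponential times and the resolvent\<close>

definition expo :: "real \<Rightarrow> real measure" where
  "expo l = density lborel (\<lambda>t. ennreal (exponential_density l t))"

text \<open>Normalised to be a probability: convolution with it is the Markov operator l (l -
  generator)^-1.\<close>

definition resolvent :: "real \<Rightarrow> (real^'n) measure" where
  "resolvent l = mix (expo l)"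

text \<open>The exponential time conditioned to be at most h: by lack of memory it is what separates
  the resolvent from its image under the time-h operator.\<close>

definition early :: "real \<Rightarrow> real \<Rightarrow> real measure" where
  "early l h = uniform_measure (expo l) {..h}"

lemma sets_expo [simp, measurable_cong]: "sets (expo l) = sets borel" "sets (early l h) = sets borel"
  by (simp_all add: expo_def early_def)

lemma prob_expo: "0 < l \<Longrightarrow> prob_space (expo l)"
  unfolding expo_def by (rule prob_space_exponential_density)

lemma emeasure_expo: "0 < l \<Longrightarrow> 0 \<le> h \<Longrightarrow> emeasure (expo l) {..h} = ennreal (1 - exp (- (l * h)))"
  unfolding expo_def by (simp add: emeasure_erlang_density erlang_CDF_0)

lemma prob_early: "0 < l \<Longrightarrow> 0 < h \<Longrightarrow> prob_space (early l h)"
  unfolding early_def by (rule prob_space_uniform_measure) (auto simp: emeasure_expo)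

lemma integral_expo:
  fixes F :: "real \<Rightarrow> real"
  assumes "0 < l" "F \<in> borel_measurable borel"
  shows "(\<integral>t. F t \<partial>expo l) = (\<integral>t. exponential_density l t * F t \<partial>lborel)"
  unfolding expo_def using assms by (subst integral_density) auto

lemma integral_early:
  fixes F :: "real \<Rightarrow> real"
  assumes "0 < l" "0 < h" "F \<in> borel_measurable borel"
  shows "(\<integral>t. F t \<partial>early l h) = (\<integral>t. indicator {..h} t * F t \<partial>expo l) / (1 - exp (- (l * h)))"
proof -
  have c: "0 < 1 - exp (- (l * h))" using assms by simp
  have "early l h = density (expo l) (\<lambda>t. ennreal (indicator {..h} t / (1 - exp (- (l * h)))))"
    unfolding early_def uniform_measure_def emeasure_expo[OF assms(1) less_imp_le[OF assms(2)]] using c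
    by (intro density_cong) (auto simp: divide_ennreal[symmetric] ennreal_indicator)
  then have "(\<integral>t. F t \<partial>early l h) = (\<integral>t. (indicator {..h} t / (1 - exp (- (l * h)))) * F t \<partial>expo l)"
    using c assms by (simp add: integral_density)
  then show ?thesis by simp
qed

lemma AE_early: "0 < l \<Longrightarrow> 0 < h \<Longrightarrow> AE t in early l h. 0 \<le> t \<and> t \<le> h"
proof -
  assume "0 < l" "0 < h"
  have "AE t in expo l. 0 \<le> t"
    unfolding expo_def by (subst AE_density) (auto simp: exponential_density_def)
  then show "AE t in early l h. 0 \<le> t \<and> t \<le> h"
    unfolding early_def by (intro AE_uniform_measureI) auto
qed

lemma sym_prob_resolvent: "0 < l \<Longrightarrow> sym_prob (resolvent l)"
  unfolding resolvent_def by (intro sym_prob_mix prob_expo) auto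

lemma sym_prob_early: "0 < l \<Longrightarrow> 0 < h \<Longrightarrow> sym_prob (mix (early l h))"
  by (intro sym_prob_mix prob_early) auto

text \<open>Proved on the level of measures: the resolvent law convolved with the time-h law is the
  law at the exponential time plus h. The semigroup property asks for nonnegative times, which holds
  almost surely.\<close>

lemma conv_op_resolvent_shift:
  assumes l: "0 < l" and h: "0 \<le> h" and [measurable]: "g \<in> borel_measurable borel" and g: "\<And>x. \<bar>g x\<bar> \<le> C"
  shows "conv_op (\<mu> h) (conv_op (resolvent l) g) x = (\<integral>t. conv_op (\<mu> (t + h)) g x \<partial>expo l)"
proof -
  interpret R: sym_prob "resolvent l" by (rule sym_prob_resolvent[OF l])
  interpret X: prob_space "expo l" by (rule prob_expo[OF l])
  have R: "borel_prob (resolvent l)" by unfold_locales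
  have sh: "(\<lambda>t. \<mu> (t + h)) \<in> expo l \<rightarrow>\<^sub>M subprob_algebra borel"
    using measurable_compose[OF _ kernel', of "\<lambda>t. t + h" borel] by simp
  have AE: "AE t in expo l. 0 \<le> t"
    unfolding expo_def by (subst AE_density) (auto simp: exponential_density_def)
  have eq: "(resolvent l \<star> \<mu> h) = (expo l \<bind> (\<lambda>t. \<mu> (t + h)))"
  proof (rule measure_eqI)
    have s: "sets (expo l \<bind> (\<lambda>t. \<mu> (t + h))) = sets borel"
      using sets_eq_imp_space_eq[OF sets_expo(1)] by (intro sets_bind) auto
    then show "sets (resolvent l \<star> \<mu> h) = sets (expo l \<bind> (\<lambda>t. \<mu> (t + h)))" by simp
    fix B assume "B \<in> sets (resolvent l \<star> \<mu> h)"
    then have B [measurable]: "B \<in> sets borel" by simp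
    have "emeasure (resolvent l \<star> \<mu> h) B = (\<integral>\<^sup>+x. indicator B x \<partial>(resolvent l \<star> \<mu> h))" by simp
    also have "\<dots> = (\<integral>\<^sup>+x. \<integral>\<^sup>+y. indicator B (x + y) \<partial>\<mu> h \<partial>resolvent l)"
      by (rule nn_integral_convolution) (auto intro: R.finite_measure \<mu>.finite_measure)
    also have "\<dots> = (\<integral>\<^sup>+t. \<integral>\<^sup>+x. \<integral>\<^sup>+y. indicator B (x + y) \<partial>\<mu> h \<partial>\<mu> t \<partial>expo l)"
      unfolding resolvent_def mix_def
      by (rule nn_integral_bind[where B=borel, OF _ kernel_\<tau>[OF prob_expo[OF l]]]) auto
    also have "\<dots> = (\<integral>\<^sup>+t. \<integral>\<^sup>+x. indicator B x \<partial>\<mu> (t + h) \<partial>expo l)"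
      using AE
    proof (intro nn_integral_cong_AE, eventually_elim)
      case (elim t)
      have "(\<integral>\<^sup>+x. indicator B x \<partial>\<mu> (t + h)) = (\<integral>\<^sup>+x. indicator B x \<partial>(\<mu> t \<star> \<mu> h))"
        by (simp only: convolution[OF elim(2) h])
      also have "\<dots> = (\<integral>\<^sup>+x. \<integral>\<^sup>+y. indicator B (x + y) \<partial>\<mu> h \<partial>\<mu> t)"
        by (rule nn_integral_convolution) (auto intro: \<mu>.finite_measure)
      finally show ?case ..
    qed
    also have "\<dots> = (\<integral>\<^sup>+x. indicator B x \<partial>(expo l \<bind> (\<lambda>t. \<mu> (t + h))))"
      by (rule nn_integral_bind[where B=borel, OF _ sh, symmetric]) auto
    also have "\<dots> = emeasure (expo l \<bind> (\<lambda>t. \<mu> (t + h))) B"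
      by (rule nn_integral_indicator) (simp add: s)
    finally show "emeasure (resolvent l \<star> \<mu> h) B = emeasure (expo l \<bind> (\<lambda>t. \<mu> (t + h))) B" .
  qed
  have "conv_op (\<mu> h) (conv_op (resolvent l) g) x = (\<integral>z. \<integral>y. g (x + z + y) \<partial>resolvent l \<partial>\<mu> h)"
    by (simp add: conv_op_def)
  also have "\<dots> = (\<integral>z. g (x + z) \<partial>(\<mu> h \<star> resolvent l))"
    by (subst integral_convolution[OF borel_prob_\<mu> R, where C=C]) (auto simp: g ac_simps)
  also have "(\<mu> h \<star> resolvent l) = (resolvent l \<star> \<mu> h)"
    by (rule convolution_commutative) (auto intro: R.finite_measure \<mu>.finite_measure)
  also have "(\<integral>z. g (x + z) \<partial>(resolvent l \<star> \<mu> h)) = (\<integral>t. (\<integral>z. g (x + z) \<partial>\<mu> (t + h)) \<partial>expo l)"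
    unfolding eq
    by (intro integral_bind[where K=borel and B=C and B'=1] sh X.finite_measure AE_I2)
       (auto simp: \<mu>.emeasure_space_1[unfolded \<mu>.space_eq] g)
  finally show ?thesis by (simp add: conv_op_def)
qed

text \<open>Shifting the exponential density by h multiplies it by exp (l h) and removes the part on
  [0, h], whose normalisation is \<open>early l h\<close>. The formula is exact for every h, so it
  gives bounds as well as limits.\<close>

lemma resolvent_identity:
  assumes l: "0 < l" and h: "0 < h" and [measurable]: "g \<in> borel_measurable borel" and g: "\<And>x. \<bar>g x\<bar> \<le> C"
  shows "conv_op (\<mu> h) (conv_op (resolvent l) g) x - conv_op (resolvent l) g x =
    (exp (l * h) - 1) * (conv_op (resolvent l) g x - conv_op (mix (early l h)) g x)"
proof -
  define F where "F = (\<lambda>t. conv_op (\<mu> t) g x)"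
  let ?d = "exponential_density l"
  have [measurable]: "F \<in> borel_measurable borel" unfolding F_def by measurable
  have F: "\<bar>F t\<bar> \<le> C" for t
    using \<mu>.conv_op_bounds[of g "-C" C t x] g by (simp add: F_def abs_le_iff minus_le_iff)
  interpret X: prob_space "expo l" by (rule prob_expo[OF l])
  have iX: "integrable (expo l) G" if "G \<in> borel_measurable borel" "\<And>t. \<bar>G t\<bar> \<le> C" for G :: "real \<Rightarrow> real"
    using that by (intro X.integrable_const_bound[where B=C]) auto
  have iL: "integrable lborel (\<lambda>t. ?d t * G t)" if "G \<in> borel_measurable borel" "\<And>t. \<bar>G t\<bar> \<le> C" for G :: "real \<Rightarrow> real"
    using iX[OF that] that(1) l unfolding expo_def by (subst (asm) integrable_density) auto
  have i1: "integrable lborel (\<lambda>t. ?d t * F t)" by (rule iL) (auto simp: F)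
  have indF: "\<bar>indicator {..h} t * F t\<bar> \<le> C" for t
    using F[of t] by (auto simp: indicator_def)
  have i2: "integrable lborel (\<lambda>t. ?d t * (indicator {..h} t * F t))" by (rule iL) (auto simp: indF)
  have u: "conv_op (resolvent l) g x = (\<integral>t. ?d t * F t \<partial>lborel)"
    unfolding resolvent_def F_def
    by (subst conv_op_mix[OF prob_expo[OF l], where C=C]) (auto simp: g integral_expo[OF l])
  have k: "conv_op (mix (early l h)) g x = (\<integral>t. ?d t * (indicator {..h} t * F t) \<partial>lborel) / (1 - exp (- (l * h)))"
    unfolding F_def
    by (subst conv_op_mix[OF prob_early[OF l h], where C=C]) (auto simp: g integral_early[OF l h] integral_expo[OF l])
  have "conv_op (\<mu> h) (conv_op (resolvent l) g) x = (\<integral>t. ?d t * F (t + h) \<partial>lborel)"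
    using h unfolding F_def
    by (subst conv_op_resolvent_shift[OF l _ _ g]) (auto simp: integral_expo[OF l])
  also have "\<dots> = (\<integral>s. ?d (s - h) * F s \<partial>lborel)"
    using lborel_integral_real_affine[of 1 "\<lambda>s. ?d (s - h) * F s" h] by (simp add: add.commute)
  also have "\<dots> = (\<integral>s. exp (l * h) * (?d s * F s - ?d s * (indicator {..h} s * F s)) \<partial>lborel)"
  proof (rule integral_cong_AE)
    \<comment> \<open>The two densities may differ at s = h, because the density is positive at 0
      while the removed interval is closed; this point is null.\<close>
    show "AE s in lborel. ?d (s - h) * F s = exp (l * h) * (?d s * F s - ?d s * (indicator {..h} s * F s))"
      using AE_lborel_singleton[of h]
    proof eventually_elim
      case (elim s)
      then show ?case using h
        by (auto simp: exponential_density_def indicator_def exp_add[symmetric] algebra_simps)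
    qed
  qed measurable
  also have "\<dots> = exp (l * h) * ((\<integral>t. ?d t * F t \<partial>lborel) - (\<integral>t. ?d t * (indicator {..h} t * F t) \<partial>lborel))"
    by (simp add: Bochner_Integration.integral_diff[OF i1 i2])
  finally have T: "conv_op (\<mu> h) (conv_op (resolvent l) g) x = exp (l * h) * (conv_op (resolvent l) g x - (1 - exp (- (l * h))) * conv_op (mix (early l h)) g x)"
    using l h by (simp add: u k)
  have "exp (l * h) * (1 - exp (- (l * h))) = exp (l * h) - 1"
    by (simp add: right_diff_distrib exp_add[symmetric] exp_minus)
  then have "exp (l * h) * ((1 - exp (- (l * h))) * K) = (exp (l * h) - 1) * K" for K
    by (simp add: mult.assoc[symmetric])
  then show ?thesis unfolding T by (simp add: right_diff_distrib left_diff_distrib)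
qed

text \<open>In the exact formula both averages of \<open>g\<close> lie in [0, C], so their
  difference is at most C. The bound is uniform in space.\<close>

lemma resolvent_lipschitz:
  assumes l: "0 < l" and h: "0 \<le> h" and m: "g \<in> borel_measurable borel" and g: "\<And>x. 0 \<le> g x" "\<And>x. g x \<le> C"
  shows "\<bar>conv_op (\<mu> h) (conv_op (resolvent l) g) x - conv_op (resolvent l) g x\<bar> \<le> (exp (l * h) - 1) * C"
proof (cases "h = 0")
  case True
  interpret R: sym_prob "resolvent l" by (rule sym_prob_resolvent[OF l])
  show ?thesis using True m by simp
next
  case False
  then have h: "0 < h" using h by simp
  interpret R: sym_prob "resolvent l" by (rule sym_prob_resolvent[OF l])
  interpret E: sym_prob "mix (early l h)" by (rule sym_prob_early[OF l h])
  have "\<bar>g x\<bar> \<le> C" for x using g[of x] by simp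
  note id = resolvent_identity[OF l h m this]
  have "\<bar>conv_op (resolvent l) g x - conv_op (mix (early l h)) g x\<bar> \<le> C"
    using R.conv_op_bounds[OF m g, of x] E.conv_op_bounds[OF m g, of x] by (simp add: abs_le_iff)
  moreover have "0 \<le> exp (l * h) - 1" using l h by simp
  ultimately show ?thesis unfolding id by (simp add: abs_mult mult_left_mono)
qed

lemma energy_early_tendsto:
  assumes l: "0 < l" and f: "L2fun f" "\<And>x. 0 \<le> f x"
  shows "((\<lambda>h. energy (mix (early l h)) f) \<longlongrightarrow> 0) (at_right 0)"
proof (rule tendstoI)
  fix e :: real assume e: "0 < e"
  have "eventually (\<lambda>t. energy (\<mu> t) f < e / 2) (at_right 0)"
    using energy_tendsto_0[OF f] by (rule order_tendstoD(2)) (use e in simp)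
  then obtain t0 where t0: "0 < t0" "\<And>t. 0 < t \<Longrightarrow> t < t0 \<Longrightarrow> energy (\<mu> t) f < e / 2"
    unfolding eventually_at_right_field by auto
  have E0: "energy (\<mu> 0) f = 0"
  proof -
    have [measurable]: "f \<in> borel_measurable borel" using f by (simp add: L2fun_def)
    show ?thesis unfolding energy_def zero by (subst integral_return) (auto simp: shift_dist_def sq_int_def)
  qed
  have "dist (energy (mix (early l h)) f) 0 < e" if h: "0 < h" "h < t0" for h
  proof -
    interpret Y: prob_space "early l h" by (rule prob_early[OF l h(1)])
    interpret E: sym_prob "mix (early l h)" by (rule sym_prob_early[OF l h(1)])
    have "energy (mix (early l h)) f \<le> (\<integral>t. e / 2 \<partial>early l h)"
      unfolding energy_mix[OF prob_early[OF l h(1)] sets_expo(2) f(1)]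
    proof (rule integral_mono_AE)
      show "AE t in early l h. energy (\<mu> t) f \<le> e / 2"
        using AE_early[OF l h(1)]
      proof eventually_elim
        case (elim t)
        then show ?case using t0(2)[of t] h E0 e by (cases "t = 0") auto
      qed
    qed (auto intro!: integrable_energy[OF prob_early[OF l h(1)] sets_expo(2) f(1)])
    then show ?thesis using E.energy_nonneg[of f] e by (simp add: dist_real_def Y.prob_space)
  qed
  then show "eventually (\<lambda>h. dist (energy (mix (early l h)) f) 0 < e) (at_right 0)"
    unfolding eventually_at_right_field using t0(1) by auto
qed

text \<open>The exponential time exceeds s with probability exp (- l s), so for large l it
  concentrates where the energy is small. Consequently the smoothed functions approximate the
  original in L2.\<close>

lemma energy_resolvent_tendsto:
  assumes f: "L2fun f" "\<And>x. 0 \<le> f x"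
  shows "((\<lambda>l. energy (resolvent l) f) \<longlongrightarrow> 0) at_top"
proof (rule tendstoI)
  fix e :: real assume e: "0 < e"
  have "eventually (\<lambda>t. energy (\<mu> t) f < e / 2) (at_right 0)"
    using energy_tendsto_0[OF f] by (rule order_tendstoD(2)) (use e in simp)
  then obtain t0 where t0: "0 < t0" "\<And>t. 0 < t \<Longrightarrow> t < t0 \<Longrightarrow> energy (\<mu> t) f < e / 2"
    unfolding eventually_at_right_field by auto
  define s where "s = t0 / 2"
  have s: "0 < s" "\<And>t. 0 < t \<Longrightarrow> t \<le> s \<Longrightarrow> energy (\<mu> t) f \<le> e / 2"
    using t0 by (auto simp: s_def intro: less_imp_le)
  have le: "energy (resolvent l) f \<le> e / 2 + 2 * sq_int f * exp (- (l * s))" if l: "0 < l" for l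
  proof -
    interpret X: prob_space "expo l" by (rule prob_expo[OF l])
    have ae: "AE t in expo l. 0 < t"
      unfolding expo_def using AE_lborel_singleton[of "0::real"]
      by (subst AE_density) (auto simp: exponential_density_def elim!: eventually_mono)
    have m: "measure (expo l) {..s} = 1 - exp (- (l * s))"
      using emeasure_expo[OF l less_imp_le[OF s(1)]] l s(1) by (simp add: measure_def)
    have im: "integrable (expo l) (\<lambda>t. indicator {..s} t :: real)"
      by (intro integrable_real_indicator) (auto simp: less_top[symmetric])
    have "energy (resolvent l) f \<le> (\<integral>t. e / 2 + 2 * sq_int f * (1 - indicator {..s} t) \<partial>expo l)"
      unfolding resolvent_def energy_mix[OF prob_expo[OF l] sets_expo(1) f(1)]
    proof (rule integral_mono_AE)
      show "AE t in expo l. energy (\<mu> t) f \<le> e / 2 + 2 * sq_int f * (1 - indicator {..s} t)"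
        using ae
      proof eventually_elim
        case (elim t)
        then show ?case using s(2)[of t] energy_le[OF f(1), of t] e by (cases "t \<le> s") auto
      qed
    qed (use im in \<open>auto intro!: integrable_energy[OF prob_expo[OF l] sets_expo(1) f(1)]\<close>)
    also have "\<dots> = e / 2 + 2 * sq_int f * (1 - measure (expo l) {..s})"
      using im by (subst Bochner_Integration.integral_add) (auto simp: X.prob_space Bochner_Integration.integral_diff)
    finally show ?thesis by (simp add: m)
  qed
  have "((\<lambda>l. 2 * sq_int f * exp (- (l * s))) \<longlongrightarrow> 2 * sq_int f * 0) at_top"
    using s(1) by (intro tendsto_intros filterlim_compose[OF exp_at_bot])
      (auto simp: filterlim_uminus_at_bot intro!: filterlim_at_top_mult_tendsto_pos[OF tendsto_const] filterlim_ident)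
  then have "eventually (\<lambda>l. 2 * sq_int f * exp (- (l * s)) < e / 2) at_top"
    by (rule order_tendstoD(2)) (use e in simp)
  then show "eventually (\<lambda>l. dist (energy (resolvent l) f) 0 < e) at_top"
    using eventually_gt_at_top[of 0]
  proof eventually_elim
    case (elim l)
    interpret R: sym_prob "resolvent l" by (rule sym_prob_resolvent) fact
    show ?case using le[OF elim(2)] elim(1) R.energy_nonneg[of f] by (simp add: dist_real_def)
  qed
qed

text \<open>By the exact formula the difference quotient is (exp (l h) - 1) / h times u - K_h, where
  K_h averages over a time at most h. The factor tends to l and K_h to \<open>g\<close> in L2, so
  the generator at u is l (u - g).\<close>

lemma resolvent_generator:
  assumes l: "0 < l" and gL: "L2fun g" and g: "\<And>x. 0 \<le> g x" "\<And>x. g x \<le> C"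
  shows "((\<lambda>h. sq_int (\<lambda>x. (conv_op (\<mu> h) (conv_op (resolvent l) g) x - conv_op (resolvent l) g x) / h - l * (conv_op (resolvent l) g x - g x))) \<longlongrightarrow> 0) (at_right 0)"
proof -
  have m [measurable]: "g \<in> borel_measurable borel" using gL by (simp add: L2fun_def)
  have ga: "\<bar>g x\<bar> \<le> C" for x using g[of x] by simp
  interpret R: sym_prob "resolvent l" by (rule sym_prob_resolvent[OF l])
  let ?u = "conv_op (resolvent l) g"
  let ?K = "\<lambda>h. conv_op (mix (early l h)) g"
  let ?b = "\<lambda>h. (exp (l * h) - 1) / h"
  have Lug: "L2fun (\<lambda>x. ?u x - g x)" by (rule L2fun_diff[OF R.L2fun_conv_op[OF gL ga] gL])
  have b: "(?b \<longlongrightarrow> l) (at_right 0)"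
    by (rule exp_quotient_tendsto)
  have lim: "((\<lambda>h. 2 * ((?b h - l)\<^sup>2 * sq_int (\<lambda>x. ?u x - g x)) + 2 * ((?b h)\<^sup>2 * (2 * energy (mix (early l h)) g)))
     \<longlongrightarrow> 2 * ((l - l)\<^sup>2 * sq_int (\<lambda>x. ?u x - g x)) + 2 * (l\<^sup>2 * (2 * 0))) (at_right 0)"
    by (intro tendsto_intros b energy_early_tendsto l gL g)
  show ?thesis
  proof (rule tendsto_sandwich[OF _ _ tendsto_const])
    show "eventually (\<lambda>h. sq_int (\<lambda>x. (conv_op (\<mu> h) ?u x - ?u x) / h - l * (?u x - g x))
       \<le> 2 * ((?b h - l)\<^sup>2 * sq_int (\<lambda>x. ?u x - g x)) + 2 * ((?b h)\<^sup>2 * (2 * energy (mix (early l h)) g))) (at_right 0)"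
      using eventually_at_right_less[of 0]
    proof eventually_elim
      case (elim h)
      interpret E: sym_prob "mix (early l h)" by (rule sym_prob_early[OF l elim])
      have LK: "L2fun (\<lambda>x. ?K h x - g x)" by (rule L2fun_diff[OF E.L2fun_conv_op[OF gL ga] gL])
      have "(conv_op (\<mu> h) ?u x - ?u x) / h - l * (?u x - g x) = (?b h - l) * (?u x - g x) - ?b h * (?K h x - g x)" for x
        unfolding resolvent_identity[OF l elim m ga] using elim by (simp add: field_simps)
      then have "sq_int (\<lambda>x. (conv_op (\<mu> h) ?u x - ?u x) / h - l * (?u x - g x))
        = sq_int (\<lambda>x. (?b h - l) * (?u x - g x) - ?b h * (?K h x - g x))" by simp
      also have "\<dots> \<le> 2 * sq_int (\<lambda>x. (?b h - l) * (?u x - g x)) + 2 * sq_int (\<lambda>x. ?b h * (?K h x - g x))"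
        by (intro sq_int_diff_le L2fun_cmult Lug LK)
      also have "\<dots> = 2 * ((?b h - l)\<^sup>2 * sq_int (\<lambda>x. ?u x - g x)) + 2 * ((?b h)\<^sup>2 * sq_int (\<lambda>x. ?K h x - g x))"
        by (simp only: sq_int_cmult)
      also have "\<dots> \<le> 2 * ((?b h - l)\<^sup>2 * sq_int (\<lambda>x. ?u x - g x)) + 2 * ((?b h)\<^sup>2 * (2 * energy (mix (early l h)) g))"
        using E.sq_int_conv_op_diff_le[OF gL ga] by (intro add_left_mono mult_left_mono) auto
      finally show ?case .
    qed
  qed (use lim in auto)
qed

text \<open>The weight t times the exponential density is, up to the factor l, an Erlang density, whose mass
  concentrates at zero.\<close>

lemma resolvent_energy_lower_bound:
  assumes f: "L2fun f" and c: "0 \<le> c" "c' < c" and ev: "eventually (\<lambda>t. c * t \<le> energy (\<mu> t) f) (at_right 0)"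
  shows "\<exists>l>0. c' < l * energy (resolvent l) f"
proof -
  from ev obtain t0 where t0: "0 < t0" "\<And>t. 0 < t \<Longrightarrow> t < t0 \<Longrightarrow> c * t \<le> energy (\<mu> t) f"
    unfolding eventually_at_right_field by auto
  define s where "s = t0 / 2"
  have s: "0 < s" "\<And>t. 0 < t \<Longrightarrow> t \<le> s \<Longrightarrow> c * t \<le> energy (\<mu> t) f"
    using t0 by (auto simp: s_def)
  \<comment> \<open>The bracket is the mass of [0, s] under the Erlang law of two exponential
    stages, which tends to 1 as l grows; the gap between \<open>c'\<close> and \<open>c\<close>
    absorbs the defect.\<close>
  have "((\<lambda>l. c * (1 - (exp (- (l * s)) + l * s * exp (- (l * s))))) \<longlongrightarrow> c * (1 - (0 + 0))) at_top"
  proof (intro tendsto_intros)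
    have ls: "LIM l at_top. l * s :> at_top"
      using s(1) by (intro filterlim_at_top_mult_tendsto_pos[OF tendsto_const] filterlim_ident)
    have "((\<lambda>y::real. exp (- y)) \<longlongrightarrow> 0) at_top" "((\<lambda>y::real. y * exp (- y)) \<longlongrightarrow> 0) at_top"
      using tendsto_power_div_exp_0[of 0] tendsto_power_div_exp_0[of 1] by (simp_all add: exp_minus field_simps)
    from this[THEN filterlim_compose, OF ls]
    show "((\<lambda>l. exp (- (l * s))) \<longlongrightarrow> 0) at_top" "((\<lambda>l. l * s * exp (- (l * s))) \<longlongrightarrow> 0) at_top" by simp_all
  qed
  then have "eventually (\<lambda>l. c' < c * (1 - (exp (- (l * s)) + l * s * exp (- (l * s))))) at_top"
    by (rule order_tendstoD(1)) (use c in simp)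
  then have "eventually (\<lambda>l. c' < c * (1 - (exp (- (l * s)) + l * s * exp (- (l * s)))) \<and> 0 < l) at_top"
    using eventually_gt_at_top[of 0] by eventually_elim auto
  then obtain l where l: "c' < c * (1 - (exp (- (l * s)) + l * s * exp (- (l * s))))" "0 < l"
    by (auto simp: eventually_at_top_linorder)
  interpret X: prob_space "expo l" by (rule prob_expo[OF l(2)])
  have [measurable]: "f \<in> borel_measurable borel" using f by (simp add: L2fun_def)
  have Y: "emeasure (density lborel (\<lambda>t. ennreal (erlang_density 1 l t))) {..s} = ennreal (1 - (exp (- (l * s)) + l * s * exp (- (l * s))))"
    using s(1) l(2) by (subst emeasure_erlang_density) (auto simp: erlang_CDF_def)
  have "ennreal (c * (1 - (exp (- (l * s)) + l * s * exp (- (l * s))))) = ennreal c * (\<integral>\<^sup>+t. ennreal (erlang_density 1 l t) * indicator {..s} t \<partial>lborel)"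
    using Y c by (simp add: ennreal_mult' emeasure_density)
  also have "\<dots> = (\<integral>\<^sup>+t. ennreal c * (ennreal (erlang_density 1 l t) * indicator {..s} t) \<partial>lborel)"
    by (rule nn_integral_cmult[symmetric]) measurable
  also have "\<dots> \<le> (\<integral>\<^sup>+t. ennreal (exponential_density l t) * ennreal (l * energy (\<mu> t) f) \<partial>lborel)"
    using AE_lborel_singleton[of "0::real"]
  proof (intro nn_integral_mono_AE, eventually_elim)
    case (elim t)
    show ?case
    proof (cases "0 < t \<and> t \<le> s")
      case True
      have "c * erlang_density 1 l t = exponential_density l t * (l * (c * t))"
        using True by (simp add: erlang_density_def power2_eq_square mult.commute)
      also have "\<dots> \<le> exponential_density l t * (l * energy (\<mu> t) f)"
        using s(2)[of t] True l(2) by (intro mult_left_mono) auto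
      finally have "ennreal (c * erlang_density 1 l t) \<le> ennreal (exponential_density l t * (l * energy (\<mu> t) f))"
        by (rule ennreal_leI)
      then show ?thesis using True c l(2) \<mu>.energy_nonneg by (simp add: ennreal_mult)
    next
      case False
      then show ?thesis using elim by (auto simp: erlang_density_def indicator_def)
    qed
  qed
  also have "\<dots> = (\<integral>\<^sup>+t. ennreal (l * energy (\<mu> t) f) \<partial>expo l)"
    unfolding expo_def by (subst nn_integral_density) auto
  also have "\<dots> = ennreal (\<integral>t. l * energy (\<mu> t) f \<partial>expo l)"
    using l(2) \<mu>.energy_nonneg integrable_energy[OF prob_expo[OF l(2)] sets_expo(1) f]
    by (intro nn_integral_eq_integral) auto
  also have "(\<integral>t. l * energy (\<mu> t) f \<partial>expo l) = l * energy (resolvent l) f"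
    unfolding resolvent_def energy_mix[OF prob_expo[OF l(2)] sets_expo(1) f] by simp
  finally have "ennreal (c * (1 - (exp (- (l * s)) + l * s * exp (- (l * s))))) \<le> ennreal (l * energy (resolvent l) f)" .
  moreover interpret R: sym_prob "resolvent l" by (rule sym_prob_resolvent[OF l(2)])
  have "0 \<le> l * energy (resolvent l) f" using R.energy_nonneg[of f] l(2) by simp
  ultimately have "c * (1 - (exp (- (l * s)) + l * s * exp (- (l * s)))) \<le> l * energy (resolvent l) f"
    by (simp add: ennreal_le_iff)
  then show ?thesis using l by (intro exI[of _ l]) auto
qed

end

subsection \<open>Upper bound for the logarithmic functional\<close>

lemma neg_ln_one_plus_le:
  fixes y :: real
  assumes "\<bar>y\<bar> \<le> 1/2"
  shows "- ln (1 + y) \<le> - y + 2 * y\<^sup>2"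
  using abs_ln_one_plus_x_minus_x_bound[OF assms] by linarith

lemma abs_ln_diff_le:
  fixes a b :: real
  assumes "0 < e" "e \<le> a" "e \<le> b"
  shows "\<bar>ln a - ln b\<bar> \<le> \<bar>a - b\<bar> / e"
proof -
  have *: "ln x - ln y \<le> \<bar>x - y\<bar> / e" if "e \<le> x" "e \<le> y" for x y
  proof -
    have p: "0 < x" "0 < y" using that assms by auto
    have "ln x - ln y = ln (x / y)" using p by (simp add: ln_div)
    also have "\<dots> \<le> x / y - 1" using p by (intro ln_le_minus_one) simp
    also have "\<dots> = (x - y) / y" using p by (simp add: field_simps)
    also have "\<dots> \<le> \<bar>x - y\<bar> / y" using p by (intro divide_right_mono) auto
    also have "\<dots> \<le> \<bar>x - y\<bar> / e" using that p assms by (intro divide_left_mono) auto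
    finally show ?thesis .
  qed
  show ?thesis using *[OF assms(2,3)] *[OF assms(3,2)] by (simp add: abs_le_iff abs_minus_commute)
qed

context sym_conv_semigroup
begin

lemma integrable_bounded_weight:
  assumes "L2fun f" "g \<in> borel_measurable borel" "\<And>x. \<bar>g x\<bar> \<le> C"
  shows "integrable lborel (\<lambda>x. g x * (f x)\<^sup>2)"
proof (rule Bochner_Integration.integrable_bound[OF integrable_mult_right[OF L2fun_integrable[OF assms(1)], of C]])
  have [measurable]: "f \<in> borel_measurable borel" using assms by (simp add: L2fun_def)
  show "(\<lambda>x. g x * (f x)\<^sup>2) \<in> borel_measurable lborel" using assms(2) by measurable
  show "AE x in lborel. norm (g x * (f x)\<^sup>2) \<le> norm (C * (f x)\<^sup>2)"
  proof (intro AE_I2)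
    fix x
    have "\<bar>g x\<bar> * (f x)\<^sup>2 \<le> \<bar>C\<bar> * (f x)\<^sup>2"
      using order_trans[OF assms(3) abs_ge_self] by (intro mult_right_mono) auto
    then show "norm (g x * (f x)\<^sup>2) \<le> norm (C * (f x)\<^sup>2)" by (simp add: abs_mult)
  qed
qed

lemma abs_ln_conv_quotient_le:
  assumes "v \<in> borel_measurable borel" "\<And>x. 0 \<le> v x" "\<And>x. v x \<le> C" and \<epsilon>: "0 < \<epsilon>"
  shows "\<bar>ln ((v x + \<epsilon>) / (conv_op (\<mu> h) v x + \<epsilon>))\<bar> \<le> C / \<epsilon>"
proof -
  note T = \<mu>.conv_op_bounds[OF assms(1-3), of h x]
  have "ln ((v x + \<epsilon>) / (conv_op (\<mu> h) v x + \<epsilon>)) = ln (v x + \<epsilon>) - ln (conv_op (\<mu> h) v x + \<epsilon>)"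
    using \<epsilon> assms(2)[of x] T by (simp add: ln_div add_nonneg_pos)
  also have "\<bar>\<dots>\<bar> \<le> \<bar>(v x + \<epsilon>) - (conv_op (\<mu> h) v x + \<epsilon>)\<bar> / \<epsilon>"
    using \<epsilon> assms(2)[of x] T by (intro abs_ln_diff_le) auto
  also have "\<dots> \<le> C / \<epsilon>" using \<epsilon> assms(2,3)[of x] T by (intro divide_right_mono) auto
  finally show ?thesis .
qed

text \<open>Over a step of length d the logarithm is linearised with an error of order d^2, thanks
  to the Lipschitz bound in time, and the linear part is at most E(d). About h / d steps give h E(d)
  / d plus an error that vanishes with d, and d may be taken among the times with E(d) < c
  d.\<close>

lemma phi_resolvent_le:
  assumes f: "L2fun f" and l: "0 < l" and g [measurable]: "g \<in> borel_measurable borel" "\<And>x. 0 \<le> g x" "\<And>x. g x \<le> C"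
    and \<epsilon>: "0 < \<epsilon>" and h: "0 < h"
    and freq: "\<exists>\<^sub>F t in at_right 0. energy (\<mu> t) f < c * t"
  shows "(\<integral>x. ln ((conv_op (resolvent l) g x + \<epsilon>) / (conv_op (\<mu> h) (conv_op (resolvent l) g) x + \<epsilon>)) * (f x)\<^sup>2 \<partial>lborel) \<le> h * c"
proof -
  interpret R: sym_prob "resolvent l" by (rule sym_prob_resolvent[OF l])
  have [measurable]: "f \<in> borel_measurable borel" using f by (simp add: L2fun_def)
  define u where "u = conv_op (resolvent l) g"
  have [measurable]: "u \<in> borel_measurable borel" unfolding u_def by measurable
  have u: "0 \<le> u x" "u x \<le> C" for x using R.conv_op_bounds[OF g] by (auto simp: u_def)
  have ua: "\<bar>u x\<bar> \<le> C" for x using u[of x] by simp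
  have C: "0 \<le> C" using g(2,3)[of 0] by linarith
  define S where "S = sq_int f"
  have S: "0 \<le> S" by (simp add: S_def)
  define W where "W = (\<lambda>s x. conv_op (\<mu> s) u x + \<epsilon>)"
  have Wm [measurable]: "W s \<in> borel_measurable borel" for s unfolding W_def by measurable
  have W: "\<epsilon> \<le> W s x" "W s x \<le> C + \<epsilon>" for s x
    using \<mu>.conv_op_bounds[of u 0 C s x] u by (auto simp: W_def)
  have Wpos: "0 < W s x" for s x using W(1)[of s x] \<epsilon> by linarith
  have Wne: "W s x \<noteq> 0" for s x using Wpos[of s x] by simp
  \<comment> \<open>Constants are invariant under the semigroup, so the shifted weight evolves like
    \<open>u\<close> itself.\<close>
  have TW: "conv_op (\<mu> d) (W s) x = W (s + d) x" if "0 \<le> d" "0 \<le> s" for d s x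
  proof -
    have b: "\<bar>conv_op (\<mu> s) u y\<bar> \<le> C" for y
      using \<mu>.conv_op_bounds[of u 0 C s y] u by simp
    have "conv_op (\<mu> d) (W s) x = conv_op (\<mu> d) (\<lambda>y. conv_op (\<mu> s) u y - (- \<epsilon>)) x" by (simp add: W_def)
    also have "\<dots> = conv_op (\<mu> d) (conv_op (\<mu> s) u) x - (- \<epsilon>)"
      by (subst \<mu>.conv_op_diff[where C=C and D="\<epsilon>"]) (use b \<epsilon> in auto)
    also have "\<dots> = W (s + d) x"
      using conv_op_semigroup[OF that(1,2) _ ua, where x=x] by (simp add: W_def add.commute)
    finally show ?thesis .
  qed
  \<comment> \<open>Bound on the relative change of the weight over a time d: the Lipschitz bound
    divided by the lower bound \<epsilon>. It is of first order in d.\<close>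
  define \<kappa> where "\<kappa> = (\<lambda>d. (exp (l * d) - 1) * C / \<epsilon>)"
  have \<kappa>0: "0 \<le> \<kappa> d" if "0 \<le> d" for d using l C \<epsilon> that by (simp add: \<kappa>_def)
  have ratio: "\<bar>(W (s + r) x - W s x) / W s x\<bar> \<le> \<kappa> r" if r: "0 \<le> r" and s: "0 \<le> s" for r s x
  proof -
    have b: "\<bar>conv_op (\<mu> r) u y\<bar> \<le> C" for y
      using \<mu>.conv_op_bounds[of u 0 C r y] u by simp
    have lip: "\<bar>conv_op (\<mu> r) u y - u y\<bar> \<le> (exp (l * r) - 1) * C" for y
      unfolding u_def by (rule resolvent_lipschitz[OF l r g])
    have "W (s + r) x - W s x = conv_op (\<mu> s) (conv_op (\<mu> r) u) x - conv_op (\<mu> s) u x"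
      using conv_op_semigroup[OF s r _ ua, where x=x] by (simp add: W_def)
    also have "\<dots> = conv_op (\<mu> s) (\<lambda>y. conv_op (\<mu> r) u y - u y) x"
      by (rule \<mu>.conv_op_diff[symmetric, OF _ b _ ua]) measurable
    finally have "\<bar>W (s + r) x - W s x\<bar> \<le> (exp (l * r) - 1) * C"
      using \<mu>.conv_op_bounds[of "\<lambda>y. conv_op (\<mu> r) u y - u y" "- ((exp (l * r) - 1) * C)" "(exp (l * r) - 1) * C" s x] lip
      by (simp add: abs_le_iff minus_le_iff)
    then have "\<bar>W (s + r) x - W s x\<bar> / W s x \<le> ((exp (l * r) - 1) * C) / \<epsilon>"
      using W(1)[of s x] Wpos[of s x] \<epsilon> by (intro frac_le) (auto intro: order_trans)
    then show ?thesis using Wpos[of s x] by (simp add: \<kappa>_def abs_divide)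
  qed
  have quad: "ln (W s x / W (s + r) x) \<le> - ((W (s + r) x - W s x) / W s x) + 2 * (\<kappa> r)\<^sup>2"
    if r: "0 \<le> r" "\<kappa> r \<le> 1/2" and s: "0 \<le> s" for r s x
  proof -
    let ?y = "(W (s + r) x - W s x) / W s x"
    have y: "\<bar>?y\<bar> \<le> \<kappa> r" by (rule ratio[OF r(1) s])
    have "1 + ?y = W (s + r) x / W s x" using Wpos[of s x] by (simp add: field_simps)
    then have "ln (W s x / W (s + r) x) = - ln (1 + ?y)"
      using Wpos[of s x] Wpos[of "s + r" x] by (simp add: ln_div)
    also have "\<dots> \<le> - ?y + 2 * ?y\<^sup>2" using y r(2) by (intro neg_ln_one_plus_le) linarith
    also have "?y\<^sup>2 \<le> (\<kappa> r)\<^sup>2" using power_mono[OF y abs_ge_zero, of 2] by (simp only: power2_abs)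
    finally show ?thesis by simp
  qed
  have lnW: "\<bar>ln (W s x / W t x)\<bar> \<le> (C + \<epsilon>) / \<epsilon>" for s t x
  proof -
    have "\<bar>W s x - W t x\<bar> \<le> C + \<epsilon>" using W[of s x] W[of t x] \<epsilon> by linarith
    then have "\<bar>W s x - W t x\<bar> / \<epsilon> \<le> (C + \<epsilon>) / \<epsilon>" using \<epsilon> by (intro divide_right_mono) auto
    then show ?thesis using abs_ln_diff_le[OF \<epsilon> W(1)[of s x] W(1)[of t x]] Wpos[of s x] Wpos[of t x] by (simp add: ln_div)
  qed
  have i_ln: "integrable lborel (\<lambda>x. ln (W s x / W t x) * (f x)\<^sup>2)" for s t
    by (rule integrable_bounded_weight[OF f _ lnW]) measurable
  define \<Phi> where "\<Phi> = (\<lambda>s t. \<integral>x. ln (W s x / W t x) * (f x)\<^sup>2 \<partial>lborel)"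
  have \<Phi>_add: "\<Phi> s t = \<Phi> s r + \<Phi> r t" for r s t
    unfolding \<Phi>_def Bochner_Integration.integral_add[OF i_ln i_ln, symmetric]
    using Wpos by (intro Bochner_Integration.integral_cong) (simp_all add: ln_div algebra_simps Wne)
  have step: "\<Phi> s (s + d) \<le> energy (\<mu> d) f + 2 * (\<kappa> d)\<^sup>2 * S"
    if d: "0 \<le> d" "\<kappa> d \<le> 1/2" and s: "0 \<le> s" for s d
  proof -
    let ?q = "\<lambda>x. (W s x - conv_op (\<mu> d) (W s) x) / W s x"
    have qb: "\<bar>?q x\<bar> \<le> \<kappa> d" for x
      using ratio[OF d(1) s, of x] by (simp add: TW[OF d(1) s] abs_minus_commute abs_divide)
    have iq: "integrable lborel (\<lambda>x. ?q x * (f x)\<^sup>2)"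
      by (rule integrable_bounded_weight[OF f _ qb]) measurable
    have "\<Phi> s (s + d) \<le> (\<integral>x. ?q x * (f x)\<^sup>2 + 2 * (\<kappa> d)\<^sup>2 * (f x)\<^sup>2 \<partial>lborel)"
      unfolding \<Phi>_def
    proof (intro integral_mono i_ln Bochner_Integration.integrable_add iq integrable_mult_right L2fun_integrable f)
      fix x
      have "?q x = - ((W (s + d) x - W s x) / W s x)"
        unfolding TW[OF d(1) s] minus_divide_left by simp
      then have "ln (W s x / W (s + d) x) \<le> ?q x + 2 * (\<kappa> d)\<^sup>2" using quad[OF d s, of x] by simp
      then have "ln (W s x / W (s + d) x) * (f x)\<^sup>2 \<le> (?q x + 2 * (\<kappa> d)\<^sup>2) * (f x)\<^sup>2" by (intro mult_right_mono) auto
      then show "ln (W s x / W (s + d) x) * (f x)\<^sup>2 \<le> ?q x * (f x)\<^sup>2 + 2 * (\<kappa> d)\<^sup>2 * (f x)\<^sup>2"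
        by (simp only: distrib_right)
    qed
    also have "\<dots> = (\<integral>x. ?q x * (f x)\<^sup>2 \<partial>lborel) + 2 * (\<kappa> d)\<^sup>2 * S"
      using iq L2fun_integrable[OF f] by (simp add: S_def sq_int_def)
    also have "(\<integral>x. ?q x * (f x)\<^sup>2 \<partial>lborel) \<le> energy (\<mu> d) f"
      by (rule \<mu>.quotient_le_energy[OF f Wm \<epsilon> W])
    finally show ?thesis by simp
  qed
  \<comment> \<open>The last, incomplete step has a length at which the energy is not controlled by
    \<open>c\<close>; it is bounded crudely at first order, a cost paid only once.\<close>
  have rest: "\<Phi> s (s + r) \<le> 2 * \<kappa> r * S" if r: "0 \<le> r" "\<kappa> r \<le> 1/2" and s: "0 \<le> s" for s r
  proof -
    have "\<Phi> s (s + r) \<le> (\<integral>x. 2 * \<kappa> r * (f x)\<^sup>2 \<partial>lborel)"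
      unfolding \<Phi>_def
    proof (intro integral_mono i_ln integrable_mult_right L2fun_integrable f mult_right_mono)
      fix x
      have "(\<kappa> r)\<^sup>2 \<le> 1/2 * \<kappa> r" unfolding power2_eq_square using \<kappa>0[OF r(1)] r(2) by (intro mult_right_mono) auto
      moreover have "- ((W (s + r) x - W s x) / W s x) \<le> \<kappa> r"
        using abs_le_D2[OF ratio[OF r(1) s, of x]] .
      ultimately show "ln (W s x / W (s + r) x) \<le> 2 * \<kappa> r" using quad[OF r s, of x] by linarith
    qed simp
    then show ?thesis by (simp add: S_def sq_int_def)
  qed
  have steps: "\<Phi> 0 (real m * d) \<le> real m * (energy (\<mu> d) f + 2 * (\<kappa> d)\<^sup>2 * S)"
    if d: "0 \<le> d" "\<kappa> d \<le> 1/2" for m d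
  proof (induction m)
    case 0
    show ?case by (simp add: \<Phi>_def Wne)
  next
    case (Suc m)
    have "\<Phi> 0 (real (Suc m) * d) = \<Phi> 0 (real m * d) + \<Phi> (real m * d) (real m * d + d)"
      using \<Phi>_add[of 0 "real m * d + d" "real m * d"] by (simp add: algebra_simps)
    then show ?case using Suc step[OF d, of "real m * d"] d by (simp add: algebra_simps)
  qed
  have total: "\<Phi> 0 h \<le> h * (energy (\<mu> d) f / d) + (h * (2 * (\<kappa> d * (\<kappa> d / d)) * S) + 2 * \<kappa> d * S)"
    if d: "0 < d" "\<kappa> d \<le> 1/2" for d
  proof -
    \<comment> \<open>The frequency hypothesis dictates d, so d need not divide h and a remainder r
      < d is left over.\<close>
    define m where "m = nat \<lfloor>h / d\<rfloor>"
    define r where "r = h - real m * d"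
    have "real m = of_int \<lfloor>h / d\<rfloor>" using h d by (simp add: m_def)
    then have "real m \<le> h / d" "h / d < real m + 1" by linarith+
    then have md: "real m * d \<le> h" "h < real m * d + d" "real m \<le> h / d" using d(1) by (simp_all add: field_simps)
    then have r: "0 \<le> r" "r < d" by (simp_all add: r_def)
    have \<kappa>r: "\<kappa> r \<le> \<kappa> d"
      unfolding \<kappa>_def using r l C \<epsilon> by (intro divide_right_mono mult_right_mono) auto
    have "\<Phi> 0 h = \<Phi> 0 (real m * d) + \<Phi> (real m * d) (real m * d + r)"
      using \<Phi>_add[of 0 h "real m * d"] by (simp add: r_def)
    also have "\<dots> \<le> real m * (energy (\<mu> d) f + 2 * (\<kappa> d)\<^sup>2 * S) + 2 * \<kappa> r * S"
      using steps[of d m] rest[of r "real m * d"] d r \<kappa>r by (intro add_mono) auto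
    also have "\<dots> \<le> (h / d) * (energy (\<mu> d) f + 2 * (\<kappa> d)\<^sup>2 * S) + 2 * \<kappa> d * S"
      using md(3) \<mu>.energy_nonneg[of d f] S \<kappa>r by (intro add_mono mult_right_mono) auto
    also have "\<dots> = h * (energy (\<mu> d) f / d) + (h * (2 * (\<kappa> d * (\<kappa> d / d)) * S) + 2 * \<kappa> d * S)"
      using d(1) by (simp add: field_simps power2_eq_square)
    finally show ?thesis .
  qed
  have \<kappa>l: "((\<lambda>d. \<kappa> d / d) \<longlongrightarrow> l * C / \<epsilon>) (at_right 0)"
  proof -
    have "((\<lambda>h. (exp (l * h) - 1) / h * C / \<epsilon>) \<longlongrightarrow> l * C / \<epsilon>) (at_right 0)"
      using \<epsilon> by (intro tendsto_intros exp_quotient_tendsto) auto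
    then show ?thesis by (simp add: \<kappa>_def field_simps)
  qed
  have \<kappa>z: "(\<kappa> \<longlongrightarrow> 0) (at_right 0)"
  proof -
    have "(\<kappa> \<longlongrightarrow> (exp (l * 0) - 1) * C / \<epsilon>) (at_right 0)"
      unfolding \<kappa>_def using \<epsilon> by (intro tendsto_intros) auto
    then show ?thesis by simp
  qed
  have "((\<lambda>d. h * (2 * (\<kappa> d * (\<kappa> d / d)) * S) + 2 * \<kappa> d * S) \<longlongrightarrow> h * (2 * (0 * (l * C / \<epsilon>)) * S) + 2 * 0 * S) (at_right 0)"
    by (intro tendsto_intros \<kappa>l \<kappa>z)
  then have small: "((\<lambda>d. h * (2 * (\<kappa> d * (\<kappa> d / d)) * S) + 2 * \<kappa> d * S) \<longlongrightarrow> 0) (at_right 0)" by simp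
  have "\<Phi> 0 h \<le> h * c"
  proof (rule field_le_epsilon)
    fix e :: real assume e: "0 < e"
    have "eventually (\<lambda>d. 0 < d \<and> \<kappa> d < 1/2 \<and> h * (2 * (\<kappa> d * (\<kappa> d / d)) * S) + 2 * \<kappa> d * S < e) (at_right 0)"
      by (intro eventually_conj eventually_at_right_less order_tendstoD(2)[OF \<kappa>z] order_tendstoD(2)[OF small] e) simp
    from frequently_ex[OF frequently_eventually_conj[OF freq this]]
    obtain d where d: "energy (\<mu> d) f < c * d" "0 < d" "\<kappa> d < 1/2" "h * (2 * (\<kappa> d * (\<kappa> d / d)) * S) + 2 * \<kappa> d * S < e"
      by blast
    have "energy (\<mu> d) f / d \<le> c" using d(1,2) by (simp add: divide_le_eq)
    then have "h * (energy (\<mu> d) f / d) \<le> h * c" using h by (intro mult_left_mono) auto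
    then show "\<Phi> 0 h \<le> h * c + e" using total[OF d(2)] d(3,4) by linarith
  qed
  then show ?thesis by (simp add: \<Phi>_def W_def u_def)
qed

text \<open>As l grows, the logarithms for \<open>g\<close> and for its smoothed version differ by a
  family that is uniformly bounded and vanishes in L2. This suffices against the density f^2, which
  is only integrable.\<close>

lemma phi_bounded_le:
  assumes f: "L2fun f" and gL: "L2fun g" and g: "\<And>x. 0 \<le> g x" "\<And>x. g x \<le> C"
    and \<epsilon>: "0 < \<epsilon>" and h: "0 < h"
    and freq: "\<exists>\<^sub>F t in at_right 0. energy (\<mu> t) f < c * t"
  shows "(\<integral>x. ln ((g x + \<epsilon>) / (conv_op (\<mu> h) g x + \<epsilon>)) * (f x)\<^sup>2 \<partial>lborel) \<le> h * c"
proof -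
  have gm [measurable]: "g \<in> borel_measurable borel" using gL by (simp add: L2fun_def)
  have [measurable]: "f \<in> borel_measurable borel" using f by (simp add: L2fun_def)
  have ga: "\<bar>g x\<bar> \<le> C" for x using g[of x] by simp
  let ?u = "\<lambda>l. conv_op (resolvent l) g"
  let ?L = "\<lambda>v x. ln ((v x + \<epsilon>) / (conv_op (\<mu> h) v x + \<epsilon>))"
  define D where "D = (\<lambda>l x. ?L (?u l) x - ?L g x)"
  \<comment> \<open>The logarithm is Lipschitz with constant 1/\<epsilon> on both weights. The 8 is
    4 from squaring a sum of two terms of comparable L2 size, times 2 from comparing smoothing with
    energy.\<close>
  have props: "L2fun (D l) \<and> (\<forall>x. \<bar>D l x\<bar> \<le> 2 * C / \<epsilon>) \<and> sq_int (D l) \<le> 8 / \<epsilon>\<^sup>2 * energy (resolvent l) g" if l: "0 < l" for l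
  proof -
    interpret R: sym_prob "resolvent l" by (rule sym_prob_resolvent[OF l])
    have u: "0 \<le> ?u l x" "?u l x \<le> C" for x using R.conv_op_bounds[OF gm g] by auto
    have um [measurable]: "?u l \<in> borel_measurable borel" by measurable
    have ua: "\<bar>?u l x\<bar> \<le> C" for x using u[of x] by simp
    define v where "v = (\<lambda>x. ?u l x - g x)"
    have vL: "L2fun v" unfolding v_def by (rule L2fun_diff[OF R.L2fun_conv_op[OF gL ga] gL])
    have va: "\<bar>v x\<bar> \<le> C" for x using u[of x] g[of x] by (simp add: v_def abs_le_iff)
    have [measurable]: "v \<in> borel_measurable borel" unfolding v_def by measurable
    have Tv: "conv_op (\<mu> h) v x = conv_op (\<mu> h) (?u l) x - conv_op (\<mu> h) g x" for x
      unfolding v_def by (rule \<mu>.conv_op_diff[OF um ua gm ga])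
    note Tb = \<mu>.conv_op_bounds(1)[OF um u] \<mu>.conv_op_bounds(1)[OF gm g]
    define B where "B = (\<lambda>x. 1 / \<epsilon> * (\<bar>v x\<bar> + \<bar>conv_op (\<mu> h) v x\<bar>))"
    have abs: "L2fun (\<lambda>x. \<bar>w x\<bar>)" if "L2fun w" for w :: "real^'n \<Rightarrow> real"
      using that by (auto simp: L2fun_def)
    have BL: "L2fun B" unfolding B_def by (intro L2fun_cmult L2fun_add abs vL \<mu>.L2fun_conv_op[OF vL va])
    have le: "\<bar>D l x\<bar> \<le> B x" for x
    proof -
      have eq: "D l x = (ln (?u l x + \<epsilon>) - ln (g x + \<epsilon>)) - (ln (conv_op (\<mu> h) (?u l) x + \<epsilon>) - ln (conv_op (\<mu> h) g x + \<epsilon>))"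
        unfolding D_def using \<epsilon> u(1)[of x] g(1)[of x] Tb[of h x]
        by (simp add: ln_div add_nonneg_pos)
      have "\<bar>ln (?u l x + \<epsilon>) - ln (g x + \<epsilon>)\<bar> \<le> \<bar>(?u l x + \<epsilon>) - (g x + \<epsilon>)\<bar> / \<epsilon>"
        using \<epsilon> u(1)[of x] g(1)[of x] by (intro abs_ln_diff_le) auto
      moreover have "\<bar>ln (conv_op (\<mu> h) (?u l) x + \<epsilon>) - ln (conv_op (\<mu> h) g x + \<epsilon>)\<bar> \<le> \<bar>(conv_op (\<mu> h) (?u l) x + \<epsilon>) - (conv_op (\<mu> h) g x + \<epsilon>)\<bar> / \<epsilon>"
        using \<epsilon> Tb[of h x] by (intro abs_ln_diff_le) auto
      ultimately show ?thesis unfolding eq B_def Tv by (simp add: v_def add_divide_distrib)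
    qed
    have DL: "L2fun (D l)"
    proof (rule L2fun_bound[OF BL])
      show "D l \<in> borel_measurable borel" unfolding D_def by measurable
      show "\<bar>D l x\<bar> \<le> \<bar>B x\<bar>" for x using le[of x] by simp
    qed
    moreover have "\<bar>D l x\<bar> \<le> 2 * C / \<epsilon>" for x
    proof -
      have "\<bar>conv_op (\<mu> h) v x\<bar> \<le> C"
        using \<mu>.conv_op_bounds[of v "-C" C h x] va by (simp add: abs_le_iff minus_le_iff)
      then have "B x \<le> 1 / \<epsilon> * (C + C)" unfolding B_def using \<epsilon> va[of x] by (intro mult_left_mono add_mono) auto
      then show ?thesis using le[of x] by simp
    qed
    moreover have "sq_int (D l) \<le> 8 / \<epsilon>\<^sup>2 * energy (resolvent l) g"
    proof -
      have "sq_int (D l) \<le> sq_int B"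
        unfolding sq_int_def using le
        by (intro integral_mono L2fun_integrable DL BL) (metis abs_ge_zero abs_le_square_iff abs_of_nonneg order_trans)
      also have "\<dots> = (1 / \<epsilon>)\<^sup>2 * sq_int (\<lambda>x. \<bar>v x\<bar> + \<bar>conv_op (\<mu> h) v x\<bar>)"
        unfolding B_def by (rule sq_int_cmult)
      also have "\<dots> \<le> (1 / \<epsilon>)\<^sup>2 * (2 * sq_int (\<lambda>x. \<bar>v x\<bar>) + 2 * sq_int (\<lambda>x. \<bar>conv_op (\<mu> h) v x\<bar>))"
        by (intro mult_left_mono sq_int_add_le abs vL \<mu>.L2fun_conv_op[OF vL va]) auto
      also have "\<dots> \<le> (1 / \<epsilon>)\<^sup>2 * (4 * sq_int v)"
        using \<mu>.sq_int_conv_op_le[OF vL va, of h] by (intro mult_left_mono) (auto simp: sq_int_def)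
      also have "\<dots> \<le> (1 / \<epsilon>)\<^sup>2 * (4 * (2 * energy (resolvent l) g))"
        using R.sq_int_conv_op_diff_le[OF gL ga] unfolding v_def by (intro mult_left_mono) auto
      finally show ?thesis by (simp add: power_divide)
    qed
    ultimately show ?thesis by auto
  qed
  have "((\<lambda>l. \<integral>x. D l x * (f x)\<^sup>2 \<partial>lborel) \<longlongrightarrow> 0) at_top"
  proof (rule bounded_L2_tendsto_integral[where C="2 * C / \<epsilon>"])
    show "eventually (\<lambda>l. L2fun (D l) \<and> (\<forall>x. \<bar>D l x\<bar> \<le> 2 * C / \<epsilon>)) at_top"
      using eventually_gt_at_top[of 0] by eventually_elim (use props in auto)
    have "((\<lambda>l. 8 / \<epsilon>\<^sup>2 * energy (resolvent l) g) \<longlongrightarrow> 8 / \<epsilon>\<^sup>2 * 0) at_top"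
      by (intro tendsto_intros energy_resolvent_tendsto gL g)
    then have lim: "((\<lambda>l. 8 / \<epsilon>\<^sup>2 * energy (resolvent l) g) \<longlongrightarrow> 0) at_top" by simp
    show "((\<lambda>l. sq_int (D l)) \<longlongrightarrow> 0) at_top"
    proof (rule tendsto_sandwich[OF _ _ tendsto_const lim])
      show "eventually (\<lambda>l. sq_int (D l) \<le> 8 / \<epsilon>\<^sup>2 * energy (resolvent l) g) at_top"
        using eventually_gt_at_top[of 0] by eventually_elim (use props in auto)
    qed simp
  qed (use f in \<open>auto simp: L2fun_def\<close>)
  then have lim: "((\<lambda>l. h * c - (\<integral>x. D l x * (f x)\<^sup>2 \<partial>lborel)) \<longlongrightarrow> h * c - 0) at_top"
    by (intro tendsto_intros)
  have "(\<integral>x. ?L g x * (f x)\<^sup>2 \<partial>lborel) \<le> h * c - 0"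
  proof (rule tendsto_lowerbound[OF lim])
    show "eventually (\<lambda>l. (\<integral>x. ?L g x * (f x)\<^sup>2 \<partial>lborel) \<le> h * c - (\<integral>x. D l x * (f x)\<^sup>2 \<partial>lborel)) at_top"
      using eventually_gt_at_top[of 0]
    proof eventually_elim
      case (elim l)
      interpret R: sym_prob "resolvent l" by (rule sym_prob_resolvent[OF elim])
      have um: "?u l \<in> borel_measurable borel" by measurable
      have u: "0 \<le> ?u l x" "?u l x \<le> C" for x using R.conv_op_bounds[OF gm g] by auto
      have i1: "integrable lborel (\<lambda>x. ?L (?u l) x * (f x)\<^sup>2)"
        by (rule integrable_bounded_weight[OF f _ abs_ln_conv_quotient_le[OF um u \<epsilon>]]) measurable
      have i2: "integrable lborel (\<lambda>x. ?L g x * (f x)\<^sup>2)"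
        by (rule integrable_bounded_weight[OF f _ abs_ln_conv_quotient_le[OF gm g \<epsilon>]]) measurable
      have "(\<integral>x. D l x * (f x)\<^sup>2 \<partial>lborel) = (\<integral>x. ?L (?u l) x * (f x)\<^sup>2 \<partial>lborel) - (\<integral>x. ?L g x * (f x)\<^sup>2 \<partial>lborel)"
        unfolding D_def Bochner_Integration.integral_diff[OF i1 i2, symmetric] by (simp add: left_diff_distrib)
      then show ?case using phi_resolvent_le[OF f elim gm g \<epsilon> h freq] by simp
    qed
  qed simp
  then show ?thesis by simp
qed

text \<open>Truncation of an unbounded \<open>g\<close> is removed by Fatou, for which the
  integrands must be bounded below by an integrable function; minus the absolute value of the limit
  integrand serves.\<close>

lemma phi_le:
  assumes f: "L2fun f" and gL: "L2fun g" and g: "\<And>x. 0 \<le> g x"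
    and \<epsilon>: "0 < \<epsilon>" and h: "0 < h" and c: "0 \<le> c"
    and freq: "\<exists>\<^sub>F t in at_right 0. energy (\<mu> t) f < c * t"
  shows "(\<integral>x. ln ((g x + \<epsilon>) / (conv_op (\<mu> h) g x + \<epsilon>)) * (f x)\<^sup>2 \<partial>lborel) \<le> h * c"
proof (cases "integrable lborel (\<lambda>x. ln ((g x + \<epsilon>) / (conv_op (\<mu> h) g x + \<epsilon>)) * (f x)\<^sup>2)")
  \<comment> \<open>The integral has the default value 0, which is below h c since c is
    nonnegative.\<close>
  case False
  then show ?thesis using h c by (simp add: not_integrable_integral_eq)
next
  case int: True
  have gm [measurable]: "g \<in> borel_measurable borel" using gL by (simp add: L2fun_def)
  have [measurable]: "f \<in> borel_measurable borel" using f by (simp add: L2fun_def)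
  interpret P: pair_sigma_finite "lborel :: (real^'n) measure" "\<mu> h" ..
  define G where "G = (\<lambda>n::nat. \<lambda>x. min (g x) (real n))"
  have Gm [measurable]: "G n \<in> borel_measurable borel" for n unfolding G_def by measurable
  have G: "0 \<le> G n x" "G n x \<le> real n" "G n x \<le> g x" for n x using g[of x] by (auto simp: G_def)
  have GL: "L2fun (G n)" for n by (rule L2fun_bound[OF gL Gm]) (use G g in auto)
  have Glim: "(\<lambda>n. G n x) \<longlonglongrightarrow> g x" for x
  proof (rule tendsto_eventually)
    obtain k0 :: nat where "g x \<le> real k0" using real_arch_simple by blast
    then show "eventually (\<lambda>k. G k x = g x) sequentially"
      unfolding eventually_sequentially G_def by (intro exI[of _ k0]) auto
  qed
  define Z where "Z = (\<lambda>x. ln ((g x + \<epsilon>) / (conv_op (\<mu> h) g x + \<epsilon>)) * (f x)\<^sup>2)"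
  define Zn where "Zn = (\<lambda>n x. ln ((G n x + \<epsilon>) / (conv_op (\<mu> h) (G n) x + \<epsilon>)) * (f x)\<^sup>2)"
  have [measurable]: "Z \<in> borel_measurable borel" "Zn n \<in> borel_measurable borel" for n
    unfolding Z_def Zn_def by measurable
  have iZ: "integrable lborel Z" using int by (simp add: Z_def)
  \<comment> \<open>By Fubini the translates of g^2, hence of g, are integrable at almost every x;
    there \<open>conv_op\<close> of \<open>g\<close> is a genuine average and the limit of the
    truncated ones.\<close>
  have "AE x in lborel. integrable (\<mu> h) (\<lambda>z. (g (x + z))\<^sup>2)"
    using P.AE_integrable_fst'[OF \<mu>.integrable_product_sum[OF L2fun_integrable[OF gL]]] by simp
  then have "AE x in lborel. integrable (\<mu> h) (\<lambda>z. g (x + z))"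
  proof eventually_elim
    case (elim x)
    show ?case
    proof (rule Bochner_Integration.integrable_bound)
      show "integrable (\<mu> h) (\<lambda>z. 1 + (g (x + z))\<^sup>2)" using elim by simp
      have "\<bar>a\<bar> \<le> 1 + a\<^sup>2" for a :: real
        using sum_squares_bound[of 1 "\<bar>a\<bar>"] abs_ge_zero[of a] by simp
      then show "AE z in \<mu> h. norm (g (x + z)) \<le> norm (1 + (g (x + z))\<^sup>2)"
        by (intro AE_I2) (simp add: abs_of_nonneg)
    qed measurable
  qed
  then have AE: "AE x in lborel. (\<lambda>n. Zn n x) \<longlonglongrightarrow> Z x \<and> (\<forall>n. - \<bar>Z x\<bar> \<le> Zn n x)"
  proof eventually_elim
    case (elim x)
    have T0: "0 \<le> conv_op (\<mu> h) (G n) x" "conv_op (\<mu> h) (G n) x \<le> real n" for n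
      using \<mu>.conv_op_bounds[OF Gm G(1,2)] by auto
    have Tg: "0 \<le> conv_op (\<mu> h) g x" unfolding conv_op_def by (intro integral_nonneg_AE AE_I2 g)
    have Tle: "conv_op (\<mu> h) (G n) x \<le> conv_op (\<mu> h) g x" for n
      unfolding conv_op_def
      by (intro integral_mono elim \<mu>.integrable_translate_bounded[where C="real n"]) (use G in auto)
    have Tlim: "(\<lambda>n. conv_op (\<mu> h) (G n) x) \<longlonglongrightarrow> conv_op (\<mu> h) g x"
      unfolding conv_op_def
      by (rule integral_dominated_convergence[where w="\<lambda>z. g (x + z)"]) (use G g Glim elim in auto)
    have "(\<lambda>n. Zn n x) \<longlonglongrightarrow> Z x"
      unfolding Zn_def Z_def using \<epsilon> Tg g[of x]
      by (intro tendsto_intros Glim Tlim) (auto simp: add_nonneg_pos less_imp_neq[symmetric] add_pos_nonneg intro!: less_imp_neq[symmetric] divide_pos_pos)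
    moreover have "- \<bar>Z x\<bar> \<le> Zn n x" for n
    \<comment> \<open>If g(x) is not cut, truncation only lowers the denominator and the logarithm
      grows. If it is cut, the numerator is maximal and the logarithm is nonnegative.\<close>
    proof (cases "g x \<le> real n")
      case True
      then have "G n x = g x" by (simp add: G_def)
      moreover have "(g x + \<epsilon>) / (conv_op (\<mu> h) g x + \<epsilon>) \<le> (g x + \<epsilon>) / (conv_op (\<mu> h) (G n) x + \<epsilon>)"
        using Tle[of n] T0[of n] g[of x] \<epsilon> by (intro divide_left_mono) (auto intro!: mult_pos_pos add_nonneg_pos Tg)
      moreover have "0 < (g x + \<epsilon>) / (conv_op (\<mu> h) g x + \<epsilon>)"
        using Tg g[of x] \<epsilon> by (auto intro!: divide_pos_pos add_nonneg_pos)
      ultimately have "Z x \<le> Zn n x"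
        unfolding Z_def Zn_def by (intro mult_right_mono) auto
      then show ?thesis by linarith
    next
      case False
      then have "G n x = real n" by (simp add: G_def)
      then have "1 \<le> (G n x + \<epsilon>) / (conv_op (\<mu> h) (G n) x + \<epsilon>)"
        using T0[of n] \<epsilon> by (simp add: le_divide_eq)
      then have "0 \<le> Zn n x" unfolding Zn_def by (intro mult_nonneg_nonneg ln_ge_zero) auto
      then show ?thesis by linarith
    qed
    ultimately show ?case by blast
  qed
  have iZn: "integrable lborel (Zn n)" for n
    unfolding Zn_def by (rule integrable_bounded_weight[OF f _ abs_ln_conv_quotient_le[OF Gm G(1,2) \<epsilon>]]) measurable
  have bZn: "(\<integral>x. Zn n x \<partial>lborel) \<le> h * c" for n
    unfolding Zn_def by (rule phi_bounded_le[OF f GL G(1,2) \<epsilon> h freq])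
  let ?I = "\<integral>x. \<bar>Z x\<bar> \<partial>lborel"
  have I0: "0 \<le> ?I" by (intro integral_nonneg_AE) auto
  have "ennreal ((\<integral>x. Z x \<partial>lborel) + ?I) = (\<integral>\<^sup>+x. ennreal (Z x + \<bar>Z x\<bar>) \<partial>lborel)"
    using iZ by (subst nn_integral_eq_integral) auto
  also have "\<dots> = (\<integral>\<^sup>+x. liminf (\<lambda>n. ennreal (Zn n x + \<bar>Z x\<bar>)) \<partial>lborel)"
    using AE
  proof (intro nn_integral_cong_AE, eventually_elim)
    case (elim x)
    then have "(\<lambda>n. ennreal (Zn n x + \<bar>Z x\<bar>)) \<longlonglongrightarrow> ennreal (Z x + \<bar>Z x\<bar>)"
      by (intro tendsto_intros) auto
    then show ?case by (simp add: lim_imp_Liminf)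
  qed
  also have "\<dots> \<le> liminf (\<lambda>n. \<integral>\<^sup>+x. ennreal (Zn n x + \<bar>Z x\<bar>) \<partial>lborel)"
    by (rule nn_integral_liminf) measurable
  also have "\<dots> \<le> ennreal (h * c + ?I)"
  proof (rule Liminf_le, simp)
    have "(\<integral>\<^sup>+x. ennreal (Zn n x + \<bar>Z x\<bar>) \<partial>lborel) \<le> ennreal (h * c + ?I)" for n
    proof -
      have "AE x in lborel. 0 \<le> Zn n x + \<bar>Z x\<bar>" using AE
      proof eventually_elim
        case (elim x)
        then have "- \<bar>Z x\<bar> \<le> Zn n x" by blast
        then show ?case by linarith
      qed
      then have "(\<integral>\<^sup>+x. ennreal (Zn n x + \<bar>Z x\<bar>) \<partial>lborel) = ennreal ((\<integral>x. Zn n x \<partial>lborel) + ?I)"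
        using iZ iZn[of n] by (subst nn_integral_eq_integral) auto
      then show ?thesis using bZn[of n] by (simp add: ennreal_leI)
    qed
    then show "eventually (\<lambda>n. (\<integral>\<^sup>+x. ennreal (Zn n x + \<bar>Z x\<bar>) \<partial>lborel) \<le> ennreal (h * c + ?I)) sequentially"
      by simp
  qed
  finally have "(\<integral>x. Z x \<partial>lborel) + ?I \<le> h * c + ?I"
    using I0 c h by (subst (asm) ennreal_le_iff) auto
  then show ?thesis by (simp add: Z_def)
qed

end

subsection \<open>The Fisher functional\<close>

context sym_conv_semigroup
begin

text \<open>The L2 limit defining the generator is paired with
  \<open>(min f n)\<^sup>2 / (u + \<epsilon>)\<close>, which lies in L2. At the small times singled
  out by \<open>freq\<close> the difference quotient is bounded by the energy, and truncation is
  removed at the end.\<close>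

lemma fisher_le:
  assumes f: "L2fun f" "\<And>x. 0 \<le> f x" and uL: "L2fun u" and u: "\<And>x. 0 \<le> u x" "\<And>x. u x \<le> C"
    and aL: "L2fun a" and gen: "((\<lambda>h. sq_int (\<lambda>x. (conv_op (\<mu> h) u x - u x) / h - a x)) \<longlongrightarrow> 0) (at_right 0)"
    and \<epsilon>: "0 < \<epsilon>" and c: "0 \<le> c" and freq: "\<exists>\<^sub>F t in at_right 0. energy (\<mu> t) f < c * t"
  shows "(\<integral>x. - a x / (u x + \<epsilon>) * (f x)\<^sup>2 \<partial>lborel) \<le> c"
proof (cases "integrable lborel (\<lambda>x. - a x / (u x + \<epsilon>) * (f x)\<^sup>2)")
  case False
  then show ?thesis using c by (simp add: not_integrable_integral_eq)
next
  case int: True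
  have [measurable]: "f \<in> borel_measurable borel" "u \<in> borel_measurable borel" "a \<in> borel_measurable borel"
    using f uL aL by (auto simp: L2fun_def)
  have ua: "\<bar>u x\<bar> \<le> C" for x using u[of x] by simp
  have w: "\<epsilon> \<le> u x + \<epsilon>" "u x + \<epsilon> \<le> C + \<epsilon>" "0 < u x + \<epsilon>" for x using u[of x] \<epsilon> by auto
  define F where "F = (\<lambda>n::nat. \<lambda>x. min (f x) (real n))"
  have [measurable]: "F n \<in> borel_measurable borel" for n unfolding F_def by measurable
  have F: "0 \<le> F n x" "F n x \<le> real n" "F n x \<le> f x" for n x using f(2)[of x] by (auto simp: F_def)
  have FL: "L2fun (F n)" for n by (rule L2fun_bound[OF f(1)]) (use F f in auto)
  define q where "q = (\<lambda>n x. (F n x)\<^sup>2 / (u x + \<epsilon>))"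
  have qL: "L2fun (q n)" for n
  proof (rule L2fun_bound[OF L2fun_cmult[OF FL, of "real n / \<epsilon>"]])
    show "q n \<in> borel_measurable borel" unfolding q_def by measurable
    fix x
    have "q n x \<le> (real n * F n x) / \<epsilon>"
      unfolding q_def power2_eq_square using F[of n x] w[of x] \<epsilon> by (intro frac_le mult_right_mono) auto
    moreover have "0 \<le> q n x" unfolding q_def using w(3)[of x] by simp
    ultimately show "\<bar>q n x\<bar> \<le> \<bar>real n / \<epsilon> * F n x\<bar>"
      unfolding times_divide_eq_left by linarith
  qed
  define v where "v = (\<lambda>h x. (conv_op (\<mu> h) u x - u x) / h - a x)"
  have TL: "L2fun (\<lambda>x. (conv_op (\<mu> h) u x - u x) / h)" for h
    using L2fun_cmult[OF L2fun_diff[OF \<mu>.L2fun_conv_op[OF uL ua] uL], of "1/h"] by simp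
  have vL: "L2fun (v h)" for h unfolding v_def by (rule L2fun_diff[OF TL aL])
  have qle: "(\<integral>x. - a x * q n x \<partial>lborel) \<le> c" for n
  proof (rule field_le_epsilon)
    fix e :: real assume e: "0 < e"
    have "((\<lambda>h. sq_int (v h)) \<longlongrightarrow> 0) (at_right 0)" using gen by (simp add: v_def)
    then have "((\<lambda>h. \<integral>x. v h x * q n x \<partial>lborel) \<longlongrightarrow> 0) (at_right 0)"
      by (intro L2_tendsto_integral always_eventually allI vL qL)
    then have "eventually (\<lambda>h. (\<integral>x. v h x * q n x \<partial>lborel) < e) (at_right 0)"
      by (rule order_tendstoD(2)) (rule e)
    then have "eventually (\<lambda>h. (\<integral>x. v h x * q n x \<partial>lborel) < e \<and> 0 < h) (at_right 0)"
      by (intro eventually_conj eventually_at_right_less)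
    \<comment> \<open>A single time h is picked at which the energy is below c h and the generator
      error is below e.\<close>
    from frequently_ex[OF frequently_eventually_conj[OF freq this]]
    obtain h where h: "energy (\<mu> h) f < c * h" "(\<integral>x. v h x * q n x \<partial>lborel) < e" "0 < h"
      by blast
    have "conv_op (\<mu> h) (\<lambda>x. u x + \<epsilon>) x = conv_op (\<mu> h) (\<lambda>x. u x - (- \<epsilon>)) x" for x by simp
    also have "conv_op (\<mu> h) (\<lambda>x. u x - (- \<epsilon>)) x = conv_op (\<mu> h) u x + \<epsilon>" for x
      by (subst \<mu>.conv_op_diff[where C=C and D=\<epsilon>]) (use ua \<epsilon> in auto)
    finally have Tw: "conv_op (\<mu> h) (\<lambda>x. u x + \<epsilon>) x = conv_op (\<mu> h) u x + \<epsilon>" for x .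
    have i1: "integrable lborel (\<lambda>x. v h x * q n x)" by (rule L2fun_mult_integrable[OF vL qL])
    have i2: "integrable lborel (\<lambda>x. (conv_op (\<mu> h) u x - u x) / h * q n x)" by (rule L2fun_mult_integrable[OF TL qL])
    have "(\<integral>x. - a x * q n x \<partial>lborel) = (\<integral>x. v h x * q n x - (conv_op (\<mu> h) u x - u x) / h * q n x \<partial>lborel)"
      by (intro Bochner_Integration.integral_cong) (auto simp: v_def algebra_simps)
    also have "\<dots> = (\<integral>x. v h x * q n x \<partial>lborel) - (\<integral>x. (conv_op (\<mu> h) u x - u x) / h * q n x \<partial>lborel)"
      by (rule Bochner_Integration.integral_diff[OF i1 i2])
    also have "(\<integral>x. (conv_op (\<mu> h) u x - u x) / h * q n x \<partial>lborel)
       = - (\<integral>x. ((u x + \<epsilon>) - conv_op (\<mu> h) (\<lambda>x. u x + \<epsilon>) x) / (u x + \<epsilon>) * (F n x)\<^sup>2 \<partial>lborel) / h"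
      unfolding Tw integral_minus[symmetric] integral_divide_zero[symmetric]
      by (intro Bochner_Integration.integral_cong refl) (simp add: q_def minus_divide_left[symmetric] divide_simps, simp add: algebra_simps)
    also have "(\<integral>x. v h x * q n x \<partial>lborel) - - (\<integral>x. ((u x + \<epsilon>) - conv_op (\<mu> h) (\<lambda>x. u x + \<epsilon>) x) / (u x + \<epsilon>) * (F n x)\<^sup>2 \<partial>lborel) / h
        \<le> e + energy (\<mu> h) (F n) / h"
      using \<mu>.quotient_le_energy[OF FL[of n] _ \<epsilon> w(1,2), where t=h] h(2,3)
      by (simp add: add_mono divide_right_mono)
    also have "energy (\<mu> h) (F n) / h \<le> energy (\<mu> h) f / h"
      using h(3) \<mu>.energy_min_le[OF f(1) FL[unfolded F_def]] unfolding F_def by (intro divide_right_mono) auto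
    also have "energy (\<mu> h) f / h \<le> c" using h(1,3) by (simp add: divide_le_eq)
    finally show "(\<integral>x. - a x * q n x \<partial>lborel) \<le> c + e" by simp
  qed
  have "(\<lambda>n. \<integral>x. - a x * q n x \<partial>lborel) \<longlonglongrightarrow> (\<integral>x. - a x / (u x + \<epsilon>) * (f x)\<^sup>2 \<partial>lborel)"
  \<comment> \<open>In the integrable case the limit integrand dominates, since truncating f can
    only shrink the absolute value.\<close>
  proof (rule integral_dominated_convergence[where w="\<lambda>x. \<bar>- a x / (u x + \<epsilon>) * (f x)\<^sup>2\<bar>"])
    show "AE x in lborel. (\<lambda>n. - a x * q n x) \<longlonglongrightarrow> - a x / (u x + \<epsilon>) * (f x)\<^sup>2"
    proof (intro AE_I2 tendsto_eventually)
      fix x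
      obtain k0 :: nat where "f x \<le> real k0" using real_arch_simple by blast
      then show "eventually (\<lambda>k. - a x * q k x = - a x / (u x + \<epsilon>) * (f x)\<^sup>2) sequentially"
        unfolding eventually_sequentially F_def q_def by (intro exI[of _ k0]) auto
    qed
    show "AE x in lborel. norm (- a x * q n x) \<le> \<bar>- a x / (u x + \<epsilon>) * (f x)\<^sup>2\<bar>" for n
    proof (intro AE_I2)
      fix x
      have "(F n x)\<^sup>2 \<le> (f x)\<^sup>2" using F by (intro power_mono) auto
      then have "\<bar>a x\<bar> / (u x + \<epsilon>) * (F n x)\<^sup>2 \<le> \<bar>a x\<bar> / (u x + \<epsilon>) * (f x)\<^sup>2"
        using w(3)[of x] by (intro mult_left_mono) auto
      then show "norm (- a x * q n x) \<le> \<bar>- a x / (u x + \<epsilon>) * (f x)\<^sup>2\<bar>"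
        using w(3)[of x] by (simp add: q_def abs_mult abs_divide)
    qed
    show "integrable lborel (\<lambda>x. \<bar>- a x / (u x + \<epsilon>) * (f x)\<^sup>2\<bar>)" using int by (rule integrable_abs)
  qed (simp_all add: q_def)
  then show ?thesis by (rule LIMSEQ_le_const2) (use qle in auto)
qed

text \<open>The test functions u = R g with the resolvent R and g a truncation of f: since
  (g - u)^2 is nonnegative, u may be replaced by g in the denominator, after which
  the quotient converges to the quadratic form of f.\<close>

lemma lower_bound_witness:
  assumes f: "L2fun f" "\<And>x. 0 \<le> f x" and c: "0 \<le> c" "c' < c"
    and ev: "eventually (\<lambda>t. c * t \<le> energy (\<mu> t) f) (at_right 0)"
  shows "\<exists>u a \<epsilon> C. L2fun u \<and> (\<forall>x. 0 \<le> u x \<and> u x \<le> C) \<and> L2fun a \<and> 0 < \<epsilon> \<and>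
    ((\<lambda>h. sq_int (\<lambda>x. (conv_op (\<mu> h) u x - u x) / h - a x)) \<longlongrightarrow> 0) (at_right 0) \<and>
    c' < (\<integral>x. - a x / (u x + \<epsilon>) * (f x)\<^sup>2 \<partial>lborel) \<and>
    eventually (\<lambda>h. c' < (\<integral>x. ln ((u x + \<epsilon>) / (conv_op (\<mu> h) u x + \<epsilon>)) * (f x)\<^sup>2 \<partial>lborel) / h) (at_right 0)"
proof -
  have [measurable]: "f \<in> borel_measurable borel" using f by (simp add: L2fun_def)
  \<comment> \<open>First l and then n are fixed by strict inequalities that persist near a limit,
    so the test function does not depend on h.\<close>
  obtain l where l: "0 < l" "c' < l * energy (resolvent l) f"
    using resolvent_energy_lower_bound[OF f(1) c ev] by blast
  interpret R: sym_prob "resolvent l" by (rule sym_prob_resolvent[OF l(1)])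
  have "(\<lambda>n. l * (\<integral>x. (min (f x) (real n) - conv_op (resolvent l) (\<lambda>y. min (f y) (real n)) x) / (min (f x) (real n) + 1 / real (Suc n)) * (f x)\<^sup>2 \<partial>lborel))
    \<longlonglongrightarrow> l * energy (resolvent l) f"
    by (intro tendsto_intros R.energy_as_limit f)
  from order_tendstoD(1)[OF this l(2)] obtain n where
    n: "c' < l * (\<integral>x. (min (f x) (real n) - conv_op (resolvent l) (\<lambda>y. min (f y) (real n)) x) / (min (f x) (real n) + 1 / real (Suc n)) * (f x)\<^sup>2 \<partial>lborel)"
    by (auto simp: eventually_sequentially)
  define C where "C = real n"
  define \<epsilon> where "\<epsilon> = 1 / real (Suc n)"
  define g where "g = (\<lambda>x. min (f x) C)"
  define u where "u = conv_op (resolvent l) g"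
  define a where "a = (\<lambda>x. l * (u x - g x))"
  have \<epsilon>: "0 < \<epsilon>" by (simp add: \<epsilon>_def)
  have gm [measurable]: "g \<in> borel_measurable borel" unfolding g_def by measurable
  have g: "0 \<le> g x" "g x \<le> C" for x using f(2)[of x] by (auto simp: g_def C_def)
  have ga: "\<bar>g x\<bar> \<le> C" for x using g[of x] by simp
  have gL: "L2fun g" by (rule L2fun_bound[OF f(1) gm]) (use f g in \<open>auto simp: g_def C_def\<close>)
  have um [measurable]: "u \<in> borel_measurable borel" unfolding u_def by measurable
  have u: "0 \<le> u x" "u x \<le> C" for x using R.conv_op_bounds[OF gm g] by (auto simp: u_def)
  have ua: "\<bar>u x\<bar> \<le> C" for x using u[of x] by simp
  have C: "0 \<le> C" by (simp add: C_def)
  have uL: "L2fun u" unfolding u_def by (rule R.L2fun_conv_op[OF gL ga])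
  have aL: "L2fun a" unfolding a_def by (intro L2fun_cmult L2fun_diff uL gL)
  have am [measurable]: "a \<in> borel_measurable borel" unfolding a_def by measurable
  have ab: "\<bar>a x\<bar> \<le> l * C" for x
    using u[of x] g[of x] l(1) unfolding a_def by (simp add: abs_mult abs_le_iff)
  have gen: "((\<lambda>h. sq_int (\<lambda>x. (conv_op (\<mu> h) u x - u x) / h - a x)) \<longlongrightarrow> 0) (at_right 0)"
    unfolding u_def a_def by (rule resolvent_generator[OF l(1) gL g])
  have div: "\<bar>y / (w + \<epsilon>)\<bar> \<le> K / \<epsilon>" if "\<bar>y\<bar> \<le> K" "0 \<le> w" for y w K :: real
    using that \<epsilon> by (simp add: abs_divide) (intro frac_le; auto)
  define V where "V = (\<integral>x. - a x / (u x + \<epsilon>) * (f x)\<^sup>2 \<partial>lborel)"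
  have iV: "integrable lborel (\<lambda>x. - a x / (u x + \<epsilon>) * (f x)\<^sup>2)"
    by (rule integrable_bounded_weight[OF f(1), where C="l * C / \<epsilon>"]) (measurable, rule div, use ab u in auto)
  have "c' < l * (\<integral>x. (g x - u x) / (g x + \<epsilon>) * (f x)\<^sup>2 \<partial>lborel)"
    using n by (simp add: g_def u_def \<epsilon>_def C_def)
  also have "\<dots> = (\<integral>x. - a x / (g x + \<epsilon>) * (f x)\<^sup>2 \<partial>lborel)"
    unfolding integral_mult_right_zero[symmetric] by (intro Bochner_Integration.integral_cong) (auto simp: a_def algebra_simps)
  also have "\<dots> \<le> V"
    unfolding V_def
  proof (intro integral_mono iV mult_right_mono)
    show "integrable lborel (\<lambda>x. - a x / (g x + \<epsilon>) * (f x)\<^sup>2)"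
      by (rule integrable_bounded_weight[OF f(1), where C="l * C / \<epsilon>"]) (measurable, rule div, use ab g in auto)
    fix x
    have p: "0 < g x + \<epsilon>" "0 < u x + \<epsilon>" using g[of x] u[of x] \<epsilon> by auto
    have "- a x / (u x + \<epsilon>) - - a x / (g x + \<epsilon>) = l * (g x - u x)\<^sup>2 / ((u x + \<epsilon>) * (g x + \<epsilon>))"
      using p by (simp add: a_def field_simps power2_eq_square)
    also have "\<dots> \<ge> 0" using p l(1) by simp
    finally show "- a x / (g x + \<epsilon>) \<le> - a x / (u x + \<epsilon>)" by simp
  qed simp
  finally have V: "c' < V" .
  \<comment> \<open>The generator error divided by the weight. To vanish against the merely
    integrable f^2 it needs a bound uniform in small h besides its L2 convergence.\<close>
  define v where "v = (\<lambda>h x. ((conv_op (\<mu> h) u x - u x) / h - a x) / (u x + \<epsilon>))"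
  have b: "((\<lambda>h. (exp (l * h) - 1) / h) \<longlongrightarrow> l) (at_right 0)"
    by (rule exp_quotient_tendsto)
  \<comment> \<open>Any constant above l would do; it makes the Lipschitz bound on the difference
    quotient uniform near h = 0.\<close>
  have "eventually (\<lambda>h. (exp (l * h) - 1) / h < l + 1) (at_right 0)"
    using b by (rule order_tendstoD(2)) simp
  then have ev1: "eventually (\<lambda>h. (exp (l * h) - 1) / h < l + 1 \<and> 0 < h) (at_right 0)"
    by (intro eventually_conj eventually_at_right_less)
  have TL: "L2fun (\<lambda>x. (conv_op (\<mu> h) u x - u x) / h - a x)" for h
    using L2fun_diff[OF L2fun_cmult[OF L2fun_diff[OF \<mu>.L2fun_conv_op[OF uL ua] uL], of "1/h"] aL] by simp
  have vm: "v h \<in> borel_measurable borel" for h unfolding v_def by measurable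
  have vle: "\<bar>v h x\<bar> \<le> \<bar>1 / \<epsilon> * ((conv_op (\<mu> h) u x - u x) / h - a x)\<bar>" for h x
    using div[OF order_refl u(1)[of x], of "(conv_op (\<mu> h) u x - u x) / h - a x"] \<epsilon>
    unfolding v_def by (simp add: abs_mult)
  have vL: "L2fun (v h)" for h by (rule L2fun_bound[OF L2fun_cmult[OF TL] vm vle])
  have vlim: "((\<lambda>h. \<integral>x. v h x * (f x)\<^sup>2 \<partial>lborel) \<longlongrightarrow> 0) (at_right 0)"
  proof (rule bounded_L2_tendsto_integral[where C="((l + 1) * C + l * C) / \<epsilon>"])
    show "eventually (\<lambda>h. L2fun (v h) \<and> (\<forall>x. \<bar>v h x\<bar> \<le> ((l + 1) * C + l * C) / \<epsilon>)) (at_right 0)"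
      using ev1
    proof eventually_elim
      case (elim h)
      have "\<bar>v h x\<bar> \<le> ((l + 1) * C + l * C) / \<epsilon>" for x
        unfolding v_def
      proof (rule div[OF _ u(1)])
        have "\<bar>conv_op (\<mu> h) u x - u x\<bar> \<le> (exp (l * h) - 1) * C"
          unfolding u_def using elim by (intro resolvent_lipschitz[OF l(1) _ gm g]) auto
        then have "\<bar>(conv_op (\<mu> h) u x - u x) / h\<bar> \<le> (exp (l * h) - 1) / h * C"
          using elim by (simp add: abs_divide divide_right_mono)
        also have "\<dots> \<le> (l + 1) * C" using elim C by (intro mult_right_mono) auto
        finally show "\<bar>(conv_op (\<mu> h) u x - u x) / h - a x\<bar> \<le> (l + 1) * C + l * C"
          using ab[of x] by linarith
      qed
      then show ?case using vL by auto
    qed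
    have "((\<lambda>h. (1 / \<epsilon>)\<^sup>2 * sq_int (\<lambda>x. (conv_op (\<mu> h) u x - u x) / h - a x)) \<longlongrightarrow> (1 / \<epsilon>)\<^sup>2 * 0) (at_right 0)"
      by (intro tendsto_intros gen)
    then have lim: "((\<lambda>h. (1 / \<epsilon>)\<^sup>2 * sq_int (\<lambda>x. (conv_op (\<mu> h) u x - u x) / h - a x)) \<longlongrightarrow> 0) (at_right 0)" by simp
    have "sq_int (v h) \<le> (1 / \<epsilon>)\<^sup>2 * sq_int (\<lambda>x. (conv_op (\<mu> h) u x - u x) / h - a x)" for h
      unfolding sq_int_cmult[symmetric] unfolding sq_int_def
      using vle by (intro integral_mono L2fun_integrable vL L2fun_cmult TL) (simp only: abs_le_square_iff[symmetric])
    then show "((\<lambda>h. sq_int (v h)) \<longlongrightarrow> 0) (at_right 0)"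
      by (intro tendsto_sandwich[OF _ _ tendsto_const lim]) (auto intro!: always_eventually)
  qed (use f in \<open>auto simp: L2fun_def\<close>)
  then have "((\<lambda>h. V - (\<integral>x. v h x * (f x)\<^sup>2 \<partial>lborel)) \<longlongrightarrow> V - 0) (at_right 0)"
    by (intro tendsto_intros)
  then have "eventually (\<lambda>h. c' < V - (\<integral>x. v h x * (f x)\<^sup>2 \<partial>lborel)) (at_right 0)"
    by (rule order_tendstoD(1)) (use V in simp)
  then have evphi: "eventually (\<lambda>h. c' < (\<integral>x. ln ((u x + \<epsilon>) / (conv_op (\<mu> h) u x + \<epsilon>)) * (f x)\<^sup>2 \<partial>lborel) / h) (at_right 0)"
    using eventually_at_right_less[of 0]
  proof eventually_elim
    case (elim h)
    note T = \<mu>.conv_op_bounds[OF um u, of h]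
    have iL: "integrable lborel (\<lambda>x. ln ((u x + \<epsilon>) / (conv_op (\<mu> h) u x + \<epsilon>)) * (f x)\<^sup>2)"
      by (rule integrable_bounded_weight[OF f(1) _ abs_ln_conv_quotient_le[OF um u \<epsilon>]]) measurable
    have Db: "\<bar>(u x - conv_op (\<mu> h) u x) / (u x + \<epsilon>)\<bar> \<le> C / \<epsilon>" for x
      by (rule div) (use u[of x] T[of x] in auto)
    have iD: "integrable lborel (\<lambda>x. (u x - conv_op (\<mu> h) u x) / (u x + \<epsilon>) * (f x)\<^sup>2)"
      by (rule integrable_bounded_weight[OF f(1) _ Db]) measurable
    have alg: "((t - b) / h - a') / d * s = - a' / d * s - (b - t) / d * s / h" for t b a' d s :: real
      by (cases "h = 0"; cases "d = 0") (simp_all add: field_simps)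
    have veq: "v h x * (f x)\<^sup>2 = - a x / (u x + \<epsilon>) * (f x)\<^sup>2 - (u x - conv_op (\<mu> h) u x) / (u x + \<epsilon>) * (f x)\<^sup>2 / h" for x
      unfolding v_def by (rule alg)
    have iv: "integrable lborel (\<lambda>x. v h x * (f x)\<^sup>2)"
      unfolding veq using iV iD by (intro Bochner_Integration.integrable_diff integrable_divide) auto
    have "V - (\<integral>x. v h x * (f x)\<^sup>2 \<partial>lborel) = (\<integral>x. - a x / (u x + \<epsilon>) * (f x)\<^sup>2 - v h x * (f x)\<^sup>2 \<partial>lborel)"
      unfolding V_def by (rule Bochner_Integration.integral_diff[OF iV iv, symmetric])
    also have "\<dots> = (\<integral>x. (u x - conv_op (\<mu> h) u x) / (u x + \<epsilon>) * (f x)\<^sup>2 / h \<partial>lborel)"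
      unfolding veq by simp
    also have "\<dots> = (\<integral>x. (u x - conv_op (\<mu> h) u x) / (u x + \<epsilon>) * (f x)\<^sup>2 \<partial>lborel) / h" by (rule integral_divide_zero)
    \<comment> \<open>From ln y \<le> y - 1 for the ratio y of the weights: the logarithmic
      functional dominates its linearisation at every h.\<close>
    also have "\<dots> \<le> (\<integral>x. ln ((u x + \<epsilon>) / (conv_op (\<mu> h) u x + \<epsilon>)) * (f x)\<^sup>2 \<partial>lborel) / h"
    proof (intro divide_right_mono integral_mono iD iL mult_right_mono)
      fix x
      have p: "0 < conv_op (\<mu> h) u x + \<epsilon>" "0 < u x + \<epsilon>" using T(1)[of x] u(1)[of x] \<epsilon> by auto
      have "ln ((conv_op (\<mu> h) u x + \<epsilon>) / (u x + \<epsilon>)) \<le> (conv_op (\<mu> h) u x + \<epsilon>) / (u x + \<epsilon>) - 1"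
        using p by (intro ln_le_minus_one) simp
      also have "\<dots> = - ((u x - conv_op (\<mu> h) u x) / (u x + \<epsilon>))" using p by (simp add: field_simps)
      finally show "(u x - conv_op (\<mu> h) u x) / (u x + \<epsilon>) \<le> ln ((u x + \<epsilon>) / (conv_op (\<mu> h) u x + \<epsilon>))"
        using p by (simp add: ln_div)
    qed (use elim in auto)
    finally show ?case using elim(1) by simp
  qed
  show ?thesis
    by (intro exI[of _ u] exI[of _ a] exI[of _ \<epsilon>] exI[of _ C] conjI allI uL u aL \<epsilon> gen V[unfolded V_def] evphi)
qed

end

section \<open>From the given definitions to the abstract semigroup\<close>

lemma levy_law_semigroup:
  fixes A :: "real^'n^'n"
  assumes "transpose A = A" and "\<And>\<xi>. 0 \<le> \<xi> \<bullet> (A *v \<xi>)" and "levy_measure \<nu>"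
  shows "sym_conv_semigroup (levy_law A \<nu>)"
proof (rule sym_conv_semigroup.intro)
  show "sym_prob (levy_law A \<nu> t)" for t
    using levy_law[OF assms] levy_law_symmetric[OF assms] by (simp add: sym_prob_def sym_prob_axioms_def)
  show "(levy_law A \<nu> s \<star> levy_law A \<nu> t) = levy_law A \<nu> (s + t)" if "0 \<le> s" "0 \<le> t" for s t
    by (rule levy_law_convolution[OF assms that])
  show "levy_law A \<nu> \<in> borel \<rightarrow>\<^sub>M prob_algebra borel" by (rule levy_law_kernel[OF assms])
  show "((\<lambda>t. measure (levy_law A \<nu> t) {x. r \<le> norm x}) \<longlongrightarrow> 0) (at_right 0)" if "0 < r" for r
    by (rule levy_law_concentrates[OF assms that])
  show "levy_law A \<nu> 0 = return borel 0" by (simp add: levy_law_def)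
qed

lemma semigroup_T_eq: "0 < h \<Longrightarrow> semigroup_T A \<nu> h g x = conv_op (levy_law A \<nu> h) g x"
  by (simp add: semigroup_T_def conv_op_def levy_law_def)

lemma gen_limit_iff:
  "gen_limit A \<nu> g a \<longleftrightarrow> L2fun a \<and>
    ((\<lambda>h. sq_int (\<lambda>x. (conv_op (levy_law A \<nu> h) g x - g x) / h - a x)) \<longlongrightarrow> 0) (at_right 0)"
proof -
  have "((\<lambda>h. L2norm (\<lambda>x. (semigroup_T A \<nu> h g x - g x) / h - a x)) \<longlongrightarrow> 0) (at_right 0) \<longleftrightarrow>
    ((\<lambda>h. L2norm (\<lambda>x. (conv_op (levy_law A \<nu> h) g x - g x) / h - a x)) \<longlongrightarrow> 0) (at_right 0)"
    by (rule tendsto_cong) (use eventually_at_right_less[of 0] in \<open>eventually_elim, simp add: semigroup_T_eq\<close>)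
  then show ?thesis by (simp add: gen_limit_def tendsto_L2norm_iff)
qed

text \<open>The generator is a \<open>SOME\<close> choice, determined only up to null sets; this
  lets an explicit L2 limit replace it under an integral.\<close>

lemma (in sym_conv_semigroup) generator_unique:
  assumes uL: "L2fun u" and u: "\<And>x. \<bar>u x\<bar> \<le> C"
    and a: "L2fun a" "((\<lambda>h. sq_int (\<lambda>x. (conv_op (\<mu> h) u x - u x) / h - a x)) \<longlongrightarrow> 0) (at_right 0)"
    and b: "L2fun b" "((\<lambda>h. sq_int (\<lambda>x. (conv_op (\<mu> h) u x - u x) / h - b x)) \<longlongrightarrow> 0) (at_right 0)"
  shows "AE x in lborel. a x = b x"
proof -
  have TL: "L2fun (\<lambda>x. (conv_op (\<mu> h) u x - u x) / h)" for h
    using L2fun_cmult[OF L2fun_diff[OF \<mu>.L2fun_conv_op[OF uL u] uL], of "1/h"] by simp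
  have ab: "L2fun (\<lambda>x. a x - b x)" by (rule L2fun_diff[OF a(1) b(1)])
  have le: "sq_int (\<lambda>x. a x - b x) \<le> 2 * sq_int (\<lambda>x. (conv_op (\<mu> h) u x - u x) / h - b x) + 2 * sq_int (\<lambda>x. (conv_op (\<mu> h) u x - u x) / h - a x)" for h
    using sq_int_diff_le[OF L2fun_diff[OF TL[of h] b(1)] L2fun_diff[OF TL[of h] a(1)]] by simp
  have "((\<lambda>h. 2 * sq_int (\<lambda>x. (conv_op (\<mu> h) u x - u x) / h - b x) + 2 * sq_int (\<lambda>x. (conv_op (\<mu> h) u x - u x) / h - a x)) \<longlongrightarrow> 2 * 0 + 2 * 0) (at_right 0)"
    by (intro tendsto_intros a b)
  then have "sq_int (\<lambda>x. a x - b x) \<le> 2 * 0 + 2 * 0"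
    by (rule tendsto_lowerbound) (use le in \<open>auto intro!: always_eventually\<close>)
  then have "sq_int (\<lambda>x. a x - b x) = 0" using sq_int_nonneg[of "\<lambda>x. a x - b x"] by simp
  then have "AE x in lborel. (a x - b x)\<^sup>2 = 0"
    unfolding sq_int_def by (subst (asm) integral_nonneg_eq_0_iff_AE[OF L2fun_integrable[OF ab]]) auto
  then show ?thesis by eventually_elim simp
qed

text \<open>Tonelli gives the product of the two masses as a bound. At points where the inner
  integrand is not integrable the marginal is 0 by default, which keeps it below the Tonelli
  integral.\<close>

lemma integrable_marginal:
  fixes p \<pi> :: "real^'n \<Rightarrow> real"
  assumes [measurable]: "p \<in> borel_measurable borel" "\<pi> \<in> borel_measurable borel"
    and p: "\<And>x. 0 \<le> p x" and \<pi>: "\<And>\<theta>. 0 \<le> \<pi> \<theta>"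
    and "(\<integral>\<^sup>+x. ennreal (p x) \<partial>lborel) < \<infinity>" "(\<integral>\<^sup>+\<theta>. ennreal (\<pi> \<theta>) \<partial>lborel) < \<infinity>"
  shows "integrable lborel (marginal p \<pi>)" and "0 \<le> marginal p \<pi> x"
proof -
  show nonneg: "0 \<le> marginal p \<pi> x" for x
    unfolding marginal_def using p \<pi> by (intro integral_nonneg_AE) auto
  have [measurable]: "marginal p \<pi> \<in> borel_measurable borel" unfolding marginal_def[abs_def] by measurable
  have "(\<integral>\<^sup>+x. ennreal (norm (marginal p \<pi> x)) \<partial>lborel) \<le> (\<integral>\<^sup>+x. \<integral>\<^sup>+\<theta>. ennreal (p (x - \<theta>) * \<pi> \<theta>) \<partial>lborel \<partial>lborel)"
  proof (rule nn_integral_mono)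
    fix x
    have "ennreal (norm (marginal p \<pi> x)) \<le> (\<integral>\<^sup>+\<theta>. ennreal (norm (p (x - \<theta>) * \<pi> \<theta>)) \<partial>lborel)"
      unfolding marginal_def using integral_norm_bound_ennreal[of lborel "\<lambda>\<theta>. p (x - \<theta>) * \<pi> \<theta>"]
      by (cases "integrable lborel (\<lambda>\<theta>. p (x - \<theta>) * \<pi> \<theta>)") (simp_all add: not_integrable_integral_eq)
    then show "ennreal (norm (marginal p \<pi> x)) \<le> (\<integral>\<^sup>+\<theta>. ennreal (p (x - \<theta>) * \<pi> \<theta>) \<partial>lborel)"
      using p \<pi> by simp
  qed
  also have "\<dots> = (\<integral>\<^sup>+\<theta>. \<integral>\<^sup>+x. ennreal (p (x - \<theta>) * \<pi> \<theta>) \<partial>lborel \<partial>lborel)"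
    by (rule lborel_pair.Fubini') measurable
  also have "\<dots> = (\<integral>\<^sup>+\<theta>. (\<integral>\<^sup>+x. ennreal (p x) \<partial>lborel) * ennreal (\<pi> \<theta>) \<partial>lborel)"
  proof (rule nn_integral_cong)
    fix \<theta>
    have "(\<integral>\<^sup>+x. ennreal (p x) \<partial>lborel) = (\<integral>\<^sup>+x. ennreal (p x) \<partial>distr lborel borel ((+) (- \<theta>)))"
      by (simp add: lborel_distr_plus)
    also have "\<dots> = (\<integral>\<^sup>+x. ennreal (p (x - \<theta>)) \<partial>lborel)" by (subst nn_integral_distr) auto
    finally show "(\<integral>\<^sup>+x. ennreal (p (x - \<theta>) * \<pi> \<theta>) \<partial>lborel) = (\<integral>\<^sup>+x. ennreal (p x) \<partial>lborel) * ennreal (\<pi> \<theta>)"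
      using p \<pi> by (simp add: ennreal_mult nn_integral_multc)
  qed
  also have "\<dots> = (\<integral>\<^sup>+x. ennreal (p x) \<partial>lborel) * (\<integral>\<^sup>+\<theta>. ennreal (\<pi> \<theta>) \<partial>lborel)"
    by (rule nn_integral_cmult) measurable
  also have "\<dots> < \<infinity>" using assms(5,6) by (simp add: ennreal_mult_less_top)
  finally show "integrable lborel (marginal p \<pi>)" by (simp add: integrable_iff_bounded)
qed

section \<open>Both functionals squeezed onto the liminf of the energy quotient\<close>

theorem theorem6:
  fixes A :: "real^'n^'n" and \<nu> :: "(real^'n) measure" and \<gamma> :: "real^'n"
    and p :: "real^'n \<Rightarrow> real" and \<pi> :: "real^'n \<Rightarrow> real"
  assumes A_sym: "transpose A = A"
    and A_psd: "\<forall>\<xi>. 0 \<le> \<xi> \<bullet> (A *v \<xi>)"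
    and levy: "levy_measure \<nu>"
    and p_meas: "p \<in> borel_measurable borel" and p_nonneg: "\<forall>x. 0 \<le> p x"
    and p_density: "is_ID (density lborel (\<lambda>x. ennreal (p x))) A \<nu> \<gamma>"
    and pi_meas: "\<pi> \<in> borel_measurable borel" and pi_nonneg: "\<forall>\<theta>. 0 \<le> \<pi> \<theta>"
    and pi_prob: "(\<integral>\<^sup>+\<theta>. ennreal (\<pi> \<theta>) \<partial>lborel) = 1"
    and pi_sym: "\<forall>\<theta>. \<pi> (- \<theta>) = \<pi> \<theta>"
  shows "((\<lambda>h. ereal (1 / h) *
            Sup {ereal (phi_fun A \<nu> (marginal p \<pi>) h g \<epsilon>) | g \<epsilon>.
                   gen_dom A \<nu> g \<and> (\<forall>x. 0 \<le> g x) \<and> 0 < \<epsilon>})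
          \<longlongrightarrow> fisher_I A \<nu> (marginal p \<pi>)) (at_right 0)"
proof -
  interpret S: sym_conv_semigroup "levy_law A \<nu>"
    using levy_law_semigroup[OF A_sym _ levy] A_psd by blast
  let ?\<mu> = "levy_law A \<nu>"
  have "(\<integral>\<^sup>+x. ennreal (p x) \<partial>lborel) = 1"
    using p_density p_meas prob_space.emeasure_space_1 by (force simp: is_ID_def emeasure_density)
  then have M: "integrable lborel (marginal p \<pi>)" "\<And>x. 0 \<le> marginal p \<pi> x"
    using integrable_marginal[of p \<pi>] p_meas pi_meas p_nonneg pi_nonneg pi_prob by auto
  define f where "f = (\<lambda>x. sqrt (marginal p \<pi> x))"
  have [measurable]: "marginal p \<pi> \<in> borel_measurable borel" using M by auto
  have f2: "marginal p \<pi> x = (f x)\<^sup>2" for x using M(2) by (simp add: f_def)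
  have f0: "0 \<le> f x" for x by (simp add: f_def M(2))
  have fL: "L2fun f"
    unfolding L2fun_def f2[symmetric] using M(1) unfolding f_def by simp
  define \<Phi> where "\<Phi> = (\<lambda>h. Sup {ereal (phi_fun A \<nu> (marginal p \<pi>) h g \<epsilon>) | g \<epsilon>. gen_dom A \<nu> g \<and> (\<forall>x. 0 \<le> g x) \<and> 0 < \<epsilon>})"
  have phi: "phi_fun A \<nu> (marginal p \<pi>) h g \<epsilon> = (\<integral>x. ln ((g x + \<epsilon>) / (conv_op (?\<mu> h) g x + \<epsilon>)) * (f x)\<^sup>2 \<partial>lborel)"
    if "0 < h" for h g \<epsilon>
    using that by (simp add: phi_fun_def semigroup_T_eq f2)
  \<comment> \<open>Taken in the extended reals, so that an infinite value is covered by the same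
    argument.\<close>
  define E where "E = Liminf (at_right 0) (\<lambda>t. ereal (energy (?\<mu> t) f / t))"
  have E0: "0 \<le> E"
    unfolding E_def
  proof (rule Liminf_bounded)
    show "eventually (\<lambda>t. 0 \<le> ereal (energy (?\<mu> t) f / t)) (at_right 0)"
      using eventually_at_right_less[of 0] by eventually_elim (simp add: S.\<mu>.energy_nonneg)
  qed
  have freq: "\<exists>\<^sub>F t in at_right 0. energy (?\<mu> t) f < c * t" if "E < ereal c" for c
  proof (rule ccontr)
    assume "\<not> (\<exists>\<^sub>F t in at_right 0. energy (?\<mu> t) f < c * t)"
    then have "eventually (\<lambda>t. c * t \<le> energy (?\<mu> t) f) (at_right 0)"
      by (simp add: not_frequently not_less)
    then have "eventually (\<lambda>t. ereal c \<le> ereal (energy (?\<mu> t) f / t)) (at_right 0)"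
      using eventually_at_right_less[of 0] by eventually_elim (simp add: le_divide_eq)
    then have "ereal c \<le> E" unfolding E_def by (rule Liminf_bounded)
    then show False using that by simp
  qed
  have ev: "eventually (\<lambda>t. c * t \<le> energy (?\<mu> t) f) (at_right 0)" if "ereal c < E" for c
  proof -
    have "eventually (\<lambda>t. ereal c < ereal (energy (?\<mu> t) f / t)) (at_right 0)"
      using that unfolding E_def by (rule less_LiminfD)
    then show ?thesis
      using eventually_at_right_less[of 0] by eventually_elim (simp add: less_divide_eq less_imp_le)
  qed
  \<comment> \<open>Lets upper bounds be proved for real c above E only: an infinite E gives nothing
    to prove, and for a finite one a slack e / h in c costs e.\<close>
  have leE: "x \<le> ereal h * E" if "\<And>c. 0 \<le> c \<Longrightarrow> E < ereal c \<Longrightarrow> x \<le> ereal (h * c)" "0 < h" for x h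
  proof (cases E)
    case (real r)
    have "x \<le> ereal (h * r) + ereal e" if "0 < e" for e
    proof -
      have "x \<le> ereal (h * (r + e / h))"
        using that \<open>0 < h\<close> real E0 by (intro \<open>\<And>c. 0 \<le> c \<Longrightarrow> E < ereal c \<Longrightarrow> x \<le> ereal (h * c)\<close>) auto
      then show ?thesis using \<open>0 < h\<close> by (simp add: distrib_left)
    qed
    then have "x \<le> ereal (h * r)" by (rule ereal_le_epsilon2)
    then show ?thesis using real by simp
  next
    case PInf
    then show ?thesis using that(2) by simp
  next
    case MInf
    then show ?thesis using E0 by simp
  qed
  have upper: "ereal (1 / h) * \<Phi> h \<le> E" if h: "0 < h" for h
  proof -
    have "\<Phi> h \<le> ereal h * E"
    proof (rule leE[OF _ h])
      fix c assume c: "0 \<le> c" "E < ereal c"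
      show "\<Phi> h \<le> ereal (h * c)"
        unfolding \<Phi>_def
      proof (rule Sup_least)
        fix y assume "y \<in> {ereal (phi_fun A \<nu> (marginal p \<pi>) h g \<epsilon>) | g \<epsilon>. gen_dom A \<nu> g \<and> (\<forall>x. 0 \<le> g x) \<and> 0 < \<epsilon>}"
        then obtain g \<epsilon> where g: "y = ereal (phi_fun A \<nu> (marginal p \<pi>) h g \<epsilon>)" "L2fun g" "\<And>x. 0 \<le> g x" "0 < \<epsilon>"
          by (auto simp: gen_dom_def)
        show "y \<le> ereal (h * c)"
          unfolding g(1) phi[OF h] using S.phi_le[OF fL g(2-4) h c(1) freq[OF c(2)]] by simp
      qed
    qed
    then have "ereal (1 / h) * \<Phi> h \<le> ereal (1 / h) * (ereal h * E)"
      using h by (intro ereal_mult_left_mono) auto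
    also have "\<dots> = E" using h by (simp add: mult.assoc[symmetric])
    finally show ?thesis .
  qed
  have fisher_ub: "ereal (\<integral>x. - generator A \<nu> u x / (u x + \<epsilon>) * marginal p \<pi> x \<partial>lborel) \<le> fisher_I A \<nu> (marginal p \<pi>)"
    if "u \<in> borel_measurable borel" "bounded (range u)" "\<forall>x. 0 \<le> u x" "gen_dom A \<nu> u" "0 < \<epsilon>" for u \<epsilon>
    unfolding fisher_I_def by (rule Sup_upper, intro CollectI exI[of _ u] exI[of _ \<epsilon>] conjI refl that)
  have \<Phi>_ub: "ereal (phi_fun A \<nu> (marginal p \<pi>) h g \<epsilon>) \<le> \<Phi> h"
    if "gen_dom A \<nu> g" "\<forall>x. 0 \<le> g x" "0 < \<epsilon>" for h g \<epsilon>
    unfolding \<Phi>_def by (rule Sup_upper, intro CollectI exI[of _ g] exI[of _ \<epsilon>] conjI refl that)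
  \<comment> \<open>One pair of \<open>u\<close> and \<epsilon> serves both functionals: it is
    admissible in each supremum, and being independent of h it bounds the logarithmic one at all
    small h.\<close>
  have lower: "ereal c' < fisher_I A \<nu> (marginal p \<pi>) \<and> eventually (\<lambda>h. ereal c' < ereal (1 / h) * \<Phi> h) (at_right 0)"
    if c: "0 \<le> c" "c' < c" "ereal c < E" for c c'
  proof -
    from S.lower_bound_witness[OF fL f0 c(1,2) ev[OF c(3)]]
    obtain u a \<epsilon> C where uL: "L2fun u" and uC: "\<forall>x. 0 \<le> u x \<and> u x \<le> C" and a: "L2fun a" and \<epsilon>: "0 < \<epsilon>"
      and gen: "((\<lambda>h. sq_int (\<lambda>x. (conv_op (?\<mu> h) u x - u x) / h - a x)) \<longlongrightarrow> 0) (at_right 0)"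
      and V: "c' < (\<integral>x. - a x / (u x + \<epsilon>) * (f x)\<^sup>2 \<partial>lborel)"
      and \<phi>: "eventually (\<lambda>h. c' < (\<integral>x. ln ((u x + \<epsilon>) / (conv_op (?\<mu> h) u x + \<epsilon>)) * (f x)\<^sup>2 \<partial>lborel) / h) (at_right 0)"
      by (elim exE conjE) (rule that; assumption)
    have u: "L2fun u" "\<And>x. 0 \<le> u x" "\<And>x. u x \<le> C" using uL uC by auto
    have ua: "\<bar>u x\<bar> \<le> C" for x using u(2,3)[of x] by simp
    have [measurable]: "u \<in> borel_measurable borel" using u by (simp add: L2fun_def)
    have gl: "gen_limit A \<nu> u a" unfolding gen_limit_iff using a gen by simp
    then have dom: "gen_dom A \<nu> u" using u(1) by (auto simp: gen_dom_def)
    have gl': "gen_limit A \<nu> u (generator A \<nu> u)"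
      unfolding generator_def using someI[of "gen_limit A \<nu> u", OF gl] .
    have AE: "AE x in lborel. generator A \<nu> u x = a x"
      using gl gl' unfolding gen_limit_iff by (intro S.generator_unique[OF u(1) ua]) auto
    have [measurable]: "generator A \<nu> u \<in> borel_measurable borel" "a \<in> borel_measurable borel" "f \<in> borel_measurable borel"
      using gl gl' fL unfolding gen_limit_iff by (auto simp: L2fun_def)
    have "(\<integral>x. - generator A \<nu> u x / (u x + \<epsilon>) * marginal p \<pi> x \<partial>lborel) = (\<integral>x. - a x / (u x + \<epsilon>) * (f x)\<^sup>2 \<partial>lborel)"
      by (rule integral_cong_AE) (measurable, use AE in \<open>eventually_elim, simp add: f2\<close>)
    then have "ereal c' < ereal (\<integral>x. - generator A \<nu> u x / (u x + \<epsilon>) * marginal p \<pi> x \<partial>lborel)"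
      using V by simp
    also have "\<dots> \<le> fisher_I A \<nu> (marginal p \<pi>)"
      using ua u(2) by (intro fisher_ub dom \<epsilon>) (auto simp: bounded_iff)
    finally have 1: "ereal c' < fisher_I A \<nu> (marginal p \<pi>)" .
    have 2: "eventually (\<lambda>h. ereal c' < ereal (1 / h) * \<Phi> h) (at_right 0)"
      using \<phi> eventually_at_right_less[of 0]
    proof eventually_elim
      case (elim h)
      have "ereal (phi_fun A \<nu> (marginal p \<pi>) h u \<epsilon>) \<le> \<Phi> h"
        using u(2) by (intro \<Phi>_ub dom \<epsilon>) auto
      then have "ereal (1 / h) * ereal (phi_fun A \<nu> (marginal p \<pi>) h u \<epsilon>) \<le> ereal (1 / h) * \<Phi> h"
        using elim(2) by (intro ereal_mult_left_mono) auto
      moreover have "ereal c' < ereal (1 / h) * ereal (phi_fun A \<nu> (marginal p \<pi>) h u \<epsilon>)"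
        using elim by (simp add: phi)
      ultimately show ?case by (rule less_le_trans[rotated])
    qed
    show ?thesis using 1 2 by blast
  qed
  \<comment> \<open>A level strictly between \<open>c'\<close> and E provides the gap that the
    witness requires.\<close>
  have between: "ereal c' < fisher_I A \<nu> (marginal p \<pi>) \<and> eventually (\<lambda>h. ereal c' < ereal (1 / h) * \<Phi> h) (at_right 0)"
    if "0 \<le> c'" "ereal c' < E" for c'
    using ereal_dense2[OF that(2)] that(1) lower[of _ c'] by force
  \<comment> \<open>The zero function gives the value 0 in both suprema. This settles negative
    levels, which \<open>between\<close> does not reach.\<close>
  have sq0: "sq_int (\<lambda>x::real^'n. 0) = 0" by (simp add: sq_int_def)
  have gl0: "gen_limit A \<nu> (\<lambda>_. 0) (\<lambda>_. 0)"
    unfolding gen_limit_iff by (simp add: sq0 L2fun_def)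
  then have dom0: "gen_dom A \<nu> (\<lambda>_. 0)" by (auto simp: gen_dom_def L2fun_def)
  have gl0': "gen_limit A \<nu> (\<lambda>_. 0) (generator A \<nu> (\<lambda>_. 0))"
    unfolding generator_def using someI[of "gen_limit A \<nu> (\<lambda>_. 0)", OF gl0] .
  have fisher0: "0 \<le> fisher_I A \<nu> (marginal p \<pi>)"
  proof -
    have "AE x in lborel. generator A \<nu> (\<lambda>_. 0) x = 0"
      using gl0 gl0' unfolding gen_limit_iff
      by (intro S.generator_unique[of "\<lambda>_. 0" 0]) (auto simp: L2fun_def)
    then have "AE x in lborel. - generator A \<nu> (\<lambda>_. 0) x / (0 + 1) * marginal p \<pi> x = 0"
      by eventually_elim simp
    then have "(\<integral>x. - generator A \<nu> (\<lambda>_. 0) x / (0 + 1) * marginal p \<pi> x \<partial>lborel) = 0"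
      by (rule integral_eq_zero_AE)
    then show ?thesis
      using fisher_ub[of "\<lambda>_. 0" 1, OF _ _ _ dom0] by (simp only: zero_ereal_def) simp
  qed
  have \<Phi>0: "0 \<le> \<Phi> h" if "0 < h" for h
    using \<Phi>_ub[OF dom0, of 1 h] phi[OF that, of "\<lambda>_. 0" 1] by (simp add: zero_ereal_def)
  have "fisher_I A \<nu> (marginal p \<pi>) \<le> ereal 1 * E"
  proof (rule leE)
    fix c assume c: "0 \<le> c" "E < ereal c"
    show "fisher_I A \<nu> (marginal p \<pi>) \<le> ereal (1 * c)"
      unfolding fisher_I_def
    proof (rule Sup_least)
      fix y assume "y \<in> {ereal (\<integral>x. - generator A \<nu> u x / (u x + \<epsilon>) * marginal p \<pi> x \<partial>lborel) | u \<epsilon>.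
        u \<in> borel_measurable borel \<and> bounded (range u) \<and> (\<forall>x. 0 \<le> u x) \<and> gen_dom A \<nu> u \<and> 0 < \<epsilon>}"
      then obtain u \<epsilon> where y: "y = ereal (\<integral>x. - generator A \<nu> u x / (u x + \<epsilon>) * (f x)\<^sup>2 \<partial>lborel)"
        and u: "bounded (range u)" "\<And>x. 0 \<le> u x" "gen_dom A \<nu> u" "0 < \<epsilon>"
        by (auto simp: f2)
      obtain C where uC: "\<And>x. u x \<le> C" using u(1) by (auto simp: bounded_iff abs_le_iff)
      have "gen_limit A \<nu> u (generator A \<nu> u)"
        unfolding generator_def using u(3) someI_ex[of "gen_limit A \<nu> u"] by (simp add: gen_dom_def)
      then have gen: "L2fun (generator A \<nu> u)"
        "((\<lambda>h. sq_int (\<lambda>x. (conv_op (?\<mu> h) u x - u x) / h - generator A \<nu> u x)) \<longlongrightarrow> 0) (at_right 0)"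
        unfolding gen_limit_iff by auto
      have uL: "L2fun u" using u(3) by (simp add: gen_dom_def)
      show "y \<le> ereal (1 * c)"
        unfolding y using S.fisher_le[OF fL f0 uL u(2) uC gen u(4) c(1) freq[OF c(2)]] by simp
    qed
  qed simp
  moreover have "E \<le> fisher_I A \<nu> (marginal p \<pi>)"
  proof (rule ccontr)
    assume "\<not> E \<le> fisher_I A \<nu> (marginal p \<pi>)"
    then obtain c' where c': "fisher_I A \<nu> (marginal p \<pi>) < ereal c'" "ereal c' < E"
      using ereal_dense2[of "fisher_I A \<nu> (marginal p \<pi>)" E] by (auto simp: not_le)
    then have "0 \<le> c'" using le_less_trans[OF fisher0 c'(1)] by simp
    then show False using between[of c'] c' by auto
  qed
  ultimately have eq: "fisher_I A \<nu> (marginal p \<pi>) = E" by simp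
  have "((\<lambda>h. ereal (1 / h) * \<Phi> h) \<longlongrightarrow> E) (at_right 0)"
  proof (rule order_tendstoI)
    fix y assume "y < E"
    show "eventually (\<lambda>h. y < ereal (1 / h) * \<Phi> h) (at_right 0)"
    \<comment> \<open>At negative levels, nonnegativity of the supremum suffices; otherwise a real
      level between y and E is fed to \<open>between\<close>.\<close>
    proof (cases "y < 0")
      case True
      show ?thesis
        using eventually_at_right_less[of 0]
      proof eventually_elim
        case (elim h)
        then have "0 \<le> ereal (1 / h) * \<Phi> h" using \<Phi>0 by simp
        then show ?case using True by (rule less_le_trans[rotated])
      qed
    next
      case False
      obtain c' where c': "y < ereal c'" "ereal c' < E" using ereal_dense2[OF \<open>y < E\<close>] by blast
      have "0 < ereal c'" using False c'(1) by (metis le_less_trans not_less)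
      then have "eventually (\<lambda>h. ereal c' < ereal (1 / h) * \<Phi> h) (at_right 0)" using between[of c'] c'(2) by simp
      then show ?thesis by eventually_elim (rule less_trans[OF c'(1)])
    qed
  next
    fix y assume "E < y"
    then show "eventually (\<lambda>h. ereal (1 / h) * \<Phi> h < y) (at_right 0)"
      using eventually_at_right_less[of 0] by (auto elim!: eventually_mono intro: le_less_trans[OF upper])
  qed
  then show ?thesis unfolding eq \<Phi>_def .
qed

end
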